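(* Let $\mathcal{F}$ be a primitive subequation on an open set $X\subset\mathbb{R}^n$ and let $u:X\to\mathbb{R}$ be a locally semiconvex function. Then $$(u(x),Du(x),D^2u(x))\in\mathcal{F}_x\ \text{ for almost all } x\in X\quad\iff\quad u\in\mathcal{F}(X).$$
   Context: $\mathcal{S}(n)$ is the space of real symmetric $n\times n$ matrices with the Loewner order; $\mathcal{J}^2=\mathbb{R}\times\mathbb{R}^n\times\mathcal{S}(n)$, $\mathcal{J}^2(X)=X\times\mathcal{J}^2$. For $\mathcal{F}\subset\mathcal{J}^2(X)$ the fiber over $x$ is $\mathcal{F}_x=\{(r,p,A)\in\mathcal{J}^2:(x,r,p,A)\in\mathcal{F}\}$. $\mathcal{F}$ is a primitive subequation on $X$ if $\mathcal{F}$ is closed in $\mathcal{J}^2(X)$ and satisfies positivity: $(r,p,A)\in\mathcal{F}_x\Rightarrow(r,p,A+P)\in\mathcal{F}_x$ for all $P>0$ in $\mathcal{S}(n)$ and all $x\in X$. A function $u:X\to\mathbb{R}$ is locally semiconvex if every $x\in X$ belongs to some ball $B\subset X$ such that $u+\frac{\lambda}{2}|\cdot|^2$ is convex on $B$ for some $\lambda=\lambda(x)\geq0$. $\mathcal{F}(X)$ is the set of $\mathcal{F}$-subharmonic functions (viscosity sense): upper semicontinuous $u:X\to[-\infty,+\infty)$ such that for every $x\in X$ and every function $\varphi$ which is $C^2$ near $x$ with $u-\varphi\leq0$ near $x$ and $u-\varphi=0$ at $x$, one has $(\varphi(x),D\varphi(x),D^2\varphi(x))\in\mathcal{F}_x$.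 "Almost all" refers to Lebesgue measure; $Du(x),D^2u(x)$ are the derivatives in the Peano sense at points $x$ where $u(y)=u(x)+\langle Du(x),y-x\rangle+\frac12\langle D^2u(x)(y-x),y-x\rangle+o(|y-x|^2)$ as $y\to x$, with $D^2u(x)$ symmetric (locally semiconvex functions are twice differentiable in this sense almost everywhere, by Alexandrov's theorem). *)

theory Defs
  imports "HOL-Analysis.Analysis" "HOL-Library.Landau_Symbols"
begin

type_synonym 'n jet = "real \<times> (real ^ 'n) \<times> (real ^ 'n ^ 'n)"

definition sym_matrices :: "(real ^ 'n ^ 'n) set"
  where "sym_matrices = {A. transpose A = A}"

text \<open>\<open>P > 0\<close> in the Loewner order, read as positive definiteness.\<close>

definition pos_def :: "real ^ 'n ^ 'n \<Rightarrow> bool"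
  where "pos_def P \<longleftrightarrow> P \<in> sym_matrices \<and> (\<forall>v. v \<noteq> 0 \<longrightarrow> (P *v v) \<bullet> v > 0)"

definition jet_space :: "(real ^ 'n) set \<Rightarrow> ((real ^ 'n) \<times> 'n jet) set"
  where "jet_space X = X \<times> UNIV \<times> UNIV \<times> sym_matrices"

definition fiber :: "((real ^ 'n) \<times> 'n jet) set \<Rightarrow> real ^ 'n \<Rightarrow> 'n jet set"
  where "fiber F x = {(r, p, A). (x, r, p, A) \<in> F}"

text \<open>Closedness is relative to the 2-jet space over \<open>X\<close>; \<open>closedin\<close> also gives
  \<open>F \<subseteq> jet_space X\<close>.\<close>

definition primitive_subequation :: "(real ^ 'n) set \<Rightarrow> ((real ^ 'n) \<times> 'n jet) set \<Rightarrow> bool"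
  where "primitive_subequation X F \<longleftrightarrow>
    closedin (top_of_set (jet_space X)) F \<and>
    (\<forall>x\<in>X. \<forall>r p A P. (r, p, A) \<in> fiber F x \<longrightarrow> pos_def P \<longrightarrow> (r, p, A + P) \<in> fiber F x)"

text \<open>Functions on \<open>X\<close> are represented by total functions of which only the values on \<open>X\<close> matter.\<close>

definition locally_semiconvex :: "(real ^ 'n) set \<Rightarrow> (real ^ 'n \<Rightarrow> real) \<Rightarrow> bool"
  where "locally_semiconvex X u \<longleftrightarrow>
    (\<forall>x\<in>X. \<exists>c \<rho>. x \<in> ball c \<rho> \<and> ball c \<rho> \<subseteq> X \<and>
      (\<exists>\<mu>\<ge>0. convex_on (ball c \<rho>) (\<lambda>y. u y + \<mu> / 2 * (norm y)\<^sup>2)))"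

definition usc_on :: "'a::topological_space set \<Rightarrow> ('a \<Rightarrow> ereal) \<Rightarrow> bool"
  where "usc_on X u \<longleftrightarrow> (\<forall>c. openin (top_of_set X) {x \<in> X. u x < c})"

text \<open>\<open>\<phi>\<close> is \<open>C\<^sup>2\<close> near \<open>x\<close>, with gradient \<open>g\<close> and Hessian matrix \<open>H\<close>.\<close>

definition C2_near ::
    "real ^ 'n \<Rightarrow> (real ^ 'n \<Rightarrow> real) \<Rightarrow> (real ^ 'n \<Rightarrow> real ^ 'n) \<Rightarrow> (real ^ 'n \<Rightarrow> real ^ 'n ^ 'n) \<Rightarrow> bool"
  where "C2_near x \<phi> g H \<longleftrightarrow>
    (\<exists>U. open U \<and> x \<in> U \<and>
      (\<forall>y\<in>U. (\<phi> has_derivative (\<lambda>h. g y \<bullet> h)) (at y)) \<and>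
      (\<forall>y\<in>U. (g has_derivative (\<lambda>h. H y *v h)) (at y)) \<and>
      continuous_on U H)"

definition subharmonics :: "((real ^ 'n) \<times> 'n jet) set \<Rightarrow> (real ^ 'n) set \<Rightarrow> (real ^ 'n \<Rightarrow> ereal) set"
  where "subharmonics F X = {u.
    (\<forall>x\<in>X. u x \<noteq> \<infinity>) \<and> usc_on X u \<and>
    (\<forall>x\<in>X. \<forall>\<phi> g H.
      C2_near x \<phi> g H \<longrightarrow>
      (\<forall>\<^sub>F y in nhds x. y \<in> X \<longrightarrow> u y - ereal (\<phi> y) \<le> 0) \<longrightarrow>
      u x - ereal (\<phi> x) = 0 \<longrightarrow>
      (\<phi> x, g x, H x) \<in> fiber F x)}"

text \<open>\<open>Du(x) = p\<close> and \<open>D\<^sup>2u(x) = A\<close> in the Peano sense; for \<open>x\<close> in the interior of the domain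
  of \<open>u\<close>, such \<open>p\<close> and \<open>A\<close> are unique if they exist.\<close>

definition has_peano_derivatives ::
    "(real ^ 'n \<Rightarrow> real) \<Rightarrow> real ^ 'n \<Rightarrow> real ^ 'n ^ 'n \<Rightarrow> real ^ 'n \<Rightarrow> bool"
  where "has_peano_derivatives u p A x \<longleftrightarrow>
    A \<in> sym_matrices \<and>
    (\<lambda>y. u y - (u x + p \<bullet> (y - x) + 1 / 2 * ((A *v (y - x)) \<bullet> (y - x))))
      \<in> o[at x](\<lambda>y. (norm (y - x))\<^sup>2)"

end

theory Submission
  imports Defs
begin

text \<open>
  Two theorems about a locally semiconvex function \<open>u\<close> carry the proof.

  The first is Alexandrov's theorem (\<open>negligible_no_peano_derivatives\<close>): \<open>u\<close> has a second-order
  Peano expansion at almost every point. Suppose that \<open>u\<close> is \<open>F\<close>-subharmonic and that \<open>u\<close> has the Peano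
  derivatives \<open>p\<close>, \<open>A\<close> at \<open>x\<close>. The quadratic polynomial with the jet \<open>(u x, p, A + \<epsilon> I)\<close> at \<open>x\<close>
  lies above \<open>u\<close> near \<open>x\<close>, so it is a test function and its jet is in the fiber; since \<open>F\<close> is closed,
  so is the limit \<open>(u x, p, A)\<close> for \<open>\<epsilon> \<longrightarrow> 0\<close> (\<open>subharmonic_peano_jet_in_fiber\<close>).

  The second is Jensen's lemma (\<open>tilted_contact_outside_negligible\<close>). Suppose that the jets of \<open>u\<close> lie in
  \<open>F\<close> almost everywhere and that a test function \<open>\<phi>\<close> touches \<open>u\<close> from above at \<open>x0\<close>. A small
  quadratic term makes the contact strict. Tilting the test function by a small linear function \<open>q\<close> moves the
  contact point to a point \<open>x\<close> near \<open>x0\<close>, where \<open>u\<close> is squeezed between two paraboloids. Hence \<open>q\<close>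
  is a Lipschitz function of \<open>x\<close>, and as \<open>q\<close> fills a ball, the contact points do not form a null set. At
  some contact point, therefore, \<open>u\<close> has Peano derivatives with jet in \<open>F\<close>; there the gradient of \<open>u\<close> is that of
  the tilted test function, and its Hessian is at most that of the test function. Positivity replaces
  the Hessian of \<open>u\<close> by that of the test function, up to a small multiple of the identity, and closedness
  gives the jet of \<open>\<phi>\<close> at \<open>x0\<close> (\<open>test_jet_in_fiber\<close>).

  The proof of Alexandrov's theorem for a convex function \<open>f\<close> is elementary. On a line, a choice of subgradients
  is monotone, hence differentiable almost everywhere by Lebesgue's theorem, and so \<open>f\<close> has a
  second-order expansion at almost every point of the line. By Fubini's theorem, \<open>f\<close> has at almost every \<open>x\<close> a
  second-order expansion along each direction from a countable dense set. The functions
  \<open>h \<mapsto> (f (x + t h) - f x - t \<langle>p, h\<rangle>) / t\<^sup>2\<close> are convex, so convergence on a dense set makes them converge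
  locally uniformly, to a continuous function \<open>g\<close> that is homogeneous of degree two
  (\<open>second_order_expansion_if_directional\<close>). It remains to see that \<open>g\<close> is a quadratic form. If \<open>x\<close> and
  a point \<open>y\<close> very close to \<open>x + t h\<close> have almost the same \<open>g\<close>, then the expansions at \<open>x\<close> and at \<open>y\<close>
  both compute the same mixed second difference of \<open>f\<close>, and so the mixed second differences of \<open>g\<close> at \<open>h\<close> and at
  \<open>0\<close> almost agree. The points \<open>x\<close> where they differ thus form a countable union of porous sets, which is a null
  set by Vitali's covering theorem (\<open>negligible_mixed_difference_mismatch\<close>). A continuous \<open>g\<close> with constant
  mixed differences is a quadratic form.
\<close>

section \<open>Null sets from Vitali coverings\<close>

text \<open>
  Vitali's theorem picks countably many disjoint balls that cover \<open>S\<close> up to a null set; replacing each ball by a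
  measurable set that contains its part of \<open>S\<close> bounds the outer measure of \<open>S\<close>, which need not be measurable.
  The weights \<open>w\<close> keep apart the two ways in which the disjoint balls are summed below: by volume, and by the
  increments of a monotone function.
\<close>

lemma outer_lmeasurable_Vitali_cover:
  fixes S :: "'a::euclidean_space set" and a :: "'i \<Rightarrow> 'a"
  assumes rpos: "\<And>i. i \<in> K \<Longrightarrow> 0 < r i"
    and cover: "\<And>x d. x \<in> S \<Longrightarrow> 0 < d \<Longrightarrow> \<exists>i\<in>K. x \<in> cball (a i) (r i) \<and> r i < d"
    and thin: "\<And>i. i \<in> K \<Longrightarrow> \<exists>U. S \<inter> cball (a i) (r i) \<subseteq> U \<and> U \<in> lmeasurable \<and> measure lebesgue U \<le> w i"
    and packing: "\<And>J. finite J \<Longrightarrow> J \<subseteq> K \<Longrightarrow>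
        pairwise (\<lambda>i j. disjnt (cball (a i) (r i)) (cball (a j) (r j))) J \<Longrightarrow> sum w J \<le> M"
  obtains V where "S \<subseteq> V" "V \<in> lmeasurable" "measure lebesgue V \<le> M"
proof -
  obtain C where C: "countable C" "C \<subseteq> K"
     "pairwise (\<lambda>i j. disjnt (cball (a i) (r i)) (cball (a j) (r j))) C"
     and N: "negligible (S - (\<Union>i\<in>C. cball (a i) (r i)))"
    by (rule Vitali_covering_theorem_cballs[of K r S a]) (use rpos cover in \<open>auto simp: Bex_def\<close>)
  let ?B = "\<Union>i\<in>C. cball (a i) (r i)"
  obtain U where U: "\<And>i. i \<in> K \<Longrightarrow> S \<inter> cball (a i) (r i) \<subseteq> U i \<and> U i \<in> lmeasurable \<and> measure lebesgue (U i) \<le> w i"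
    using thin by metis
  have bd: "measure lebesgue (\<Union>i\<in>I. U i) \<le> M" if "I \<subseteq> C" "finite I" for I
  proof -
    have "measure lebesgue (\<Union>i\<in>I. U i) \<le> (\<Sum>i\<in>I. measure lebesgue (U i))"
      using that C U by (intro measure_UNION_le) (auto intro!: fmeasurableD)
    also have "\<dots> \<le> sum w I" using that C U by (intro sum_mono) auto
    also have "\<dots> \<le> M" using that C pairwise_subset by (intro packing) blast+
    finally show ?thesis .
  qed
  have m: "U i \<in> lmeasurable" if "i \<in> C" for i using that C U by blast
  have 1: "(\<Union>i\<in>C. U i) \<in> lmeasurable" "measure lebesgue (\<Union>i\<in>C. U i) \<le> M"
    by (auto intro!: fmeasurable_UN_bound[OF C(1) m bd] measure_UN_bound[OF C(1) m bd])
  have N': "S - ?B \<in> lmeasurable" "measure lebesgue (S - ?B) = 0"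
    using N by (auto simp: negligible_imp_measurable negligible_imp_measure0)
  show thesis
  proof
    show "S \<subseteq> (S - ?B) \<union> (\<Union>i\<in>C. U i)" using U C by fast
    show "(S - ?B) \<union> (\<Union>i\<in>C. U i) \<in> lmeasurable"
      using 1 N' by (intro fmeasurable.Un)
    have "measure lebesgue ((S - ?B) \<union> (\<Union>i\<in>C. U i))
       \<le> measure lebesgue (S - ?B) + measure lebesgue (\<Union>i\<in>C. U i)"
      using 1 N' by (intro measure_Un_le fmeasurableD) 
    then show "measure lebesgue ((S - ?B) \<union> (\<Union>i\<in>C. U i)) \<le> M"
      using 1 N' by linarith
  qed
qed

text \<open>
  A form of Lebesgue's density theorem for arbitrary sets. Inside an open set \<open>G\<close> of nearly minimal measure around
  \<open>S\<close>, a Vitali covering shows that the outer measure of \<open>S\<close> is at most \<open>\<theta>\<close> times that of \<open>G\<close>;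
  since \<open>\<theta> < 1\<close>, the minimum is zero. The balls only have to contain the point, so that in dimension one
  intervals with the point as an end may be used.
\<close>

lemma negligible_if_thin_at_points:
  fixes S :: "'a::euclidean_space set"
  assumes th: "0 \<le> \<theta>" "\<theta> < 1"
    and thin: "\<And>x d. x \<in> S \<Longrightarrow> 0 < d \<Longrightarrow> \<exists>c r U. 0 < r \<and> r < d \<and> x \<in> cball c r \<and> S \<inter> cball c r \<subseteq> U \<and>
        U \<in> lmeasurable \<and> measure lebesgue U \<le> \<theta> * measure lebesgue (cball c r)"
  shows "negligible S"
proof -
  have shrink: "\<exists>V. S \<inter> G \<subseteq> V \<and> V \<in> lmeasurable \<and> measure lebesgue V \<le> \<theta> * measure lebesgue G"
    if G: "open G" "G \<in> lmeasurable" for G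
  proof -
    define K where "K = {(c,r). 0 < r \<and> cball c r \<subseteq> G \<and> (\<exists>U. S \<inter> cball c r \<subseteq> U \<and> U \<in> lmeasurable \<and> measure lebesgue U \<le> \<theta> * measure lebesgue (cball c r))}"
    obtain V where "S \<inter> G \<subseteq> V" "V \<in> lmeasurable" "measure lebesgue V \<le> \<theta> * measure lebesgue G"
    proof (rule outer_lmeasurable_Vitali_cover[of K snd "S \<inter> G" fst "\<lambda>i. \<theta> * measure lebesgue (cball (fst i) (snd i))"])
      show "\<exists>i\<in>K. x \<in> cball (fst i) (snd i) \<and> snd i < d" if xd: "x \<in> S \<inter> G" "0 < d" for x d
      proof -
        obtain e where e: "e > 0" "cball x e \<subseteq> G" using open_contains_cball[THEN iffD1, OF G(1)] xd(1) by auto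
        have "min d (e/2) > 0" "x \<in> S" using e xd by auto
        obtain c r U where cr: "0 < r" "r < min d (e/2)" "x \<in> cball c r" "S \<inter> cball c r \<subseteq> U"
          "U \<in> lmeasurable" "measure lebesgue U \<le> \<theta> * measure lebesgue (cball c r)"
          using thin[OF \<open>x \<in> S\<close> \<open>min d (e/2) > 0\<close>] by blast
        have "cball c r \<subseteq> cball x e"
        proof
          fix y assume "y \<in> cball c r"
          then have "dist x y \<le> r + r" using cr(3) dist_triangle[of x y c]
            by (simp add: dist_commute)
          then show "y \<in> cball x e" using cr(2) by simp
        qed
        then have "cball c r \<subseteq> G" using e by blast
        then have "(c,r) \<in> K" unfolding K_def using cr(1,4-6) by auto
        then show ?thesis using cr by (intro bexI[of _ "(c,r)"]) auto
      qed
      show "\<exists>U. S \<inter> G \<inter> cball (fst i) (snd i) \<subseteq> U \<and> U \<in> lmeasurable \<and> measure lebesgue U \<le> \<theta> * measure lebesgue (cball (fst i) (snd i))"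
        if i: "i \<in> K" for i
      proof -
        obtain U where "S \<inter> cball (fst i) (snd i) \<subseteq> U" "U \<in> lmeasurable"
            "measure lebesgue U \<le> \<theta> * measure lebesgue (cball (fst i) (snd i))"
          using i unfolding K_def by auto
        then show ?thesis by (intro exI[of _ U]) auto
      qed
      show "(\<Sum>i\<in>J. \<theta> * measure lebesgue (cball (fst i) (snd i))) \<le> \<theta> * measure lebesgue G"
        if J: "finite J" "J \<subseteq> K" "pairwise (\<lambda>i j. disjnt (cball (fst i) (snd i)) (cball (fst j) (snd j))) J" for J
      proof -
        have "(\<Sum>i\<in>J. measure lebesgue (cball (fst i) (snd i))) = measure lebesgue (\<Union>i\<in>J. cball (fst i) (snd i))"
          using J by (subst measure_UNION') auto
        also have "\<dots> \<le> measure lebesgue G"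
        proof (rule measure_mono_fmeasurable)
          have "cball (fst i) (snd i) \<subseteq> G" if "i \<in> J" for i using J(2) that unfolding K_def by fastforce
          then show "(\<Union>i\<in>J. cball (fst i) (snd i)) \<subseteq> G" by blast
        qed (use J G in auto)
        finally show ?thesis using th by (simp add: sum_distrib_left[symmetric] mult_left_mono)
      qed
    qed (auto simp: K_def)
    then show ?thesis by blast
  qed
  have "negligible (S \<inter> ball 0 n)" for n
  proof (rule ccontr)
    assume neg: "\<not> negligible (S \<inter> ball 0 n)"
    let ?M = "{measure lebesgue V |V. S \<inter> ball 0 n \<subseteq> V \<and> V \<in> lmeasurable}"
    define m where "m = Inf ?M"
    have bdd: "bdd_below ?M"
      by (rule bdd_belowI[of _ 0]) auto
    have m_le: "m \<le> measure lebesgue V" if "S \<inter> ball 0 n \<subseteq> V" "V \<in> lmeasurable" for V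
      unfolding m_def by (rule cInf_lower[OF _ bdd]) (use that in blast)
    have ne: "?M \<noteq> {}"
      using lmeasurable_ball[of 0 n] by blast
    have appr: "\<exists>V. S \<inter> ball 0 n \<subseteq> V \<and> V \<in> lmeasurable \<and> measure lebesgue V < m + e" if "e > 0" for e
      using cInf_lessD[OF ne, of "m + e"] that unfolding m_def[symmetric] by auto
    have mpos: "m > 0"
    proof (rule ccontr)
      assume "\<not> m > 0"
      then have "\<exists>V. S \<inter> ball 0 n \<subseteq> V \<and> V \<in> lmeasurable \<and> measure lebesgue V < e" if "e > 0" for e
        using appr[OF that] by (meson add_le_same_cancel2 less_le_trans not_less)
      then have "negligible (S \<inter> ball 0 n)" unfolding negligible_outer by blast
      then show False using neg by blast
    qed
    \<comment> \<open>Small enough for \<open>\<theta> * (m + 2 * e) < m\<close>.\<close>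
    define e where "e = m * (1 - \<theta>) / 4"
    have epos: "e > 0" using mpos th by (simp add: e_def)
    obtain V where V: "S \<inter> ball 0 n \<subseteq> V" "V \<in> lmeasurable" "measure lebesgue V < m + e" using appr[OF epos] by blast
    obtain G where G: "open G" "V \<subseteq> G" "G - V \<in> lmeasurable" "emeasure lebesgue (G - V) < ennreal e"
      using sets_lebesgue_outer_open[OF _ epos, of V] V by blast
    have "G = V \<union> (G - V)" using G by auto
    have Gm: "G \<in> lmeasurable" using fmeasurable.Un[OF V(2) G(3)] G(2) by (simp add: Un_absorb1)
    have "measure lebesgue (G - V) < e"
      using G(3,4) emeasure_eq_measure2[OF G(3)] by (simp add: ennreal_less_iff)
    moreover have "measure lebesgue G \<le> measure lebesgue V + measure lebesgue (G - V)"
      by (subst \<open>G = V \<union> (G - V)\<close>) (use V G in \<open>intro measure_Un_le fmeasurableD\<close>)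
    ultimately have Gle: "measure lebesgue G \<le> m + 2 * e" using V(3) by linarith
    obtain W where W: "S \<inter> G \<subseteq> W" "W \<in> lmeasurable" "measure lebesgue W \<le> \<theta> * measure lebesgue G"
      using shrink[OF G(1) Gm] by blast
    have "S \<inter> ball 0 n \<subseteq> W" using W(1) V(1) G(2) by blast
    then have "m \<le> measure lebesgue W" using W m_le by blast
    also have "\<dots> \<le> \<theta> * (m + 2 * e)" using W(3) Gle th(1) by (meson mult_left_mono order_trans)
    also have "\<dots> \<le> \<theta> * m + 2 * e" using th epos by (simp add: algebra_simps mult_left_le_one_le)
    finally have "m * (1 - \<theta>) \<le> 2 * e" by (simp add: algebra_simps)
    then show False using epos unfolding e_def by simp
  qed
  then have "negligible (\<Union>n::nat. S \<inter> ball 0 (real n))" by (intro negligible_Union_nat)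
  moreover have "S \<subseteq> (\<Union>n::nat. S \<inter> ball 0 (real n))" by (auto simp: reals_Archimedean2)
  ultimately show ?thesis by (rule negligible_subset)
qed

text \<open>
  The hole removes a fixed fraction \<open>c ^ DIM('a)\<close> of the volume of the ball.
\<close>

lemma negligible_if_porous:
  fixes S :: "'a::euclidean_space set"
  assumes c: "0 < c" "c \<le> 1"
    and por: "\<And>x d. x \<in> S \<Longrightarrow> 0 < d \<Longrightarrow> \<exists>r y. 0 < r \<and> r < d \<and> ball y (c * r) \<subseteq> cball x r \<and> S \<inter> ball y (c * r) = {}"
  shows "negligible S"
proof (rule negligible_if_thin_at_points[where \<theta> = "1 - c ^ DIM('a)"])
  show "0 \<le> 1 - c ^ DIM('a)" using c by (simp add: power_le_one)
  show "1 - c ^ DIM('a) < 1" using c by simp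
  fix x and d :: real assume "x \<in> S" "0 < d"
  then obtain r y where r: "0 < r" "r < d" "ball y (c * r) \<subseteq> cball x r" "S \<inter> ball y (c * r) = {}" using por by blast
  have "measure lebesgue (cball x r - ball y (c * r)) = measure lebesgue (cball x r) - measure lebesgue (ball y (c * r))"
    using r(3) by (intro measurable_measure_Diff) auto
  also have "\<dots> = (1 - c ^ DIM('a)) * measure lebesgue (cball x r)"
    using r c by (simp add: content_ball content_cball power_mult_distrib algebra_simps)
  finally show "\<exists>ca r U. 0 < r \<and> r < d \<and> x \<in> cball ca r \<and> S \<inter> cball ca r \<subseteq> U \<and> U \<in> lmeasurable \<and>
          measure lebesgue U \<le> (1 - c ^ DIM('a)) * measure lebesgue (cball ca r)"
    using r by (intro exI[of _ x] exI[of _ r] exI[of _ "cball x r - ball y (c * r)"]) (auto intro!: fmeasurable.Diff)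
qed

section \<open>Monotone functions of one variable\<close>

lemma sum_mono_increments_disjoint:
  fixes G :: "real \<Rightarrow> real"
  assumes "finite J" and "mono_on {a..b} G" "a \<le> b"
    and "\<And>c r. (c,r) \<in> J \<Longrightarrow> 0 < r \<and> a \<le> c - r \<and> c + r \<le> b"
    and "pairwise (\<lambda>i j. disjnt (cball (fst i) (snd i)) (cball (fst j) (snd j))) J"
  shows "(\<Sum>(c,r)\<in>J. G (c + r) - G (c - r)) \<le> G b - G a"
  using assms
proof (induction J arbitrary: b rule: finite_psubset_induct)
  case (psubset J)
  show ?case
  proof (cases "J = {}")
    case True then show ?thesis using psubset.prems by (auto dest: mono_onD[where r=a and s=b])
  next
    case False
    have "finite (fst ` J)" "fst ` J \<noteq> {}" using psubset.hyps False by auto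
    then have "Max (fst ` J) \<in> fst ` J" by (rule Max_in)
    then obtain i where i: "i \<in> J" "fst i = Max (fst ` J)" by auto
    obtain c r where cr: "i = (c,r)" by (cases i)
    have I: "0 < r" "a \<le> c - r" "c + r \<le> b" using psubset.prems(3) i cr by auto
    let ?J = "J - {i}"
    have left: "c' + r' \<le> c - r" "0 < r'" "a \<le> c' - r'" if "(c',r') \<in> ?J" for c' r'
    proof -
      have le: "c' \<le> c" using that i cr psubset.hyps by (metis DiffD1 Max_ge finite_imageI fst_conv image_eqI)
      show r': "0 < r'" "a \<le> c' - r'" using psubset.prems(3) that by auto
      have disj: "disjnt (cball c' r') (cball c r)"
        using psubset.prems(4) that i cr unfolding pairwise_def by (metis DiffD1 DiffD2 fst_conv insertI1 snd_conv)
      show "c' + r' \<le> c - r"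
      proof (rule ccontr)
        assume "\<not> ?thesis"
        then have "max c' (c - r) \<in> cball c' r' \<inter> cball c r" using le r' I by (auto simp: dist_real_def max_def)
        then show False using disj by (auto simp: disjnt_def)
      qed
    qed
    have "(\<Sum>(c,r)\<in>?J. G (c + r) - G (c - r)) \<le> G (c - r) - G a"
    proof (rule psubset.IH)
      show "?J \<subset> J" using i by auto
      show "mono_on {a..c - r} G" using psubset.prems(1) by (rule mono_on_subset) (use I in auto)
      show "a \<le> c - r" using I by simp
      show "0 < r' \<and> a \<le> c' - r' \<and> c' + r' \<le> c - r" if "(c',r') \<in> ?J" for c' r' using left that by blast
      show "pairwise (\<lambda>i j. disjnt (cball (fst i) (snd i)) (cball (fst j) (snd j))) ?J"
        using psubset.prems(4) by (rule pairwise_subset) auto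
    qed
    moreover have "(\<Sum>(c,r)\<in>J. G (c + r) - G (c - r)) = (G (c + r) - G (c - r)) + (\<Sum>(c,r)\<in>?J. G (c + r) - G (c - r))"
      using sum.remove[OF psubset.hyps i(1), of "\<lambda>(c,r). G (c + r) - G (c - r)"] cr by simp
    moreover have "G (c + r) \<le> G b" using psubset.prems(1) I by (auto intro: mono_onD)
    ultimately show ?thesis by linarith
  qed
qed

text \<open>
  The points with a difference quotient above \<open>q\<close> are covered by disjoint intervals on each of which \<open>G\<close> grows
  by more than \<open>q\<close> times the length, and the total growth is limited by \<open>G b - G a\<close>.
\<close>

lemma outer_measure_steep_points:
  fixes G :: "real \<Rightarrow> real"
  assumes G: "mono_on {a..b} G" and "a \<le> b" "0 < q"
    and steep: "\<And>x d. x \<in> E \<Longrightarrow> 0 < d \<Longrightarrow> \<exists>y. y \<noteq> x \<and> \<bar>y - x\<bar> < d \<and> q < (G y - G x) / (y - x)"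
    and E: "E \<subseteq> {a<..<b}"
  obtains U where "E \<subseteq> U" "U \<in> lmeasurable" "measure lebesgue U \<le> (G b - G a) / q"
proof -
  define K where "K = {(c,r). 0 < r \<and> a \<le> c - r \<and> c + r \<le> b \<and> q * (2 * r) \<le> G (c + r) - G (c - r)}"
  show thesis
  proof (rule outer_lmeasurable_Vitali_cover[of K snd E fst "\<lambda>i. 2 * snd i" "(G b - G a) / q"])
    show "\<exists>i\<in>K. x \<in> cball (fst i) (snd i) \<and> snd i < d" if x: "x \<in> E" "0 < d" for x d
    proof -
      have ab: "a < x" "x < b" using E x by auto
      obtain y where y: "y \<noteq> x" "\<bar>y - x\<bar> < min d (min (x - a) (b - x))" "q < (G y - G x) / (y - x)"
        using steep[OF x(1), of "min d (min (x - a) (b - x))"] x ab by auto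
      let ?c = "(x + y) / 2" and ?r = "\<bar>y - x\<bar> / 2"
      have "q * (2 * ?r) \<le> G (?c + ?r) - G (?c - ?r)"
      proof (cases "x < y")
        case True
        then have "?c + ?r = y" "?c - ?r = x" "\<bar>y - x\<bar> = y - x" by (auto simp: field_simps)
        then show ?thesis using y True by (simp add: field_simps)
      next
        case False
        then have "?c + ?r = x" "?c - ?r = y" "\<bar>y - x\<bar> = x - y" by (auto simp: field_simps)
        then show ?thesis using y False by (simp add: field_simps)
      qed
      moreover have "x \<in> cball ?c ?r" "?r < d" "0 < ?r" using y x by (auto simp: dist_real_def field_simps abs_if)
      moreover have "a \<le> ?c - ?r" "?c + ?r \<le> b" using y ab by (auto simp: field_simps abs_if split: if_splits)
      ultimately show ?thesis by (intro bexI[of _ "(?c,?r)"]) (auto simp: K_def)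
    qed
    show "\<exists>U. E \<inter> cball (fst i) (snd i) \<subseteq> U \<and> U \<in> lmeasurable \<and> measure lebesgue U \<le> 2 * snd i" if "i \<in> K" for i
      using that by (intro exI[of _ "cball (fst i) (snd i)"]) (auto simp: K_def cball_eq_atLeastAtMost)
    show "(\<Sum>i\<in>J. 2 * snd i) \<le> (G b - G a) / q"
      if J: "finite J" "J \<subseteq> K" "pairwise (\<lambda>i j. disjnt (cball (fst i) (snd i)) (cball (fst j) (snd j))) J" for J
    proof -
      have "q * (\<Sum>i\<in>J. 2 * snd i) \<le> (\<Sum>(c,r)\<in>J. G (c + r) - G (c - r))"
        unfolding sum_distrib_left using J by (intro sum_mono) (auto simp: K_def)
      also have "\<dots> \<le> G b - G a"
        by (rule sum_mono_increments_disjoint[OF J(1) G \<open>a \<le> b\<close> _ J(3)]) (use J in \<open>auto simp: K_def\<close>)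
      finally show ?thesis using \<open>0 < q\<close> by (simp add: field_simps)
    qed
  qed (use that in \<open>auto simp: K_def\<close>)
qed

text \<open>
  The preceding estimate in the shape in which \<open>negligible_if_thin_at_points\<close> consumes it: on an interval of small mean growth, the steep
  points are relatively few.
\<close>

lemma thin_steep_points:
  fixes G :: "real \<Rightarrow> real"
  assumes G: "mono_on (cball c r) G" and "0 < r" "0 < q"
    and steep: "\<And>x d. x \<in> E \<Longrightarrow> 0 < d \<Longrightarrow> \<exists>y. y \<noteq> x \<and> \<bar>y - x\<bar> < d \<and> q < (G y - G x) / (y - x)"
    and growth: "G (c + r) - G (c - r) \<le> \<theta> * q * (2 * r)"
  shows "\<exists>U. E \<inter> cball c r \<subseteq> U \<and> U \<in> lmeasurable \<and> measure lebesgue U \<le> \<theta> * measure lebesgue (cball c r)"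
proof -
  let ?a = "c - r" and ?b = "c + r"
  have I: "cball c r = {?a..?b}" by (rule cball_eq_atLeastAtMost)
  obtain U where U: "E \<inter> {?a<..<?b} \<subseteq> U" "U \<in> lmeasurable" "measure lebesgue U \<le> (G ?b - G ?a) / q"
  proof (rule outer_measure_steep_points[of ?a ?b G q "E \<inter> {?a<..<?b}"])
    show "mono_on {?a..?b} G" using G I by simp
  qed (use steep \<open>0 < r\<close> \<open>0 < q\<close> in auto)
  have N: "negligible {?a, ?b}" by (simp add: negligible_finite)
  show ?thesis
  proof (intro exI conjI)
    show "E \<inter> cball c r \<subseteq> U \<union> {?a, ?b}" unfolding I using U(1) by force
    show "U \<union> {?a, ?b} \<in> lmeasurable" using U(2) N negligible_imp_measurable by blast
    have "measure lebesgue (U \<union> {?a, ?b}) \<le> measure lebesgue U + measure lebesgue {?a, ?b}"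
      using U(2) N by (intro measure_Un_le) (auto intro: negligible_imp_sets)
    also have "\<dots> \<le> (G ?b - G ?a) / q" using U(3) negligible_imp_measure0[OF N] by linarith
    also have "\<dots> \<le> \<theta> * (2 * r)" using growth \<open>0 < q\<close> by (simp add: field_simps)
    also have "\<dots> = \<theta> * measure lebesgue (cball c r)" unfolding I using \<open>0 < r\<close> by simp
    finally show "measure lebesgue (U \<union> {?a, ?b}) \<le> \<theta> * measure lebesgue (cball c r)" .
  qed
qed

text \<open>
  Lebesgue's theorem. At a point without derivative either all rates of growth are exceeded at arbitrarily small
  scales, or there are rationals \<open>p < q\<close> such that difference quotients below \<open>p\<close> and above \<open>q\<close> both occur
  there. In the second case the point has arbitrarily short intervals of mean growth below \<open>p\<close>, in which the points that
  are steep for \<open>q\<close> occupy at most the fraction \<open>p / q < 1\<close>.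
\<close>

theorem negligible_nondifferentiable_mono_on:
  fixes G :: "real \<Rightarrow> real"
  assumes T: "open T" and G: "mono_on T G"
  shows "negligible {x \<in> T. \<nexists>D. (G has_real_derivative D) (at x)}"
proof -
  let ?Q = "\<lambda>x y. (G y - G x) / (y - x)"
  define steep where "steep q x \<longleftrightarrow> (\<forall>d>0. \<exists>y. y \<noteq> x \<and> \<bar>y - x\<bar> < d \<and> q < ?Q x y)" for q x
  define flat where "flat p x \<longleftrightarrow> (\<forall>d>0. \<exists>y. y \<noteq> x \<and> \<bar>y - x\<bar> < d \<and> ?Q x y < p)" for p x
  define E where "E p q = {x \<in> T. flat p x \<and> steep q x}" for p q
  define Einf where "Einf = {x \<in> T. \<forall>q. steep q x}"
  have E: "negligible (E p q)" if pq: "0 < p" "p < q" for p q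
  proof (rule negligible_if_thin_at_points[where \<theta> = "p / q"])
    show "0 \<le> p / q" "p / q < 1" using pq by auto
    fix x and d :: real assume x: "x \<in> E p q" and d: "0 < d"
    then obtain e where e: "e > 0" "ball x e \<subseteq> T" using T unfolding E_def by (auto elim: openE)
    then have de: "0 < min d e" using d by simp
    obtain y where y: "y \<noteq> x" "\<bar>y - x\<bar> < min d e" "?Q x y < p"
      using x de unfolding E_def flat_def by blast
    define c where "c = (x + y) / 2"
    define r where "r = \<bar>y - x\<bar> / 2"
    have r: "0 < r" "r < d" using y unfolding r_def by auto
    have xc: "x \<in> cball c r" unfolding c_def r_def by (auto simp: dist_real_def field_simps)
    have sub: "cball c r \<subseteq> T"
    proof -
      have "cball c r \<subseteq> ball x e" using y unfolding c_def r_def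
        by (auto simp: dist_real_def cball_eq_atLeastAtMost ball_eq_greaterThanLessThan abs_if field_simps split: if_splits)
      then show ?thesis using e by blast
    qed
    have "G (c + r) - G (c - r) \<le> p * (2 * r)"
    proof (cases "x < y")
      case True
      then have eq: "c + r = y" "c - r = x" "2 * r = y - x" unfolding c_def r_def by (auto simp: field_simps)
      have "G y - G x < p * (y - x)" using y(3) True by (simp add: pos_divide_less_eq)
      then show ?thesis unfolding eq by simp
    next
      case False
      then have eq: "c + r = x" "c - r = y" "2 * r = x - y" unfolding c_def r_def by (auto simp: field_simps)
      have "?Q x y = (G x - G y) / (x - y)" by (metis minus_diff_eq minus_divide_divide)
      then have "G x - G y < p * (x - y)" using y(1,3) False by (simp add: pos_divide_less_eq)
      then show ?thesis unfolding eq by simp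
    qed
    also have "\<dots> = p / q * q * (2 * r)" using pq by simp
    finally have growth: "G (c + r) - G (c - r) \<le> p / q * q * (2 * r)" .
    have "\<exists>U. E p q \<inter> cball c r \<subseteq> U \<and> U \<in> lmeasurable \<and> measure lebesgue U \<le> p / q * measure lebesgue (cball c r)"
    proof (rule thin_steep_points[OF mono_on_subset[OF G sub] r(1) _ _ growth])
      show "0 < q" using pq by simp
    qed (auto simp: E_def steep_def)
    then show "\<exists>c r U. 0 < r \<and> r < d \<and> x \<in> cball c r \<and> E p q \<inter> cball c r \<subseteq> U \<and> U \<in> lmeasurable \<and>
        measure lebesgue U \<le> p / q * measure lebesgue (cball c r)"
      using r xc by blast
  qed
  have Einf: "negligible Einf"
  proof (rule negligible_if_thin_at_points[where \<theta> = "1/2"])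
    fix x and d :: real assume x: "x \<in> Einf" and d: "0 < d"
    then obtain e where e: "e > 0" "ball x e \<subseteq> T" using T unfolding Einf_def by (auto elim: openE)
    define r where "r = min d e / 2"
    have r: "0 < r" "r < d" "cball x r \<subseteq> T" using d e unfolding r_def by auto
    \<comment> \<open>A rate so high that the mean growth on this interval is at most \<open>q / 2\<close>.\<close>
    define q where "q = max 1 ((G (x + r) - G (x - r)) / r)"
    have q: "0 < q" "(G (x + r) - G (x - r)) / r \<le> q" unfolding q_def by auto
    then have growth: "G (x + r) - G (x - r) \<le> 1 / 2 * q * (2 * r)" using r(1) by (simp add: field_simps)
    have "\<exists>U. Einf \<inter> cball x r \<subseteq> U \<and> U \<in> lmeasurable \<and> measure lebesgue U \<le> 1 / 2 * measure lebesgue (cball x r)"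
      by (rule thin_steep_points[OF mono_on_subset[OF G r(3)] r(1) q(1) _ growth]) (auto simp: Einf_def steep_def)
    then show "\<exists>c r U. 0 < r \<and> r < d \<and> x \<in> cball c r \<and> Einf \<inter> cball c r \<subseteq> U \<and> U \<in> lmeasurable \<and>
        measure lebesgue U \<le> 1 / 2 * measure lebesgue (cball c r)"
      using r by (intro exI[of _ x] exI[of _ r]) auto
  qed auto
  have diff: "\<exists>D. (G has_real_derivative D) (at x)"
    if x: "x \<in> T" and notE: "\<And>p q. p \<in> \<rat> \<Longrightarrow> q \<in> \<rat> \<Longrightarrow> 0 < p \<Longrightarrow> p < q \<Longrightarrow> x \<notin> E p q" and notinf: "x \<notin> Einf" for x
  proof -
    define near where "near P \<longleftrightarrow> (\<exists>d>0. \<forall>y. y \<noteq> x \<longrightarrow> \<bar>y - x\<bar> < d \<longrightarrow> P (?Q x y))" for P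
    have near_conj: "near (\<lambda>t. P t \<and> R t)" if "near P" "near R" for P R
    proof -
      obtain d1 d2 where "d1 > 0" "d2 > 0" "\<forall>y. y \<noteq> x \<longrightarrow> \<bar>y - x\<bar> < d1 \<longrightarrow> P (?Q x y)" "\<forall>y. y \<noteq> x \<longrightarrow> \<bar>y - x\<bar> < d2 \<longrightarrow> R (?Q x y)"
        using \<open>near P\<close> \<open>near R\<close> unfolding near_def by blast
      then show ?thesis unfolding near_def by (intro exI[of _ "min d1 d2"]) auto
    qed
    have near_mono: "near R" if P: "near P" and PR: "\<And>t. P t \<Longrightarrow> R t" for P R
    proof -
      obtain d where "d > 0" "\<forall>y. y \<noteq> x \<longrightarrow> \<bar>y - x\<bar> < d \<longrightarrow> P (?Q x y)" using P unfolding near_def by blast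
      then show ?thesis unfolding near_def using PR by (intro exI[of _ d]) simp
    qed
    have near_False: "\<not> near (\<lambda>_. False)"
    proof
      assume "near (\<lambda>_. False)"
      then obtain d where "d > 0" "\<forall>y. y \<noteq> x \<longrightarrow> \<not> \<bar>y - x\<bar> < d" unfolding near_def by blast
      then show False by (auto dest!: spec[of _ "x + d/2"])
    qed
    obtain e where e: "e > 0" "ball x e \<subseteq> T" using T x by (auto elim: openE)
    have nonneg: "near (\<lambda>t. 0 \<le> t)"
      unfolding near_def
    proof (intro exI[of _ e] conjI allI impI)
      fix y assume "y \<noteq> x" "\<bar>y - x\<bar> < e"
      then have "y \<in> T" using e by (auto simp: dist_real_def abs_minus_commute)
      then show "0 \<le> ?Q x y" using mono_onD[OF G x, of y] mono_onD[OF G _ x, of y]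
        by (cases "x \<le> y") (auto simp: divide_simps)
    qed (use e in auto)
    have steep_or: "near (\<lambda>t. t \<le> q)" if "\<not> steep q x" for q
      using that unfolding steep_def near_def by (meson not_less)
    obtain q0 where "\<not> steep q0 x" using notinf x unfolding Einf_def by blast
    then have M: "near (\<lambda>t. t \<le> q0)" by (rule steep_or)
    define A where "A = {q. near (\<lambda>t. t \<le> q)}"
    have A0: "0 \<le> q" if "q \<in> A" for q
    proof (rule ccontr)
      assume "\<not> 0 \<le> q"
      have "near (\<lambda>t. t \<le> q)" using that unfolding A_def by simp
      then have "near (\<lambda>t. 0 \<le> t \<and> t \<le> q)" by (rule near_conj[OF nonneg])
      then have "near (\<lambda>_. False)" by (rule near_mono) (use \<open>\<not> 0 \<le> q\<close> in auto)
      then show False using near_False by blast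
    qed
    then have bdd: "bdd_below A" by (rule bdd_belowI)
    \<comment> \<open>The upper limit of the difference quotients at \<open>x\<close>; it is finite because \<open>x \<notin> Einf\<close>.\<close>
    define l where "l = Inf A"
    have upper: "near (\<lambda>t. t \<le> l + \<epsilon>)" if \<epsilon>: "\<epsilon> > 0" for \<epsilon>
    proof -
      have "A \<noteq> {}" using M unfolding A_def by auto
      then obtain q where "q \<in> A" "q < l + \<epsilon>" using cInf_lessD[of A "l + \<epsilon>"] \<epsilon> unfolding l_def by auto
      then show ?thesis unfolding A_def by (auto elim!: near_mono)
    qed
    have lower: "near (\<lambda>t. l - \<epsilon> \<le> t)" if \<epsilon>: "\<epsilon> > 0" for \<epsilon>
    proof (rule ccontr)
      assume no: "\<not> near (\<lambda>t. l - \<epsilon> \<le> t)"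
      have l0: "l - \<epsilon> > 0"
      proof (rule ccontr)
        assume "\<not> l - \<epsilon> > 0"
        then have "near (\<lambda>t. l - \<epsilon> \<le> t)" by (intro near_mono[OF nonneg]) simp
        then show False using no by blast
      qed
      obtain p where p: "p \<in> \<rat>" "l - \<epsilon> < p" "p < l" using Rats_dense_in_real[of "l - \<epsilon>" l] \<epsilon> by auto
      obtain q where q: "q \<in> \<rat>" "p < q" "q < l" using Rats_dense_in_real[of p l] p by auto
      have "flat p x"
      proof (rule ccontr)
        assume "\<not> flat p x"
        then have "near (\<lambda>t. p \<le> t)" unfolding flat_def near_def by (meson not_less)
        then have "near (\<lambda>t. l - \<epsilon> \<le> t)" by (rule near_mono) (use p in auto)
        then show False using no by blast
      qed
      then have "\<not> steep q x" using notE[OF p(1) q(1)] p q l0 x unfolding E_def by auto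
      then have "q \<in> A" unfolding A_def by (simp add: steep_or)
      then have "l \<le> q" unfolding l_def using bdd by (rule cInf_lower)
      then show False using q by simp
    qed
    have "((\<lambda>y. ?Q x y) \<longlongrightarrow> l) (at x)"
      unfolding LIM_def
    proof (intro allI impI)
      fix \<epsilon> :: real assume "0 < \<epsilon>"
      then have "near (\<lambda>t. t \<le> l + \<epsilon>/2)" "near (\<lambda>t. l - \<epsilon>/2 \<le> t)" using upper[of "\<epsilon>/2"] lower[of "\<epsilon>/2"] by simp_all
      then have "near (\<lambda>t. t \<le> l + \<epsilon>/2 \<and> l - \<epsilon>/2 \<le> t)" by (rule near_conj)
      then obtain d where d: "d > 0" "\<And>y. y \<noteq> x \<Longrightarrow> \<bar>y - x\<bar> < d \<Longrightarrow> ?Q x y \<le> l + \<epsilon>/2 \<and> l - \<epsilon>/2 \<le> ?Q x y"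
        unfolding near_def by blast
      show "\<exists>s>0. \<forall>y. y \<noteq> x \<and> dist y x < s \<longrightarrow> dist (?Q x y) l < \<epsilon>"
      proof (intro exI[of _ d] conjI allI impI)
        fix y assume "y \<noteq> x \<and> dist y x < d"
        then show "dist (?Q x y) l < \<epsilon>" using d(2)[of y] \<open>0 < \<epsilon>\<close> unfolding dist_real_def by linarith
      qed (use d in auto)
    qed
    then show ?thesis unfolding has_field_derivative_iff by blast
  qed
  let ?I = "{(p,q). p \<in> \<rat> \<and> q \<in> \<rat> \<and> 0 < p \<and> p < q}"
  have "{x \<in> T. \<nexists>D. (G has_real_derivative D) (at x)} \<subseteq> Einf \<union> (\<Union>(p,q)\<in>?I. E p q)"
  proof
    fix x assume "x \<in> {x \<in> T. \<nexists>D. (G has_real_derivative D) (at x)}"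
    then have x: "x \<in> T" "\<nexists>D. (G has_real_derivative D) (at x)" by auto
    then have "x \<in> Einf \<or> (\<exists>p q. p \<in> \<rat> \<and> q \<in> \<rat> \<and> 0 < p \<and> p < q \<and> x \<in> E p q)" using diff[OF x(1)] by blast
    then show "x \<in> Einf \<union> (\<Union>(p,q)\<in>?I. E p q)" by auto
  qed
  moreover have "negligible (Einf \<union> (\<Union>(p,q)\<in>?I. E p q))"
  proof (intro negligible_Un Einf negligible_countable_Union)
    show "countable ((\<lambda>(p,q). E p q) ` ?I)"
      by (intro countable_image countable_subset[OF _ countable_SIGMA[OF countable_rat, of "\<lambda>_. \<rat>"]]) (auto simp: countable_rat)
  qed (use E in auto)
  ultimately show ?thesis by (rule negligible_subset[rotated])
qed

section \<open>Second-order expansions of convex functions of one variable\<close>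

text \<open>
  A hyperplane that separates the strict epigraph from the point \<open>(x, f x)\<close>. It is not vertical because
  \<open>x\<close> is an interior point of \<open>S\<close>.
\<close>

lemma convex_on_subgradient:
  fixes f :: "'a::euclidean_space \<Rightarrow> real"
  assumes S: "open S" and f: "convex_on S f" and x: "x \<in> S"
  obtains p where "\<And>y. y \<in> S \<Longrightarrow> f x + p \<bullet> (y - x) \<le> f y"
proof -
  \<comment> \<open>The strict epigraph of \<open>f\<close>, moved so that \<open>(x, f x)\<close> becomes the origin.\<close>
  define W where "W = {(z, r). x + z \<in> S \<and> f (x + z) - f x < r}"
  have cS: "convex S" using f convex_on_imp_convex by blast
  have "convex W"
  proof (rule convexI)
    fix v w and s t :: real assume vw: "v \<in> W" "w \<in> W" and st: "0 \<le> s" "0 \<le> t" "s + t = 1"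
    obtain z r z' r' where e: "v = (z,r)" "w = (z',r')" by fastforce
    have m: "x + z \<in> S" "x + z' \<in> S" "f (x + z) - f x < r" "f (x + z') - f x < r'" using vw e unfolding W_def by auto
    have s: "s = 1 - t" using st by simp
    have eq: "x + (s *\<^sub>R z + t *\<^sub>R z') = s *\<^sub>R (x + z) + t *\<^sub>R (x + z')"
      unfolding s by (simp add: algebra_simps)
    have "f (s *\<^sub>R (x + z) + t *\<^sub>R (x + z')) \<le> s * f (x + z) + t * f (x + z')"
      using f m(1,2) st unfolding convex_on_def by blast
    moreover have "s * f (x + z) + t * f (x + z') - f x = s * (f (x + z) - f x) + t * (f (x + z') - f x)"
      unfolding s by (simp add: algebra_simps)
    moreover have "s * (f (x + z) - f x) + t * (f (x + z') - f x) < s * r + t * r'"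
    proof (cases "s = 0")
      case True then show ?thesis using m st by simp
    next
      case False
      then have "s * (f (x + z) - f x) < s * r" "t * (f (x + z') - f x) \<le> t * r'" using m st by (auto intro: mult_left_mono)
      then show ?thesis by linarith
    qed
    ultimately have "f (x + (s *\<^sub>R z + t *\<^sub>R z')) - f x < s * r + t * r'" unfolding eq by linarith
    moreover have "x + (s *\<^sub>R z + t *\<^sub>R z') \<in> S" unfolding eq using convexD[OF cS] m st by blast
    ultimately show "s *\<^sub>R v + t *\<^sub>R w \<in> W" unfolding e W_def by simp
  qed
  moreover have "0 \<notin> W" unfolding W_def zero_prod_def by simp
  ultimately have "\<exists>a. a \<noteq> 0 \<and> (\<forall>w\<in>W. 0 \<le> a \<bullet> w)" by (rule separating_hyperplane_set_0)
  then obtain a where a: "a \<noteq> 0" "\<And>w. w \<in> W \<Longrightarrow> 0 \<le> a \<bullet> w" by auto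
  obtain b c where abc: "a = (b, c)" by fastforce
  have ineq: "0 \<le> b \<bullet> z + c * r" if "x + z \<in> S" "f (x + z) - f x < r" for z r
    using a(2)[of "(z,r)"] that unfolding W_def abc by (simp add: inner_prod_def)
  have c0: "0 \<le> c" using ineq[of 0 1] x by simp
  have "c \<noteq> 0"
  proof
    assume c: "c = 0"
    then have b: "b \<noteq> 0" using a abc by (auto simp: zero_prod_def)
    obtain e where e: "e > 0" "ball x e \<subseteq> S" using S x by (auto elim: openE)
    let ?z = "- (e / (2 * norm b)) *\<^sub>R b"
    have "x + ?z \<in> S" using e b by (intro set_mp[OF e(2)]) (simp add: dist_norm)
    then have "0 \<le> b \<bullet> ?z" using ineq[of ?z "f (x + ?z) - f x + 1"] c by simp
    moreover have "b \<bullet> ?z < 0" using e b by (simp add: zero_less_mult_iff)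
    ultimately show False by simp
  qed
  then have cpos: "0 < c" using c0 by simp
  show thesis
  proof
    fix y assume y: "y \<in> S"
    have "f x + (- (1/c)) * (b \<bullet> (y - x)) \<le> f y"
    proof (rule field_le_epsilon)
      fix e :: real assume "0 < e"
      then have "0 \<le> b \<bullet> (y - x) + c * (f y - f x + e)" using ineq[of "y - x" "f y - f x + e"] y by simp
      then show "f x + (- (1/c)) * (b \<bullet> (y - x)) \<le> f y + e" using cpos by (simp add: field_simps)
    qed
    then show "f x + (- (1/c) *\<^sub>R b) \<bullet> (y - x) \<le> f y" by simp
  qed
qed

definition second_order_expansion :: "('a::real_inner \<Rightarrow> real) \<Rightarrow> 'a \<Rightarrow> 'a \<Rightarrow> ('a \<Rightarrow> real) \<Rightarrow> bool"
  where "second_order_expansion f x p g \<longleftrightarrow>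
    (\<forall>e>0. \<exists>d>0. \<forall>z. norm z < d \<longrightarrow> \<bar>f (x + z) - f x - p \<bullet> z - g z\<bar> \<le> e * (norm z)^2)"

text \<open>
  Integrating the first-order expansion of \<open>\<gamma>\<close> gives the second-order expansion of \<open>\<phi>\<close>. The integral is replaced by
  Riemann sums: on each piece of a subdivision the increment of \<open>\<phi>\<close> lies between the values of \<open>\<gamma>\<close> at the two ends,
  times the length, and the error of the sums vanishes as the number \<open>N\<close> of pieces grows.
\<close>

lemma second_order_expansion_if_subgradient_differentiable:
  fixes \<phi> \<gamma> :: "real \<Rightarrow> real"
  assumes T: "open T" "t \<in> T"
    and sub: "\<And>a b. a \<in> T \<Longrightarrow> b \<in> T \<Longrightarrow> \<phi> a + \<gamma> a * (b - a) \<le> \<phi> b"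
    and der: "(\<gamma> has_real_derivative D) (at t)"
  shows "second_order_expansion \<phi> t (\<gamma> t) (\<lambda>s. D / 2 * s^2)"
  unfolding second_order_expansion_def
proof (intro allI impI)
  fix e :: real assume e: "0 < e"
  obtain d0 where d0: "d0 > 0" "ball t d0 \<subseteq> T" using T by (auto elim: openE)
  obtain d1 where d1: "d1 > 0" "\<And>y. y \<noteq> t \<Longrightarrow> \<bar>y - t\<bar> < d1 \<Longrightarrow> \<bar>(\<gamma> y - \<gamma> t) / (y - t) - D\<bar> < e"
    using der e unfolding has_field_derivative_iff LIM_def dist_real_def by blast
  have \<gamma>: "\<bar>\<gamma> (t + r) - \<gamma> t - D * r\<bar> \<le> e * \<bar>r\<bar>" if "\<bar>r\<bar> < d1" for r
  proof (cases "r = 0")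
    case False
    have "\<bar>\<gamma> (t + r) - \<gamma> t - D * r\<bar> = \<bar>(\<gamma> (t + r) - \<gamma> t) / r - D\<bar> * \<bar>r\<bar>"
      using False by (simp add: abs_mult[symmetric] field_simps)
    also have "\<dots> \<le> e * \<bar>r\<bar>" using d1(2)[of "t + r"] that False by (intro mult_right_mono) auto
    finally show ?thesis .
  qed simp
  show "\<exists>d>0. \<forall>s. norm s < d \<longrightarrow> \<bar>\<phi> (t + s) - \<phi> t - \<gamma> t \<bullet> s - D / 2 * s^2\<bar> \<le> e * (norm s)^2"
  proof (intro exI[of _ "min d0 d1"] conjI allI impI)
    fix s :: real assume s: "norm s < min d0 d1"
    have bound: "\<bar>\<phi> (t + s) - \<phi> t - \<gamma> t * s - D / 2 * s^2\<bar> \<le> e * s^2 + \<bar>D\<bar> * s^2 / real N" if N: "N > 0" for N :: nat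
    proof -
      \<comment> \<open>The nodes of the subdivision; they run backwards when \<open>s < 0\<close>, and the estimates hold for both signs.\<close>
      define y where "y i = t + s * real i / real N" for i :: nat
      have fr: "\<bar>s * real i / real N\<bar> \<le> \<bar>s\<bar>" if "i \<le> N" for i
        using that N by (simp add: abs_mult divide_le_eq mult_left_mono)
      have yT: "y i \<in> T" if "i \<le> N" for i
        using fr[OF that] s by (intro set_mp[OF d0(2)]) (simp add: y_def dist_real_def)
      have step: "y (Suc i) - y i = s / real N" for i
        unfolding y_def by (simp add: add_divide_distrib[symmetric] diff_divide_distrib[symmetric] algebra_simps)
      have \<gamma>y: "\<bar>\<gamma> (y i) * (s / real N) - (\<gamma> t + D * (s * real i / real N)) * (s / real N)\<bar> \<le> e * s^2 / real N" if "i \<le> N" for i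
      proof -
        have "\<bar>\<gamma> (y i) - \<gamma> t - D * (s * real i / real N)\<bar> \<le> e * \<bar>s * real i / real N\<bar>"
          unfolding y_def using fr[OF that] s by (intro \<gamma>) auto
        also have "\<dots> \<le> e * \<bar>s\<bar>" using fr[OF that] e by (intro mult_left_mono) auto
        finally have "\<bar>\<gamma> (y i) - \<gamma> t - D * (s * real i / real N)\<bar> * \<bar>s / real N\<bar> \<le> e * \<bar>s\<bar> * \<bar>s / real N\<bar>"
          by (rule mult_right_mono) simp
        also have "e * \<bar>s\<bar> * \<bar>s / real N\<bar> = e * s^2 / real N" by (simp add: power2_eq_square)
        finally have "\<bar>(\<gamma> (y i) - \<gamma> t - D * (s * real i / real N)) * (s / real N)\<bar> \<le> e * s^2 / real N"
          by (simp only: abs_mult)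
        moreover have "(\<gamma> (y i) - \<gamma> t - D * (s * real i / real N)) * (s / real N)
            = \<gamma> (y i) * (s / real N) - (\<gamma> t + D * (s * real i / real N)) * (s / real N)"
          by (simp only: left_diff_distrib distrib_right diff_diff_eq)
        ultimately show ?thesis by argo
      qed
      have tel: "\<phi> (t + s) - \<phi> t = (\<Sum>i<N. \<phi> (y (Suc i)) - \<phi> (y i))"
        using N sum_lessThan_telescope[of "\<lambda>i. \<phi> (y i)" N] by (simp add: y_def)
      have S1: "(\<Sum>i<N. (\<gamma> t + D * (s * real i / real N)) * (s / real N)) = \<gamma> t * s + D * s^2 * ((real N - 1) / (2 * real N))"
      proof -
        have arith: "(\<Sum>i<n. A + B * real i) = real n * A + B * (real n * (real n - 1) / 2)" for A B n
          by (induction n) (auto simp: field_simps)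
        have "(\<Sum>i<N. (\<gamma> t + D * (s * real i / real N)) * (s / real N))
            = (\<Sum>i<N. \<gamma> t * (s / real N) + D * s * s / (real N * real N) * real i)"
          by (rule sum.cong) (use N in \<open>auto simp: field_simps\<close>)
        also have "\<dots> = \<gamma> t * s + D * s^2 * ((real N - 1) / (2 * real N))"
          unfolding arith using N by (simp add: field_simps power2_eq_square)
        finally show ?thesis .
      qed
      have up: "\<phi> (y (Suc i)) - \<phi> (y i) \<le> (\<gamma> t + D * (s * real i / real N)) * (s / real N) + D * s^2 / (real N)^2 + e * s^2 / real N" if "i < N" for i
      proof -
        have "\<phi> (y (Suc i)) - \<phi> (y i) \<le> \<gamma> (y (Suc i)) * (s / real N)"
          using sub[of "y (Suc i)" "y i"] yT[of i] yT[of "Suc i"] that step[of i] by (simp add: algebra_simps)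
        also have "\<dots> \<le> (\<gamma> t + D * (s * real (Suc i) / real N)) * (s / real N) + e * s^2 / real N"
          using \<gamma>y[of "Suc i"] that by linarith
        also have "(\<gamma> t + D * (s * real (Suc i) / real N)) * (s / real N) = (\<gamma> t + D * (s * real i / real N)) * (s / real N) + D * s^2 / (real N)^2"
          using N by (simp add: field_simps power2_eq_square)
        finally show ?thesis .
      qed
      have lo: "(\<gamma> t + D * (s * real i / real N)) * (s / real N) - e * s^2 / real N \<le> \<phi> (y (Suc i)) - \<phi> (y i)" if "i < N" for i
      proof -
        have "\<gamma> (y i) * (s / real N) \<le> \<phi> (y (Suc i)) - \<phi> (y i)"
          using sub[of "y i" "y (Suc i)"] yT[of i] yT[of "Suc i"] that step[of i] by simp
        then show ?thesis using \<gamma>y[of i] that by linarith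
      qed
      have U: "\<phi> (t + s) - \<phi> t \<le> \<gamma> t * s + D * s^2 * ((real N - 1) / (2 * real N)) + real N * (D * s^2 / (real N)^2 + e * s^2 / real N)"
        unfolding tel S1[symmetric] using sum_mono[of "{..<N}", OF up] by (simp add: sum.distrib algebra_simps)
      have L: "\<gamma> t * s + D * s^2 * ((real N - 1) / (2 * real N)) - real N * (e * s^2 / real N) \<le> \<phi> (t + s) - \<phi> t"
        unfolding tel S1[symmetric] using sum_mono[of "{..<N}", OF lo] by (simp add: sum_subtractf algebra_simps)
      have e1: "real N * (e * s^2 / real N) = e * s^2" "real N * (D * s^2 / (real N)^2) = D * s^2 / real N"
        "D * s^2 * ((real N - 1) / (2 * real N)) = D / 2 * s^2 - (D * s^2 / real N) / 2"
        using N by (auto simp: field_simps power2_eq_square)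
      have "\<bar>D * s^2 / real N\<bar> = \<bar>D\<bar> * s^2 / real N" by (simp add: abs_mult)
      then have "D * s^2 / real N \<le> \<bar>D\<bar> * s^2 / real N" "- (D * s^2 / real N) \<le> \<bar>D\<bar> * s^2 / real N" by linarith+
      then show ?thesis using U L unfolding distrib_left e1 by (intro abs_leI) argo+
    qed
    have "\<bar>\<phi> (t + s) - \<phi> t - \<gamma> t * s - D / 2 * s^2\<bar> \<le> e * s^2"
    proof (rule field_le_epsilon)
      fix \<delta> :: real assume \<delta>: "0 < \<delta>"
      obtain N :: nat where N: "\<bar>D\<bar> * s^2 / \<delta> < real N" using reals_Archimedean2 by blast
      have "0 \<le> \<bar>D\<bar> * s^2 / \<delta>" using \<delta> by simp
      then have N0: "0 < N" using N by (metis of_nat_0_less_iff order_le_less_trans)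
      then have "\<bar>D\<bar> * s^2 / real N \<le> \<delta>" using N \<delta> by (simp add: field_simps)
      then show "\<bar>\<phi> (t + s) - \<phi> t - \<gamma> t * s - D / 2 * s^2\<bar> \<le> e * s^2 + \<delta>" using bound[OF N0] by linarith
    qed
    then show "\<bar>\<phi> (t + s) - \<phi> t - \<gamma> t \<bullet> s - D / 2 * s^2\<bar> \<le> e * (norm s)^2" by simp
  qed (use d0 d1 in auto)
qed

lemma negligible_no_second_order_expansion_real:
  fixes \<phi> :: "real \<Rightarrow> real"
  assumes T: "open T" and \<phi>: "convex_on T \<phi>"
  shows "negligible {t \<in> T. \<nexists>a q. second_order_expansion \<phi> t a (\<lambda>s. q * s^2)}"
proof -
  have "\<exists>g. \<forall>b\<in>T. \<phi> a + g * (b - a) \<le> \<phi> b" if a: "a \<in> T" for a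
  proof -
    obtain p where "\<And>y. y \<in> T \<Longrightarrow> \<phi> a + p \<bullet> (y - a) \<le> \<phi> y" by (rule convex_on_subgradient[OF T \<phi> a]) blast
    then show ?thesis by auto
  qed
  then obtain \<gamma> where \<gamma>: "\<And>a b. a \<in> T \<Longrightarrow> b \<in> T \<Longrightarrow> \<phi> a + \<gamma> a * (b - a) \<le> \<phi> b" by metis
  have "mono_on T \<gamma>"
  proof (rule mono_onI)
    fix r s assume rs: "r \<in> T" "s \<in> T" "r \<le> s"
    show "\<gamma> r \<le> \<gamma> s"
    proof (cases "r = s")
      case False
      have "\<gamma> r * (s - r) \<le> \<gamma> s * (s - r)" using \<gamma>[OF rs(1,2)] \<gamma>[OF rs(2,1)] by (simp add: algebra_simps)
      then show ?thesis using False rs(3) by simp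
    qed simp
  qed
  then have "negligible {x \<in> T. \<nexists>D. (\<gamma> has_real_derivative D) (at x)}" by (rule negligible_nondifferentiable_mono_on[OF T])
  then show ?thesis
    by (rule negligible_subset) (use second_order_expansion_if_subgradient_differentiable[OF T _ \<gamma>] in blast)
qed

section \<open>Almost everywhere expansions along a fixed direction\<close>

lemma convergent_if_eventually_near:
  fixes f :: "'b \<Rightarrow> real"
  assumes F: "F \<noteq> bot" and near: "\<And>e. 0 < e \<Longrightarrow> \<exists>c. \<forall>\<^sub>F t in F. \<bar>f t - c\<bar> \<le> e"
  obtains l where "(f \<longlongrightarrow> l) F"
proof -
  have "cauchy_filter (filtermap f F)"
    unfolding cauchy_filter_metric_filtermap
  proof (intro allI impI)
    fix e :: real assume e: "0 < e"
    obtain c where c: "\<forall>\<^sub>F t in F. \<bar>f t - c\<bar> \<le> e / 3" using near[of "e / 3"] e by auto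
    show "\<exists>P. eventually P F \<and> (\<forall>x y. P x \<and> P y \<longrightarrow> dist (f x) (f y) < e)"
    proof (intro exI conjI allI impI)
      fix x y assume "\<bar>f x - c\<bar> \<le> e / 3 \<and> \<bar>f y - c\<bar> \<le> e / 3"
      then show "dist (f x) (f y) < e" using e unfolding dist_real_def by linarith
    qed (rule c)
  qed
  moreover have "complete (UNIV :: real set)"
    by (meson Cauchy_convergent UNIV_I complete_def convergent_def)
  ultimately obtain l where "filtermap f F \<le> nhds l"
    using cauchy_filter_complete_converges[of "filtermap f F" UNIV] F by (auto simp: filtermap_bot_iff)
  then show thesis by (intro that) (simp add: filterlim_def)
qed

text \<open>
  Extends the countable condition below from rational to real arguments.
\<close>

lemma nonpos_if_nonpos_on_Rats:
  fixes \<psi> :: "real \<Rightarrow> real"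
  assumes "open A" "continuous_on A \<psi>" and rat: "\<And>s. s \<in> A \<Longrightarrow> s \<in> \<rat> \<Longrightarrow> \<psi> s \<le> 0" and "s \<in> A"
  shows "\<psi> s \<le> 0"
proof (rule ccontr)
  assume "\<not> \<psi> s \<le> 0"
  then have "s \<in> A \<inter> \<psi> -` {0<..}" using \<open>s \<in> A\<close> by auto
  moreover have "open (A \<inter> \<psi> -` {0<..})" using assms(1,2) by (simp add: continuous_open_preimage)
  ultimately obtain e where e: "e > 0" "ball s e \<subseteq> A \<inter> \<psi> -` {0<..}" by (auto elim: openE)
  obtain r where r: "r \<in> \<rat>" "s < r" "r < s + e" using Rats_dense_in_real[of s "s + e"] e by auto
  then have "r \<in> ball s e" by (simp add: dist_real_def)
  then have "r \<in> A" "\<psi> r > 0" using e by auto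
  then show False using rat[of r] r by simp
qed

text \<open>
  That this holds for every \<open>n\<close> with some \<open>q\<close> and \<open>m\<close> characterizes the existence of a second-order expansion of a continuous \<open>\<phi>\<close> at \<open>0\<close> without mentioning
  the slope, which cancels in the difference of the two quotients. All quantifiers range over countable types, so
  that the condition defines a Borel set when \<open>\<phi>\<close> depends measurably on a parameter; Fubini's theorem needs this.
\<close>

definition quotients_rat_close :: "(real \<Rightarrow> real) \<Rightarrow> nat \<Rightarrow> rat \<Rightarrow> nat \<Rightarrow> bool"
  where "quotients_rat_close \<phi> n q m \<longleftrightarrow> (\<forall>s::rat. \<forall>r::rat.
      0 < \<bar>s\<bar> \<and> \<bar>s\<bar> < 1 / of_nat (Suc m) \<and> 0 < \<bar>r\<bar> \<and> \<bar>r\<bar> < 1 / of_nat (Suc m) \<longrightarrow>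
      \<bar>(\<phi> (of_rat s) - \<phi> 0) / of_rat s - (\<phi> (of_rat r) - \<phi> 0) / of_rat r - of_rat q * (of_rat s - of_rat r)\<bar>
        \<le> (\<bar>of_rat s\<bar> + \<bar>of_rat r\<bar>) / real (Suc n))"

definition quotients_rat_cauchy :: "(real \<Rightarrow> real) \<Rightarrow> bool"
  where "quotients_rat_cauchy \<phi> \<longleftrightarrow> (\<forall>n. \<exists>q m. quotients_rat_close \<phi> n q m)"

lemma quotients_rat_cauchy_if_expansion:
  assumes "second_order_expansion \<phi> 0 a (\<lambda>s. q0 * s^2)"
  shows "quotients_rat_cauchy \<phi>"
  unfolding quotients_rat_cauchy_def
proof (intro allI)
  fix n :: nat
  define \<epsilon> where "\<epsilon> = 1 / real (Suc n)"
  have \<epsilon>: "\<epsilon> > 0" by (simp add: \<epsilon>_def)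
  obtain q' where q': "q' \<in> \<rat>" "q0 < q'" "q' < q0 + \<epsilon> / 2" using Rats_dense_in_real[of q0 "q0 + \<epsilon> / 2"] \<epsilon> by auto
  obtain q where q: "q' = of_rat q" using q'(1) by (auto elim: Rats_cases)
  obtain d where d: "d > 0" "\<And>z. \<bar>z\<bar> < d \<Longrightarrow> \<bar>\<phi> z - \<phi> 0 - a * z - q0 * z^2\<bar> \<le> \<epsilon> / 2 * z^2"
    using assms[unfolded second_order_expansion_def, rule_format, of "\<epsilon> / 2"] \<epsilon> by auto
  obtain m where m: "1 / real (Suc m) < d" using d(1) by (metis nat_approx_posE)
  have quot: "\<bar>(\<phi> z - \<phi> 0) / z - a - q0 * z\<bar> \<le> \<epsilon> / 2 * \<bar>z\<bar>" if z: "z \<noteq> 0" "\<bar>z\<bar> < d" for z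
  proof -
    have "\<bar>(\<phi> z - \<phi> 0) / z - a - q0 * z\<bar> * \<bar>z\<bar> = \<bar>\<phi> z - \<phi> 0 - a * z - q0 * z^2\<bar>"
      using z(1) by (simp add: abs_mult[symmetric] field_simps power2_eq_square)
    also have "\<dots> \<le> \<epsilon> / 2 * \<bar>z\<bar> * \<bar>z\<bar>" using d(2)[OF z(2)] by (simp add: power2_eq_square)
    finally show ?thesis using z(1) by simp
  qed
  have "quotients_rat_close \<phi> n q m"
    unfolding quotients_rat_close_def
  proof (intro allI impI)
    fix s r :: rat
    assume sr: "0 < \<bar>s\<bar> \<and> \<bar>s\<bar> < 1 / of_nat (Suc m) \<and> 0 < \<bar>r\<bar> \<and> \<bar>r\<bar> < 1 / of_nat (Suc m)"
    define S R :: real where "S = of_rat s" and "R = of_rat r"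
    have "real_of_rat \<bar>s\<bar> < real_of_rat (1 / of_nat (Suc m))" "real_of_rat \<bar>r\<bar> < real_of_rat (1 / of_nat (Suc m))"
      using sr by (auto simp: of_rat_less)
    then have lt: "\<bar>S\<bar> < d" "\<bar>R\<bar> < d" "S \<noteq> 0" "R \<noteq> 0"
      using m sr unfolding S_def R_def by (auto simp: of_rat_divide of_rat_add)
    have "\<bar>(q0 - q') * (S - R)\<bar> \<le> \<epsilon> / 2 * (\<bar>S\<bar> + \<bar>R\<bar>)"
      unfolding abs_mult using q' by (intro mult_mono) auto
    moreover have "(\<phi> S - \<phi> 0) / S - (\<phi> R - \<phi> 0) / R - q' * (S - R)
        = ((\<phi> S - \<phi> 0) / S - a - q0 * S) - ((\<phi> R - \<phi> 0) / R - a - q0 * R) + (q0 - q') * (S - R)"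
      by (simp add: algebra_simps)
    ultimately have "\<bar>(\<phi> S - \<phi> 0) / S - (\<phi> R - \<phi> 0) / R - q' * (S - R)\<bar> \<le> \<epsilon> * (\<bar>S\<bar> + \<bar>R\<bar>)"
      using quot[OF lt(3,1)] quot[OF lt(4,2)] by (simp only: distrib_left) linarith
    then show "\<bar>(\<phi> (of_rat s) - \<phi> 0) / of_rat s - (\<phi> (of_rat r) - \<phi> 0) / of_rat r - of_rat q * (of_rat s - of_rat r)\<bar>
        \<le> (\<bar>of_rat s\<bar> + \<bar>of_rat r\<bar>) / real (Suc n)"
      unfolding S_def R_def q \<epsilon>_def by (simp add: field_simps)
  qed
  then show "\<exists>q m. quotients_rat_close \<phi> n q m" by blast
qed

lemma expansion_if_quotients_rat_cauchy:
  fixes \<phi> :: "real \<Rightarrow> real"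
  assumes cauchy: "quotients_rat_cauchy \<phi>" and d0: "d0 > 0" and cont: "continuous_on {-d0<..<d0} \<phi>"
  obtains a q where "second_order_expansion \<phi> 0 a (\<lambda>s. q * s^2)"
proof -
  define Q where "Q s = (\<phi> s - \<phi> 0) / s" for s
  have Qcont: "continuous_on {s. 0 < \<bar>s\<bar> \<and> \<bar>s\<bar> < d} Q" if "d \<le> d0" for d
    unfolding Q_def by (intro continuous_intros continuous_on_subset[OF cont]) (use that in auto)
  have A_open: "open {s. 0 < \<bar>s\<bar> \<and> \<bar>s\<bar> < d}" for d :: real
    by (intro open_Collect_conj open_Collect_less continuous_intros)
  have "\<exists>q d. 0 < d \<and> (\<forall>s r. 0 < \<bar>s\<bar> \<and> \<bar>s\<bar> < d \<and> 0 < \<bar>r\<bar> \<and> \<bar>r\<bar> < d \<longrightarrow>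
      \<bar>Q s - Q r - q * (s - r)\<bar> \<le> (\<bar>s\<bar> + \<bar>r\<bar>) / real (Suc n))" for n
  proof -
    obtain q m where "quotients_rat_close \<phi> n q m" using cauchy unfolding quotients_rat_cauchy_def by blast
    then have qm: "\<bar>Q (of_rat s) - Q (of_rat r) - of_rat q * (of_rat s - of_rat r)\<bar> \<le> (\<bar>of_rat s\<bar> + \<bar>of_rat r\<bar>) / real (Suc n)"
      if "0 < \<bar>s\<bar> \<and> \<bar>s\<bar> < 1 / of_nat (Suc m) \<and> 0 < \<bar>r\<bar> \<and> \<bar>r\<bar> < 1 / of_nat (Suc m)" for s r :: rat
      using that unfolding quotients_rat_close_def Q_def by blast
    define d where "d = min d0 (1 / real (Suc m))"
    have d: "0 < d" "d \<le> d0" "d \<le> 1 / real (Suc m)" unfolding d_def using d0 by auto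
    define A where "A = {s. 0 < \<bar>s\<bar> \<and> \<bar>s\<bar> < d}"
    define \<psi> where "\<psi> s r = \<bar>Q s - Q r - of_rat q * (s - r)\<bar> - (\<bar>s\<bar> + \<bar>r\<bar>) / real (Suc n)" for s r
    have A: "open A" unfolding A_def by (rule A_open)
    have QA: "continuous_on A Q" unfolding A_def by (rule Qcont[OF d(2)])
    have rats: "0 < \<bar>s\<bar> \<and> \<bar>s\<bar> < 1 / of_nat (Suc m)" if "of_rat s \<in> A" for s :: rat
    proof -
      have "\<bar>real_of_rat s\<bar> < 1 / real (Suc m)" using that d unfolding A_def by auto
      then have "real_of_rat \<bar>s\<bar> < real_of_rat (1 / of_nat (Suc m))" by (simp add: of_rat_divide of_rat_add)
      then show ?thesis using that unfolding of_rat_less A_def by auto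
    qed
    have 1: "\<psi> s r \<le> 0" if "s \<in> A" "s \<in> \<rat>" "r \<in> A" "r \<in> \<rat>" for s r
    proof -
      obtain s' r' where "s = of_rat s'" "r = of_rat r'" using \<open>s \<in> \<rat>\<close> \<open>r \<in> \<rat>\<close> by (auto elim!: Rats_cases)
      then show ?thesis using qm[of s' r'] rats[of s'] rats[of r'] that unfolding \<psi>_def by auto
    qed
    have 2: "\<psi> s r \<le> 0" if "s \<in> A" "r \<in> A" "r \<in> \<rat>" for s r
      by (rule nonpos_if_nonpos_on_Rats[OF A _ _ that(1), where \<psi> = "\<lambda>s. \<psi> s r"])
        (use 1 that in \<open>auto simp: \<psi>_def intro!: continuous_intros QA\<close>)
    have 3: "\<psi> s r \<le> 0" if "s \<in> A" "r \<in> A" for s r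
      by (rule nonpos_if_nonpos_on_Rats[OF A _ _ that(2), where \<psi> = "\<lambda>r. \<psi> s r"])
        (use 2 that in \<open>auto simp: \<psi>_def intro!: continuous_intros QA\<close>)
    show ?thesis
      by (rule exI[of _ "of_rat q"], rule exI[of _ d]) (use 3 d in \<open>auto simp: A_def \<psi>_def\<close>)
  qed
  then obtain q d where qd: "\<And>n. 0 < d n" "\<And>n s r. \<lbrakk>0 < \<bar>s\<bar>; \<bar>s\<bar> < d n; 0 < \<bar>r\<bar>; \<bar>r\<bar> < d n\<rbrakk> \<Longrightarrow>
      \<bar>Q s - Q r - q n * (s - r)\<bar> \<le> (\<bar>s\<bar> + \<bar>r\<bar>) / real (Suc n)" by metis
  have ev: "\<forall>\<^sub>F s in at 0. 0 < \<bar>s\<bar> \<and> \<bar>s\<bar> < e" if "0 < e" for e :: real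
    unfolding eventually_at by (intro exI[of _ e]) (use that in \<open>auto simp: dist_real_def\<close>)
  obtain a where a: "(Q \<longlongrightarrow> a) (at 0)"
  proof (rule convergent_if_eventually_near[of "at 0" Q])
    fix e :: real assume e: "0 < e"
    \<comment> \<open>The Cauchy condition for \<open>n = 0\<close> bounds the distance of \<open>Q s\<close> and \<open>Q r\<close> by \<open>K\<close> times the sum of the absolute values of \<open>s\<close> and \<open>r\<close>, so that \<open>Q\<close> has a limit at \<open>0\<close>.\<close>
    define K where "K = \<bar>q 0\<bar> + 1"
    have K: "K > 0" unfolding K_def by simp
    define \<rho> where "\<rho> = min (d 0) (e / (2 * K)) / 2"
    have \<rho>: "0 < \<rho>" "\<rho> < d 0" "\<rho> \<le> e / (4 * K)" unfolding \<rho>_def using qd(1)[of 0] e K by (auto simp: min_def field_simps)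
    have "\<bar>Q s - Q \<rho>\<bar> \<le> e" if s: "0 < \<bar>s\<bar> \<and> \<bar>s\<bar> < \<rho>" for s
    proof -
      have "\<bar>Q s - Q \<rho> - q 0 * (s - \<rho>)\<bar> \<le> (\<bar>s\<bar> + \<bar>\<rho>\<bar>) / real (Suc 0)" using s \<rho> by (intro qd(2)) auto
      then have "\<bar>Q s - Q \<rho> - q 0 * (s - \<rho>)\<bar> \<le> \<bar>s\<bar> + \<rho>" using \<rho> by simp
      moreover have "\<bar>q 0 * (s - \<rho>)\<bar> \<le> \<bar>q 0\<bar> * (\<bar>s\<bar> + \<rho>)" unfolding abs_mult using \<rho> by (intro mult_left_mono) auto
      moreover have "\<bar>u\<bar> \<le> B + C" if "\<bar>u - v\<bar> \<le> C" "\<bar>v\<bar> \<le> B" for u v B C :: real using that by linarith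
      ultimately have "\<bar>Q s - Q \<rho>\<bar> \<le> \<bar>q 0\<bar> * (\<bar>s\<bar> + \<rho>) + (\<bar>s\<bar> + \<rho>)" by blast
      then have "\<bar>Q s - Q \<rho>\<bar> \<le> K * (\<bar>s\<bar> + \<rho>)" unfolding K_def distrib_right by simp
      also have "\<bar>s\<bar> + \<rho> \<le> 2 * (e / (4 * K))" using s \<rho>(3) by linarith
      then have "K * (\<bar>s\<bar> + \<rho>) \<le> K * (2 * (e / (4 * K)))" using K by (intro mult_left_mono) auto
      also have "\<dots> \<le> e" using K e by simp
      finally show ?thesis .
    qed
    then show "\<exists>c. \<forall>\<^sub>F t in at 0. \<bar>Q t - c\<bar> \<le> e"
      by (intro exI[of _ "Q \<rho>"] eventually_mono[OF ev[OF \<rho>(1)]])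
  qed auto
  have Qa: "\<bar>Q s - a - q n * s\<bar> \<le> \<bar>s\<bar> / real (Suc n)" if s: "0 < \<bar>s\<bar>" "\<bar>s\<bar> < d n" for s n
  proof (rule tendsto_le[of "at 0"])
    show "((\<lambda>r. \<bar>Q s - Q r - q n * (s - r)\<bar>) \<longlongrightarrow> \<bar>Q s - a - q n * s\<bar>) (at 0)"
      using a by (auto intro!: tendsto_eq_intros)
    show "((\<lambda>r. (\<bar>s\<bar> + \<bar>r\<bar>) / real (Suc n)) \<longlongrightarrow> \<bar>s\<bar> / real (Suc n)) (at 0)"
      by (auto intro!: tendsto_eq_intros)
    show "\<forall>\<^sub>F r in at 0. \<bar>Q s - Q r - q n * (s - r)\<bar> \<le> (\<bar>s\<bar> + \<bar>r\<bar>) / real (Suc n)"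
      by (rule eventually_mono[OF ev[OF qd(1)[of n]]]) (use qd(2) s in auto)
  qed auto
  have qq: "\<bar>q n - q m\<bar> \<le> 1 / real (Suc n) + 1 / real (Suc m)" for n m
  proof -
    define s where "s = min (d n) (d m) / 2"
    have s: "0 < s" "s < d n" "s < d m" unfolding s_def using qd(1)[of n] qd(1)[of m] by auto
    have "\<bar>(q n - q m) * s\<bar> \<le> s / real (Suc n) + s / real (Suc m)"
      using Qa[of s n] Qa[of s m] s unfolding left_diff_distrib by simp
    then have "\<bar>q n - q m\<bar> * s \<le> (1 / real (Suc n) + 1 / real (Suc m)) * s"
      using s by (simp add: abs_mult distrib_right)
    then show ?thesis using s(1) by (rule mult_right_le_imp_le)
  qed
  obtain q0 where q0: "(q \<longlongrightarrow> q0) sequentially"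
  proof (rule convergent_if_eventually_near[of sequentially q])
    fix e :: real assume e: "0 < e"
    obtain n where n: "1 / real (Suc n) < e / 2" by (meson e half_gt_zero nat_approx_posE)
    have "\<bar>q m - q n\<bar> \<le> e" if "m \<ge> n" for m
    proof -
      have "1 / real (Suc m) \<le> 1 / real (Suc n)" using that by (simp add: frac_le)
      then show ?thesis using qq[of m n] n by linarith
    qed
    then show "\<exists>c. \<forall>\<^sub>F t in sequentially. \<bar>q t - c\<bar> \<le> e"
      by (intro exI[of _ "q n"]) (auto simp: eventually_sequentially)
  qed auto
  have qq0: "\<bar>q n - q0\<bar> \<le> 1 / real (Suc n)" for n
  proof (rule tendsto_le[of sequentially])
    show "(\<lambda>m. \<bar>q n - q m\<bar>) \<longlonglongrightarrow> \<bar>q n - q0\<bar>" using q0 by (auto intro!: tendsto_eq_intros)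
    show "(\<lambda>m. 1 / real (Suc n) + 1 / real (Suc m)) \<longlonglongrightarrow> 1 / real (Suc n)"
      using tendsto_add[OF tendsto_const LIMSEQ_Suc[OF lim_1_over_n]] by simp
  qed (use qq in auto)
  have "second_order_expansion \<phi> 0 a (\<lambda>s. q0 * s^2)"
    unfolding second_order_expansion_def
  proof (intro allI impI)
    fix e :: real assume e: "0 < e"
    obtain n where n: "1 / real (Suc n) < e / 2" by (meson e half_gt_zero nat_approx_posE)
    show "\<exists>d>0. \<forall>z. norm z < d \<longrightarrow> \<bar>\<phi> (0 + z) - \<phi> 0 - a \<bullet> z - q0 * z^2\<bar> \<le> e * (norm z)^2"
    proof (intro exI[of _ "d n"] conjI allI impI qd(1))
      fix z :: real assume z: "norm z < d n"
      show "\<bar>\<phi> (0 + z) - \<phi> 0 - a \<bullet> z - q0 * z^2\<bar> \<le> e * (norm z)^2"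
      proof (cases "z = 0")
        case False
        have "\<bar>(q n - q0) * z\<bar> \<le> 1 / real (Suc n) * \<bar>z\<bar>" unfolding abs_mult using qq0 by (intro mult_right_mono) auto
        moreover have "\<bar>Q z - a - q n * z\<bar> \<le> 1 / real (Suc n) * \<bar>z\<bar>" using Qa[of z n] z False by simp
        ultimately have "\<bar>Q z - a - q0 * z\<bar> \<le> 2 * (1 / real (Suc n) * \<bar>z\<bar>)" unfolding left_diff_distrib by linarith
        also have "\<dots> \<le> 2 * (e / 2 * \<bar>z\<bar>)" using n by (intro mult_left_mono mult_right_mono) auto
        finally have "\<bar>Q z - a - q0 * z\<bar> * \<bar>z\<bar> \<le> e * \<bar>z\<bar> * \<bar>z\<bar>" by (intro mult_right_mono) auto
        moreover have "\<bar>Q z - a - q0 * z\<bar> * \<bar>z\<bar> = \<bar>\<phi> z - \<phi> 0 - a * z - q0 * z^2\<bar>"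
          using False by (simp add: abs_mult[symmetric] Q_def field_simps power2_eq_square)
        ultimately show ?thesis by (simp add: power2_eq_square)
      qed simp
    qed
  qed
  then show thesis by (rule that)
qed

text \<open>
  Fubini's theorem without a choice of coordinates: integrate the indicator of \<open>x + t h \<in> E\<close>, for \<open>t\<close> in the unit
  interval, in both orders. One order gives zero, the other the measure of \<open>E\<close> by translation invariance.
\<close>

lemma negligible_if_null_on_lines:
  fixes E :: "'a::euclidean_space set"
  assumes E[measurable]: "E \<in> sets borel" and lines: "\<And>x. negligible {t::real. x + t *\<^sub>R h \<in> E}"
  shows "negligible E"
proof -
  define F :: "'a \<Rightarrow> real \<Rightarrow> ennreal" where "F x t = indicator E (x + t *\<^sub>R h) * indicator {0..1} t" for x t
  have m: "case_prod F \<in> borel_measurable (lborel \<Otimes>\<^sub>M lborel)" unfolding F_def by measurable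
  have "(\<integral>\<^sup>+ t. (\<integral>\<^sup>+ x. F x t \<partial>lborel) \<partial>lborel) = (\<integral>\<^sup>+ t. emeasure lborel E * indicator {0..1} t \<partial>(lborel :: real measure))"
  proof (rule nn_integral_cong)
    fix t :: real
    have "(\<integral>\<^sup>+ x. F x t \<partial>lborel) = (\<integral>\<^sup>+ x. indicator E (t *\<^sub>R h + x) \<partial>lborel) * indicator {0..1} t"
      unfolding F_def by (subst nn_integral_multc) (auto simp: add.commute)
    also have "(\<integral>\<^sup>+ x. indicator E (t *\<^sub>R h + x) \<partial>lborel) = (\<integral>\<^sup>+ x. indicator E x \<partial>(distr lborel borel ((+) (t *\<^sub>R h))))"
      by (subst nn_integral_distr) auto
    also have "\<dots> = emeasure lborel E" unfolding lborel_distr_plus by simp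
    finally show "(\<integral>\<^sup>+ x. F x t \<partial>lborel) = emeasure lborel E * indicator {0..1} t" .
  qed
  also have "\<dots> = emeasure lborel E" by (subst nn_integral_cmult) auto
  also have "(\<integral>\<^sup>+ t. (\<integral>\<^sup>+ x. F x t \<partial>lborel) \<partial>lborel) = (\<integral>\<^sup>+ x. (\<integral>\<^sup>+ t. F x t \<partial>lborel) \<partial>lborel)"
    by (rule lborel_pair.Fubini'[OF m])
  also have "\<dots> = (\<integral>\<^sup>+ x. 0 \<partial>(lborel :: 'a measure))"
  proof (rule nn_integral_cong)
    fix x :: 'a
    have [measurable]: "{t::real. x + t *\<^sub>R h \<in> E} \<in> sets borel"
    proof -
      have "(\<lambda>t::real. x + t *\<^sub>R h) -` E \<inter> space borel \<in> sets borel" by measurable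
      then show ?thesis by (simp add: vimage_def)
    qed
    have "{t::real. x + t *\<^sub>R h \<in> E} \<in> null_sets lborel"
      using lines[of x] unfolding negligible_iff_null_sets by (subst (asm) null_sets_completion_iff) auto
    then have "AE t in lborel. t \<notin> {t::real. x + t *\<^sub>R h \<in> E}" by (rule AE_not_in)
    then show "(\<integral>\<^sup>+ t. F x t \<partial>lborel) = 0"
      unfolding F_def by (subst nn_integral_0_iff_AE) (auto elim!: eventually_mono)
  qed
  finally have "emeasure lborel E = 0" by simp
  then have "E \<in> null_sets lborel" by auto
  then show ?thesis unfolding negligible_iff_null_sets by (rule null_sets_completionI)
qed

lemma second_order_expansion_shift:
  assumes "second_order_expansion f x p g" and "\<delta> > 0" and "\<And>z. norm z < \<delta> \<Longrightarrow> f' (x' + z) = f (x + z)"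
  shows "second_order_expansion f' x' p g"
  unfolding second_order_expansion_def
proof (intro allI impI)
  fix e :: real assume "0 < e"
  then obtain d where d: "d > 0" "\<And>z. norm z < d \<Longrightarrow> \<bar>f (x + z) - f x - p \<bullet> z - g z\<bar> \<le> e * (norm z)^2"
    using assms(1) unfolding second_order_expansion_def by blast
  have x': "f' x' = f x" using assms(3)[of 0] \<open>\<delta> > 0\<close> by simp
  show "\<exists>d>0. \<forall>z. norm z < d \<longrightarrow> \<bar>f' (x' + z) - f' x' - p \<bullet> z - g z\<bar> \<le> e * (norm z)^2"
    by (intro exI[of _ "min d \<delta>"]) (use d assms(2,3) x' in auto)
qed

text \<open>
  The exceptional set is Borel by its description through \<open>quotients_rat_cauchy\<close>, and on each line parallel to \<open>h\<close> it is null by the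
  one-dimensional case.
\<close>

lemma negligible_no_directional_expansion:
  fixes f :: "'a::euclidean_space \<Rightarrow> real"
  assumes S: "open S" and f: "convex_on S f"
  shows "negligible {x \<in> S. \<nexists>a q. second_order_expansion (\<lambda>t. f (x + t *\<^sub>R h)) 0 a (\<lambda>s. q * s^2)}"
proof -
  \<comment> \<open>Extended by zero, \<open>f\<close> is Borel on the whole space; the condition at a point of the open set \<open>S\<close> is local and sees only values in \<open>S\<close>.\<close>
  define F where "F x = (if x \<in> S then f x else 0)" for x
  have fc: "continuous_on S f" by (rule convex_on_continuous[OF S f])
  have [measurable]: "F \<in> borel_measurable borel"
    unfolding F_def using fc S by (intro borel_measurable_continuous_on_if) auto
  have [measurable]: "S \<in> sets borel" using S by simp
  define E where "E = {x \<in> S. \<not> quotients_rat_cauchy (\<lambda>t. F (x + t *\<^sub>R h))}"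
  have Em: "E \<in> sets borel"
  proof -
    have "Measurable.pred borel (\<lambda>x. x \<in> S \<and> \<not> quotients_rat_cauchy (\<lambda>t. F (x + t *\<^sub>R h)))"
      unfolding quotients_rat_cauchy_def quotients_rat_close_def by measurable
    then show ?thesis unfolding E_def by (simp add: pred_def)
  qed
  have local: "\<exists>\<delta>>0. \<forall>t. \<bar>t\<bar> < \<delta> \<longrightarrow> x + t *\<^sub>R h \<in> S" if x: "x \<in> S" for x
  proof -
    obtain e where e: "e > 0" "ball x e \<subseteq> S" using S x by (auto elim: openE)
    show ?thesis
    proof (intro exI[of _ "e / (norm h + 1)"] conjI allI impI)
      show "0 < e / (norm h + 1)" using e by (simp add: add_nonneg_pos)
      fix t :: real assume "\<bar>t\<bar> < e / (norm h + 1)"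
      then have "\<bar>t\<bar> * (norm h + 1) < e" by (simp add: pos_less_divide_eq add_nonneg_pos)
      then have "\<bar>t\<bar> * norm h < e" using abs_ge_zero[of t] unfolding distrib_left by linarith
      then show "x + t *\<^sub>R h \<in> S" by (intro set_mp[OF e(2)]) (simp add: dist_norm)
    qed
  qed
  have "negligible E"
  proof (rule negligible_if_null_on_lines[OF Em, of h])
    fix x
    define T where "T = {t. x + t *\<^sub>R h \<in> S}"
    have T: "open T"
    proof -
      have "open ((\<lambda>t. x + t *\<^sub>R h) -` S)" by (intro open_vimage S continuous_intros)
      then show ?thesis unfolding T_def vimage_def .
    qed
    have T_conv: "convex_on T (\<lambda>t. f (x + t *\<^sub>R h))"
    proof -
      have eq: "x + (u * a + v * b) *\<^sub>R h = u *\<^sub>R (x + a *\<^sub>R h) + v *\<^sub>R (x + b *\<^sub>R h)" if "u + v = 1" for u v a b :: real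
      proof -
        have "x = u *\<^sub>R x + v *\<^sub>R x" using that by (metis scaleR_left_distrib scaleR_one)
        then show ?thesis by (simp add: algebra_simps)
      qed
      have cS: "convex S" using f convex_on_imp_convex by blast
      have "convex T" unfolding T_def convex_def using cS by (auto simp: eq convexD)
      moreover have "f (x + (u * a + v * b) *\<^sub>R h) \<le> u * f (x + a *\<^sub>R h) + v * f (x + b *\<^sub>R h)"
        if "a \<in> T" "b \<in> T" "0 \<le> u" "0 \<le> v" "u + v = 1" for u v a b
        unfolding eq[OF that(5)] using f that unfolding convex_on_def T_def by blast
      ultimately show ?thesis unfolding convex_on_def by auto
    qed
    have "t \<in> T \<and> \<not> (\<exists>a q. second_order_expansion (\<lambda>t. f (x + t *\<^sub>R h)) t a (\<lambda>s. q * s^2))" if tE: "x + t *\<^sub>R h \<in> E" for t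
    proof (intro conjI notI)
      show "t \<in> T" using tE unfolding E_def T_def by auto
      assume "\<exists>a q. second_order_expansion (\<lambda>t. f (x + t *\<^sub>R h)) t a (\<lambda>s. q * s^2)"
      then obtain a q where aq: "second_order_expansion (\<lambda>t. f (x + t *\<^sub>R h)) t a (\<lambda>s. q * s^2)" by blast
      obtain \<delta> where \<delta>: "\<delta> > 0" "\<And>s. \<bar>s\<bar> < \<delta> \<Longrightarrow> (x + t *\<^sub>R h) + s *\<^sub>R h \<in> S" using local[of "x + t *\<^sub>R h"] tE unfolding E_def by blast
      have "second_order_expansion (\<lambda>s. F ((x + t *\<^sub>R h) + s *\<^sub>R h)) 0 a (\<lambda>s. q * s^2)"
      proof (rule second_order_expansion_shift[OF aq \<delta>(1)])
        fix s :: real assume "norm s < \<delta>"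
        then show "F (x + t *\<^sub>R h + (0 + s) *\<^sub>R h) = f (x + (t + s) *\<^sub>R h)"
          using \<delta>(2)[of s] unfolding F_def by (simp add: algebra_simps)
      qed
      then have "quotients_rat_cauchy (\<lambda>s. F ((x + t *\<^sub>R h) + s *\<^sub>R h))" by (rule quotients_rat_cauchy_if_expansion)
      then show False using tE unfolding E_def by simp
    qed
    then show "negligible {t. x + t *\<^sub>R h \<in> E}"
      by (intro negligible_subset[OF negligible_no_second_order_expansion_real[OF T T_conv]]) blast
  qed
  moreover have "{x \<in> S. \<nexists>a q. second_order_expansion (\<lambda>t. f (x + t *\<^sub>R h)) 0 a (\<lambda>s. q * s^2)} \<subseteq> E"
  proof (safe, rule ccontr)
    fix x assume x: "x \<in> S" "x \<notin> E" and no: "\<nexists>a q. second_order_expansion (\<lambda>t. f (x + t *\<^sub>R h)) 0 a (\<lambda>s. q * s^2)"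
    have cq: "quotients_rat_cauchy (\<lambda>t. F (x + t *\<^sub>R h))" using x unfolding E_def by blast
    obtain \<delta> where \<delta>: "\<delta> > 0" "\<And>s. \<bar>s\<bar> < \<delta> \<Longrightarrow> x + s *\<^sub>R h \<in> S" using local[OF x(1)] by blast
    have "continuous_on {-\<delta><..<\<delta>} (\<lambda>t. f (x + t *\<^sub>R h))"
      by (rule continuous_on_compose2[OF fc]) (auto intro!: continuous_intros \<delta>(2))
    then have "continuous_on {-\<delta><..<\<delta>} (\<lambda>t. F (x + t *\<^sub>R h))"
      by (rule continuous_on_eq) (auto simp: F_def intro!: \<delta>(2))
    then obtain a q where aq: "second_order_expansion (\<lambda>t. F (x + t *\<^sub>R h)) 0 a (\<lambda>s. q * s^2)"
      using expansion_if_quotients_rat_cauchy[OF cq \<delta>(1)] by blast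
    have "second_order_expansion (\<lambda>t. f (x + t *\<^sub>R h)) 0 a (\<lambda>s. q * s^2)"
      by (rule second_order_expansion_shift[OF aq \<delta>(1)]) (use \<delta>(2) in \<open>auto simp: F_def\<close>)
    then show False using no by blast
  qed
  ultimately show ?thesis by (rule negligible_subset)
qed

section \<open>From directional to full expansions\<close>

lemma nonpos_if_le_quadratic:
  fixes a K :: real
  assumes "0 < r" and le: "\<And>t. 0 < t \<Longrightarrow> t < r \<Longrightarrow> t * a \<le> t^2 * K"
  shows "a \<le> 0"
proof (rule ccontr)
  assume "\<not> a \<le> 0"
  then have "0 < a / (\<bar>K\<bar> + 1)" by (simp add: add_nonneg_pos)
  then obtain t where t: "0 < t" "t < r" "t < a / (\<bar>K\<bar> + 1)" using field_lbound_gt_zero[OF \<open>0 < r\<close>] by blast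
  have "t * a \<le> t * (t * K)" using le[OF t(1,2)] by (simp add: power2_eq_square mult.assoc)
  then have "a \<le> t * K" using t(1) by simp
  also have "\<dots> \<le> t * (\<bar>K\<bar> + 1)" using t(1) by (intro mult_left_mono) auto
  also have "\<dots> < a" using t(3) by (simp add: pos_less_divide_eq add_nonneg_pos)
  finally show False by simp
qed

lemma slope_eq_if_touched_from_both_sides:
  fixes u :: "'a::real_inner \<Rightarrow> real"
  assumes "0 < r"
    and lower: "\<And>z. norm z < r \<Longrightarrow> u x + p \<bullet> z - C * (norm z)^2 \<le> u (x + z)"
    and upper: "\<And>z. norm z < r \<Longrightarrow> u (x + z) \<le> u x + b \<bullet> z + D * (norm z)^2"
  shows "p = b"
proof -
  define v where "v = p - b"
  have r': "0 < r / (norm v + 1)" using \<open>0 < r\<close> by (simp add: add_nonneg_pos)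
  have "v \<bullet> v \<le> 0"
  proof (rule nonpos_if_le_quadratic[OF r'])
    fix t :: real assume t: "0 < t" "t < r / (norm v + 1)"
    then have "t * (norm v + 1) < r" by (simp add: pos_less_divide_eq add_nonneg_pos)
    then have "norm (t *\<^sub>R v) < r" using t unfolding distrib_left by simp
    from lower[OF this] upper[OF this] have "t * (p \<bullet> v) - t * (b \<bullet> v) \<le> (C + D) * (norm (t *\<^sub>R v))^2"
      by (simp add: algebra_simps)
    moreover have "(norm (t *\<^sub>R v))^2 = t^2 * (norm v)^2" by (simp add: power_mult_distrib)
    moreover have "t * (v \<bullet> v) = t * (p \<bullet> v) - t * (b \<bullet> v)" unfolding v_def inner_diff_left right_diff_distrib by simp
    ultimately show "t * (v \<bullet> v) \<le> t^2 * ((C + D) * (norm v)^2)" by (simp add: mult.left_commute)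
  qed
  then have "v = 0" by (metis inner_gt_zero_iff not_le)
  then show ?thesis unfolding v_def by simp
qed

text \<open>
  Along the line, \<open>f\<close> lies between the affine minorant and a parabola of slope \<open>a\<close>, and all three agree at \<open>x\<close>.
\<close>

lemma directional_slope_eq_subgradient:
  fixes f :: "'a::euclidean_space \<Rightarrow> real"
  assumes "0 < \<rho>" and sub: "\<And>z. norm z < \<rho> \<Longrightarrow> f x + p \<bullet> z \<le> f (x + z)"
    and exp: "second_order_expansion (\<lambda>t. f (x + t *\<^sub>R h)) 0 a (\<lambda>s. q * s^2)"
  shows "a = p \<bullet> h"
proof -
  obtain d where d: "d > 0" "\<And>s. \<bar>s\<bar> < d \<Longrightarrow> \<bar>f (x + s *\<^sub>R h) - f x - a * s - q * s^2\<bar> \<le> 1 * s^2"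
    using exp[unfolded second_order_expansion_def, rule_format, of 1] by auto
  have "0 < \<rho> / (norm h + 1)" using \<open>0 < \<rho>\<close> by (simp add: add_nonneg_pos)
  with d(1) obtain r where r: "0 < r" "r < d" "r < \<rho> / (norm h + 1)" using field_lbound_gt_zero by blast
  have "p \<bullet> h = a"
  proof (rule slope_eq_if_touched_from_both_sides[of r "\<lambda>s. f (x + s *\<^sub>R h)" 0 _ 0 _ "q + 1"])
    fix s :: real assume s: "norm s < r"
    then have "norm s < \<rho> / (norm h + 1)" using r(3) by linarith
    then have "norm s * (norm h + 1) < \<rho>" by (simp add: pos_less_divide_eq add_nonneg_pos)
    then have "norm (s *\<^sub>R h) < \<rho>" using norm_ge_zero[of s] unfolding distrib_left norm_scaleR real_norm_def by linarith
    from sub[OF this] show "f (x + 0 *\<^sub>R h) + (p \<bullet> h) \<bullet> s - 0 * (norm s)^2 \<le> f (x + (0 + s) *\<^sub>R h)"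
      by (simp add: mult.commute)
    show "f (x + (0 + s) *\<^sub>R h) \<le> f (x + 0 *\<^sub>R h) + a \<bullet> s + (q + 1) * (norm s)^2"
      using d(2)[of s] s r(2) by (simp add: distrib_right abs_le_iff)
  qed (rule r)
  then show ?thesis by simp
qed

lemma convex_on_bounded_Lipschitz:
  fixes \<phi> :: "'a::real_normed_vector \<Rightarrow> real"
  assumes conv: "convex_on (cball 0 (R + 1)) \<phi>"
    and bd: "\<And>h. h \<in> cball 0 (R + 1) \<Longrightarrow> 0 \<le> \<phi> h \<and> \<phi> h \<le> M"
    and h: "h \<in> cball 0 R" "h' \<in> cball 0 R"
  shows "\<bar>\<phi> h' - \<phi> h\<bar> \<le> M * norm (h' - h)"
proof -
  have *: "\<phi> b - \<phi> a \<le> M * norm (b - a)" if ab: "a \<in> cball 0 R" "b \<in> cball 0 R" for a b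
  proof (cases "a = b")
    case False
    define n where "n = norm (b - a)"
    have n: "n > 0" using False unfolding n_def by simp
    \<comment> \<open>Extending the segment beyond \<open>b\<close> by length one gives a point where \<open>\<phi>\<close> is still at most \<open>M\<close>.\<close>
    define w where "w = b + (1 / n) *\<^sub>R (b - a)"
    define l where "l = n / (1 + n)"
    have l: "0 \<le> l" "l \<le> 1" "l \<le> n" unfolding l_def using n by (auto simp: field_simps)
    have "norm w \<le> norm b + norm ((1 / n) *\<^sub>R (b - a))" unfolding w_def by (rule norm_triangle_ineq)
    also have "norm ((1 / n) *\<^sub>R (b - a)) = 1" using n unfolding n_def by simp
    finally have w: "w \<in> cball 0 (R + 1)" using ab by simp
    have a: "a \<in> cball 0 (R + 1)" using ab by simp
    have "l *\<^sub>R w = l *\<^sub>R b + (l / n) *\<^sub>R (b - a)" unfolding w_def by (simp add: scaleR_add_right)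
    also have "l / n = 1 - l" unfolding l_def using n by (simp add: divide_simps)
    finally have "b = (1 - l) *\<^sub>R a + l *\<^sub>R w" by (simp add: algebra_simps)
    then have "\<phi> b \<le> (1 - l) * \<phi> a + l * \<phi> w" using convex_onD[OF conv, of l a w] l a w by simp
    then have "\<phi> b - \<phi> a \<le> l * (\<phi> w - \<phi> a)" by (simp add: algebra_simps)
    also have "\<dots> \<le> l * M" using bd[OF w] bd[OF a] l by (intro mult_left_mono) auto
    also have "\<dots> \<le> n * M" using l(3) bd[OF a] by (intro mult_right_mono) auto
    finally show ?thesis unfolding n_def by (simp add: mult.commute)
  qed simp
  show ?thesis using *[OF h] *[OF h(2,1)] by (simp add: abs_le_iff norm_minus_commute)
qed

text \<open>
  For small \<open>t\<close> the rescaled functions \<open>F t\<close> below are convex and nonnegative, and a finite subset of \<open>D\<close> whose convex hull contains a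
  ball bounds them on that ball. So they are equi-Lipschitz, and pointwise convergence on the dense set \<open>D\<close> becomes locally
  uniform convergence.
\<close>

lemma second_order_expansion_if_directional:
  fixes f :: "'a::euclidean_space \<Rightarrow> real"
  assumes S: "open S" and f: "convex_on S f" and x: "x \<in> S"
    and sub: "\<And>y. y \<in> S \<Longrightarrow> f x + p \<bullet> (y - x) \<le> f y"
    and dense: "closure D = UNIV" and hulls: "\<And>R. \<exists>C\<subseteq>D. finite C \<and> cball 0 R \<subseteq> convex hull C"
    and dir: "\<And>h. h \<in> D \<Longrightarrow> \<exists>a q. second_order_expansion (\<lambda>t. f (x + t *\<^sub>R h)) 0 a (\<lambda>s. q * s^2)"
  obtains g where "second_order_expansion f x p g" "continuous_on UNIV g" "\<And>s z. 0 < s \<Longrightarrow> g (s *\<^sub>R z) = s^2 * g z"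
proof -
  obtain \<rho> where \<rho>: "\<rho> > 0" "ball x \<rho> \<subseteq> S" using S x by (auto elim: openE)
  \<comment> \<open>Subtracting the affine minorant makes \<open>k\<close> nonnegative, so that only upper bounds have to be found.\<close>
  define k where "k z = f (x + z) - f x - p \<bullet> z" for z
  have inS: "x + z \<in> S" if "norm z < \<rho>" for z using that by (intro set_mp[OF \<rho>(2)]) (simp add: dist_norm)
  have k0: "0 \<le> k z" if "norm z < \<rho>" for z using sub[OF inS[OF that]] unfolding k_def by simp
  have kconv: "k (u *\<^sub>R z + v *\<^sub>R w) \<le> u * k z + v * k w" if "norm z < \<rho>" "norm w < \<rho>" "0 \<le> u" "0 \<le> v" "u + v = 1" for u v z w
  proof -
    have uv: "u = 1 - v" using that by simp
    have "f (u *\<^sub>R (x + z) + v *\<^sub>R (x + w)) \<le> u * f (x + z) + v * f (x + w)"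
      using f inS[OF that(1)] inS[OF that(2)] that(3-5) unfolding convex_on_def by blast
    moreover have "u *\<^sub>R (x + z) + v *\<^sub>R (x + w) = x + (u *\<^sub>R z + v *\<^sub>R w)" unfolding uv by (simp add: algebra_simps)
    ultimately show ?thesis unfolding k_def uv by (simp add: algebra_simps)
  qed
  define F where "F t h = k (t *\<^sub>R h) / t^2" for t :: real and h
  have small: "\<forall>\<^sub>F t in at_right 0. 0 < t \<and> t * B < \<rho>" for B :: real
    unfolding eventually_at_right_field
  proof (intro exI[of _ "\<rho> / (\<bar>B\<bar> + 1)"] conjI allI impI)
    fix t assume t: "0 < t" "t < \<rho> / (\<bar>B\<bar> + 1)"
    then have "t * (\<bar>B\<bar> + 1) < \<rho>" by (simp add: pos_less_divide_eq add_nonneg_pos)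
    moreover have "t * B \<le> t * \<bar>B\<bar>" using t by (intro mult_left_mono) auto
    ultimately show "t * B < \<rho>" using t unfolding distrib_left by linarith
  qed (use \<rho> in \<open>auto simp: add_nonneg_pos\<close>)
  have limD: "\<exists>q. (F' \<longlongrightarrow> q) (at_right 0)" if h: "h \<in> D" and F': "F' = (\<lambda>t. F t h)" for h F'
  proof -
    obtain a q where aq: "second_order_expansion (\<lambda>t. f (x + t *\<^sub>R h)) 0 a (\<lambda>s. q * s^2)" using dir[OF h] by blast
    have a: "a = p \<bullet> h"
      by (rule directional_slope_eq_subgradient[OF \<rho>(1) _ aq]) (use sub inS in force)
    have "((\<lambda>t. F t h) \<longlongrightarrow> q) (at_right 0)"
    proof (rule tendstoI)
      fix e :: real assume e: "0 < e"
      obtain d where d: "d > 0" "\<And>s. \<bar>s\<bar> < d \<Longrightarrow> \<bar>f (x + s *\<^sub>R h) - f x - a * s - q * s^2\<bar> \<le> e / 2 * s^2"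
        using aq[unfolded second_order_expansion_def, rule_format, of "e / 2"] e by auto
      show "\<forall>\<^sub>F t in at_right 0. dist (F t h) q < e"
        unfolding eventually_at_right_field
      proof (intro exI[of _ d] conjI allI impI)
        fix t assume t: "0 < t" "t < d"
        have "\<bar>F t h - q\<bar> * t^2 = \<bar>f (x + t *\<^sub>R h) - f x - a * t - q * t^2\<bar>"
          using t unfolding F_def k_def a by (simp add: abs_mult_pos[symmetric] field_simps)
        also have "\<dots> \<le> e / 2 * t^2" using d(2)[of t] t by simp
        finally have "\<bar>F t h - q\<bar> \<le> e / 2" using t by simp
        then show "dist (F t h) q < e" using e unfolding dist_real_def by linarith
      qed (rule d)
    qed
    then show ?thesis using F' by blast
  qed
  then obtain q where q: "\<And>h. h \<in> D \<Longrightarrow> ((\<lambda>t. F t h) \<longlongrightarrow> q h) (at_right 0)" by metis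
  have bound: "\<exists>M\<ge>0. \<forall>\<^sub>F t in at_right 0. convex_on (cball 0 R) (F t) \<and> (\<forall>h\<in>cball 0 R. 0 \<le> F t h \<and> F t h \<le> M)" for R
  proof -
    obtain C where C: "C \<subseteq> D" "finite C" "cball 0 R \<subseteq> convex hull C" using hulls by blast
    define M where "M = (\<Sum>c\<in>C. \<bar>q c\<bar>) + 1"
    have "bounded (convex hull C)" using C by (intro bounded_convex_hull finite_imp_bounded)
    then obtain B where B: "\<And>h. h \<in> convex hull C \<Longrightarrow> norm h \<le> B" by (auto simp: bounded_iff)
    have "\<forall>\<^sub>F t in at_right 0. F t c < M" if c: "c \<in> C" for c
    proof (rule order_tendstoD(2)[OF q])
      show "q c < M" using member_le_sum[OF c, of "\<lambda>c. \<bar>q c\<bar>"] C unfolding M_def by auto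
    qed (use c C in auto)
    then have "\<forall>\<^sub>F t in at_right 0. \<forall>c\<in>C. F t c < M" using C by (intro eventually_ball_finite) auto
    with small[of B] have "\<forall>\<^sub>F t in at_right 0. convex_on (cball 0 R) (F t) \<and> (\<forall>h\<in>cball 0 R. 0 \<le> F t h \<and> F t h \<le> M)"
    proof eventually_elim
      fix t assume t: "0 < t \<and> t * B < \<rho>" and c: "\<forall>c\<in>C. F t c < M"
      have tn: "norm (t *\<^sub>R h) < \<rho>" if "h \<in> convex hull C" for h
      proof -
        have "t * norm h \<le> t * B" using t B[OF that] by (intro mult_left_mono) auto
        then have "t * norm h < \<rho>" using t by linarith
        then show ?thesis using t by simp
      qed
      have conv: "convex_on (convex hull C) (F t)"
        unfolding convex_on_def
      proof (intro conjI ballI allI impI convex_convex_hull)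
        fix a b u v assume ab: "a \<in> convex hull C" "b \<in> convex hull C" and uv: "0 \<le> (u::real)" "0 \<le> v" "u + v = 1"
        have "k (u *\<^sub>R (t *\<^sub>R a) + v *\<^sub>R (t *\<^sub>R b)) \<le> u * k (t *\<^sub>R a) + v * k (t *\<^sub>R b)"
          by (rule kconv[OF tn[OF ab(1)] tn[OF ab(2)] uv])
        moreover have "u *\<^sub>R (t *\<^sub>R a) + v *\<^sub>R (t *\<^sub>R b) = t *\<^sub>R (u *\<^sub>R a + v *\<^sub>R b)" by (simp add: algebra_simps)
        ultimately have "k (t *\<^sub>R (u *\<^sub>R a + v *\<^sub>R b)) / t^2 \<le> (u * k (t *\<^sub>R a) + v * k (t *\<^sub>R b)) / t^2"
          by (intro divide_right_mono) auto
        then show "F t (u *\<^sub>R a + v *\<^sub>R b) \<le> u * F t a + v * F t b" unfolding F_def by (simp add: add_divide_distrib)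
      qed
      have "\<forall>h\<in>convex hull C. F t h \<le> M" by (rule convex_on_convex_hull_bound[OF conv]) (use c in force)
      moreover have "0 \<le> F t h" if "h \<in> convex hull C" for h unfolding F_def using k0[OF tn[OF that]] by simp
      moreover have "convex_on (cball 0 R) (F t)" using convex_on_subset[OF conv C(3)] by simp
      ultimately show "convex_on (cball 0 R) (F t) \<and> (\<forall>h\<in>cball 0 R. 0 \<le> F t h \<and> F t h \<le> M)" using C(3) by blast
    qed
    moreover have "M \<ge> 0" unfolding M_def by (simp add: sum_nonneg add_nonneg_nonneg)
    ultimately show ?thesis by blast
  qed
  have lip: "\<exists>M\<ge>0. \<forall>\<^sub>F t in at_right 0. \<forall>h\<in>cball 0 R. \<forall>h'\<in>cball 0 R. \<bar>F t h' - F t h\<bar> \<le> M * norm (h' - h)" for R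
  proof -
    obtain M where "M \<ge> 0" and M: "\<forall>\<^sub>F t in at_right 0. convex_on (cball 0 (R + 1)) (F t) \<and> (\<forall>h\<in>cball 0 (R + 1). 0 \<le> F t h \<and> F t h \<le> M)"
      using bound by blast
    then show ?thesis by (intro exI[of _ M] conjI) (auto elim!: eventually_mono intro!: convex_on_bounded_Lipschitz)
  qed
  have "\<exists>l. ((\<lambda>t. F t h) \<longlongrightarrow> l) (at_right 0)" for h
  proof -
    define R where "R = norm h + 1"
    obtain M where M: "M \<ge> 0" "\<forall>\<^sub>F t in at_right 0. \<forall>h\<in>cball 0 R. \<forall>h'\<in>cball 0 R. \<bar>F t h' - F t h\<bar> \<le> M * norm (h' - h)"
      using lip by blast
    obtain l where "((\<lambda>t. F t h) \<longlongrightarrow> l) (at_right 0)"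
    proof (rule convergent_if_eventually_near[of "at_right 0" "\<lambda>t. F t h"])
      fix e :: real assume e: "0 < e"
      define \<eta> where "\<eta> = min 1 (e / (2 * (M + 1)))"
      have \<eta>: "0 < \<eta>" "\<eta> \<le> 1" "M * \<eta> \<le> e / 2"
      proof -
        show "0 < \<eta>" "\<eta> \<le> 1" unfolding \<eta>_def using e M by auto
        have "M * \<eta> \<le> (M + 1) * (e / (2 * (M + 1)))" using M e \<open>0 < \<eta>\<close> by (intro mult_mono) (auto simp: \<eta>_def)
        also have "\<dots> = e / 2" using M(1) by (simp add: field_simps)
        finally show "M * \<eta> \<le> e / 2" .
      qed
      have "h \<in> closure D" using dense by simp
      then obtain h0 where h0: "h0 \<in> D" "dist h0 h < \<eta>" using \<eta>(1) by (auto simp: closure_approachable)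
      have hR: "h \<in> cball 0 R" unfolding R_def by simp
      have h0R: "h0 \<in> cball 0 R" using h0(2) \<eta>(2) norm_triangle_sub[of h0 h] unfolding R_def by (simp add: dist_norm)
      have "\<forall>\<^sub>F t in at_right 0. \<bar>F t h0 - q h0\<bar> < e / 2" using tendstoD[OF q[OF h0(1)], of "e/2"] e by (simp add: dist_real_def)
      with M(2) have "\<forall>\<^sub>F t in at_right 0. \<bar>F t h - q h0\<bar> \<le> e"
      proof eventually_elim
        case (elim t)
        have "\<bar>F t h - F t h0\<bar> \<le> M * norm (h - h0)" using elim(1) hR h0R by blast
        also have "\<dots> \<le> M * \<eta>" using h0(2) M(1) by (intro mult_left_mono) (auto simp: dist_norm norm_minus_commute)
        finally show ?case using elim(2) \<eta>(3) by linarith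
      qed
      then show "\<exists>c. \<forall>\<^sub>F t in at_right 0. \<bar>F t h - c\<bar> \<le> e" by blast
    qed auto
    then show ?thesis by blast
  qed
  then obtain g where g: "\<And>h. ((\<lambda>t. F t h) \<longlongrightarrow> g h) (at_right 0)" by metis
  have glip: "\<exists>M\<ge>0. \<forall>h\<in>cball 0 R. \<forall>h'\<in>cball 0 R. \<bar>g h' - g h\<bar> \<le> M * norm (h' - h)" for R
  proof -
    obtain M where M: "M \<ge> 0" "\<forall>\<^sub>F t in at_right 0. \<forall>h\<in>cball 0 R. \<forall>h'\<in>cball 0 R. \<bar>F t h' - F t h\<bar> \<le> M * norm (h' - h)"
      using lip by blast
    have "\<bar>g h' - g h\<bar> \<le> M * norm (h' - h)" if "h \<in> cball 0 R" "h' \<in> cball 0 R" for h h'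
      by (rule tendsto_upperbound[of "\<lambda>t. \<bar>F t h' - F t h\<bar>" _ "at_right 0"])
        (use that in \<open>auto intro!: tendsto_intros g eventually_mono[OF M(2)]\<close>)
    then show ?thesis using M(1) by blast
  qed
  have gcont: "continuous_on UNIV g"
    unfolding continuous_on_iff
  proof (intro ballI allI impI)
    fix h :: 'a and e :: real assume e: "0 < e"
    obtain M where M: "M \<ge> 0" "\<And>h' h''. h' \<in> cball 0 (norm h + 1) \<Longrightarrow> h'' \<in> cball 0 (norm h + 1) \<Longrightarrow> \<bar>g h'' - g h'\<bar> \<le> M * norm (h'' - h')"
      using glip[of "norm h + 1"] by blast
    have K: "0 < e / (M + 1)" using e M by simp
    show "\<exists>d>0. \<forall>h'\<in>UNIV. dist h' h < d \<longrightarrow> dist (g h') (g h) < e"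
    proof (intro exI[of _ "min 1 (e / (M + 1))"] conjI ballI impI)
      fix h' assume h': "dist h' h < min 1 (e / (M + 1))"
      have "h' \<in> cball 0 (norm h + 1)" using h' norm_triangle_sub[of h' h] by (simp add: dist_norm)
      then have "\<bar>g h' - g h\<bar> \<le> M * norm (h' - h)" by (intro M(2)) auto
      also have "\<dots> \<le> (M + 1) * norm (h' - h)" by (intro mult_right_mono) auto
      also have "\<dots> < (M + 1) * (e / (M + 1))" using h' M(1) by (intro mult_strict_left_mono) (auto simp: dist_norm)
      also have "\<dots> = e" using M(1) by simp
      finally show "dist (g h') (g h) < e" by (simp add: dist_real_def)
    qed (use K in auto)
  qed
  have ghom: "g (s *\<^sub>R z) = s^2 * g z" if s: "0 < s" for s z
  proof (rule tendsto_unique[of "at_right 0"])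
    show "((\<lambda>t. F t (s *\<^sub>R z)) \<longlongrightarrow> g (s *\<^sub>R z)) (at_right 0)" by (rule g)
    have "filterlim (\<lambda>t. t * s) (at_right 0) (at_right 0)"
      unfolding filterlim_at
    proof
      show "\<forall>\<^sub>F t in at_right 0. t * s \<in> {0<..} \<and> t * s \<noteq> 0"
        by (rule eventually_mono[OF eventually_at_right_less]) (use s in auto)
      show "((\<lambda>t. t * s) \<longlongrightarrow> 0) (at_right 0)" by (auto intro!: tendsto_eq_intros)
    qed
    then have "((\<lambda>t. F (t * s) z) \<longlongrightarrow> g z) (at_right 0)" by (rule filterlim_compose[OF g])
    then have "((\<lambda>t. s^2 * F (t * s) z) \<longlongrightarrow> s^2 * g z) (at_right 0)" by (intro tendsto_intros)
    moreover have "s^2 * F (t * s) z = F t (s *\<^sub>R z)" for t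
      using s unfolding F_def by (simp add: power_mult_distrib)
    ultimately show "((\<lambda>t. F t (s *\<^sub>R z)) \<longlongrightarrow> s^2 * g z) (at_right 0)" by simp
  qed auto
  have g0: "g 0 = 0"
  proof (rule tendsto_unique[of "at_right 0"])
    show "((\<lambda>t. F t 0) \<longlongrightarrow> g 0) (at_right 0)" by (rule g)
    show "((\<lambda>t. F t 0) \<longlongrightarrow> 0) (at_right 0)" unfolding F_def k_def by simp
  qed auto
  have unif: "\<forall>\<^sub>F t in at_right 0. \<forall>h\<in>cball 0 1. \<bar>F t h - g h\<bar> \<le> e" if e: "0 < e" for e
  proof -
    obtain M1 where M1: "M1 \<ge> 0" "\<forall>\<^sub>F t in at_right 0. \<forall>h\<in>cball 0 1. \<forall>h'\<in>cball 0 1. \<bar>F t h' - F t h\<bar> \<le> M1 * norm (h' - h)"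
      using lip by blast
    obtain M2 where M2: "M2 \<ge> 0" "\<And>h h'. h \<in> cball 0 1 \<Longrightarrow> h' \<in> cball 0 1 \<Longrightarrow> \<bar>g h' - g h\<bar> \<le> M2 * norm (h' - h)"
      using glip[of 1] by blast
    define \<eta> where "\<eta> = e / (3 * (M1 + M2 + 1))"
    have \<eta>: "0 < \<eta>" "M1 * \<eta> \<le> e / 3" "M2 * \<eta> \<le> e / 3"
    proof -
      show \<eta>0: "0 < \<eta>" unfolding \<eta>_def using e M1(1) M2(1) by simp
      have "K \<noteq> 0 \<Longrightarrow> K * (e / (3 * K)) = e / 3" for K by simp
      then have "(M1 + M2 + 1) * \<eta> = e / 3" unfolding \<eta>_def using M1(1) M2(1) by (smt (verit))
      then have sum: "M1 * \<eta> + M2 * \<eta> + \<eta> = e / 3" by (simp only: distrib_right mult_1)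
      have "0 \<le> M1 * \<eta>" "0 \<le> M2 * \<eta>" using M1(1) M2(1) \<eta>0 by auto
      then show "M1 * \<eta> \<le> e / 3" "M2 * \<eta> \<le> e / 3" using sum \<eta>0 by linarith+
    qed
    have "compact (cball 0 1 :: 'a set)" by simp
    then obtain C where C: "C \<subseteq> cball (0::'a) 1" "finite C" "cball 0 1 \<subseteq> (\<Union>c\<in>C. ball c \<eta>)"
      by (rule compactE_image[of _ "cball 0 1" "\<lambda>c. ball c \<eta>"]) (use \<eta>(1) in auto)
    have "\<forall>\<^sub>F t in at_right 0. \<forall>c\<in>C. \<bar>F t c - g c\<bar> < e / 3"
    proof (intro eventually_ball_finite C(2) ballI)
      fix c show "\<forall>\<^sub>F t in at_right 0. \<bar>F t c - g c\<bar> < e / 3" using tendstoD[OF g[of c], of "e / 3"] e by (simp add: dist_real_def)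
    qed
    with M1(2) show ?thesis
    proof eventually_elim
      case (elim t)
      show ?case
      proof
        fix h :: 'a assume h: "h \<in> cball 0 1"
        then obtain c where c: "c \<in> C" "dist c h < \<eta>" using C(3) by auto
        have c1: "c \<in> cball 0 1" using c C by auto
        have nm: "norm (h - c) \<le> \<eta>" using c(2) by (simp add: dist_norm norm_minus_commute)
        have "\<bar>F t h - F t c\<bar> \<le> M1 * norm (h - c)" using elim(1) h c1 by blast
        also have "\<dots> \<le> M1 * \<eta>" using nm M1(1) by (rule mult_left_mono)
        finally have 1: "\<bar>F t h - F t c\<bar> \<le> e / 3" using \<eta>(2) by linarith
        have "\<bar>g h - g c\<bar> \<le> M2 * norm (h - c)" using M2(2) h c1 by blast
        also have "\<dots> \<le> M2 * \<eta>" using nm M2(1) by (rule mult_left_mono)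
        finally have 2: "\<bar>g h - g c\<bar> \<le> e / 3" using \<eta>(3) by linarith
        have "\<bar>F t c - g c\<bar> < e / 3" using elim(2) c by blast
        then show "\<bar>F t h - g h\<bar> \<le> e" using 1 2 by linarith
      qed
    qed
  qed
  have exp: "second_order_expansion f x p g"
    unfolding second_order_expansion_def
  proof (intro allI impI)
    fix e :: real assume "0 < e"
    then obtain b where b: "b > 0" "\<And>t h. 0 < t \<Longrightarrow> t < b \<Longrightarrow> h \<in> cball 0 1 \<Longrightarrow> \<bar>F t h - g h\<bar> \<le> e"
      using unif unfolding eventually_at_right_field by meson
    show "\<exists>d>0. \<forall>z. norm z < d \<longrightarrow> \<bar>f (x + z) - f x - p \<bullet> z - g z\<bar> \<le> e * (norm z)^2"
    proof (intro exI[of _ b] conjI allI impI b(1))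
      fix z :: 'a assume z: "norm z < b"
      show "\<bar>f (x + z) - f x - p \<bullet> z - g z\<bar> \<le> e * (norm z)^2"
      proof (cases "z = 0")
        case False
        define t h where "t = norm z" and "h = (1 / norm z) *\<^sub>R z"
        have t: "0 < t" "t < b" "z = t *\<^sub>R h" "h \<in> cball 0 1" using False z unfolding t_def h_def by auto
        have "F t h * t^2 = k (t *\<^sub>R h)" unfolding F_def using t(1) by simp
        then have "k (t *\<^sub>R h) - g (t *\<^sub>R h) = (F t h - g h) * t^2"
          unfolding ghom[OF t(1)] by (simp only: left_diff_distrib) (simp add: mult.commute)
        then have "\<bar>k z - g z\<bar> = \<bar>F t h - g h\<bar> * t^2" unfolding t(3)[symmetric] by (simp add: abs_mult)
        also have "\<dots> \<le> e * t^2" using b(2)[OF t(1,2,4)] by (intro mult_right_mono) auto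
        finally show ?thesis unfolding k_def t_def .
      qed (simp add: g0)
    qed
  qed
  show thesis
  proof (rule that)
    show "g (s *\<^sub>R z) = s^2 * g z" if "0 < s" for s z using that by (rule ghom)
  qed (rule exp gcont)+
qed

text \<open>
  Adding the vertices of larger and larger cubes to a countable dense set gives a set of directions that fits
  \<open>second_order_expansion_if_directional\<close>.
\<close>

lemma countable_dense_with_hulls:
  obtains D :: "'a::euclidean_space set" where "countable D" "closure D = UNIV"
    "\<forall>R. \<exists>C\<subseteq>D. finite C \<and> cball 0 R \<subseteq> convex hull C"
proof -
  have "\<exists>D0 :: 'a set. countable D0 \<and> (\<forall>X. open X \<longrightarrow> X \<noteq> {} \<longrightarrow> (\<exists>d\<in>D0. d \<in> X))"
    by (rule countable_dense_exists)
  then obtain D0 :: "'a set" where D0': "countable D0 \<and> (\<forall>X. open X \<longrightarrow> X \<noteq> {} \<longrightarrow> (\<exists>d\<in>D0. d \<in> X))" by (rule exE)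
  then have D0: "countable D0" "\<And>X. open X \<Longrightarrow> X \<noteq> {} \<Longrightarrow> \<exists>d\<in>D0. d \<in> X" by simp_all
  have "\<exists>C :: 'a set. finite C \<and> cball 0 (real n) \<subseteq> convex hull C" for n
  proof -
    have "0 < real n + 1" by simp
    then obtain C :: "'a set" where C: "finite C"
      "cbox (0 - (\<Sum>i\<in>Basis. (real n + 1) *\<^sub>R i)) (0 + (\<Sum>i\<in>Basis. (real n + 1) *\<^sub>R i)) = convex hull C"
      by (rule cube_convex_hull)
    have "cball 0 (real n) \<subseteq> convex hull C" unfolding C(2)[symmetric]
    proof
      fix z :: 'a assume "z \<in> cball 0 (real n)"
      then have "\<bar>z \<bullet> i\<bar> \<le> real n + 1" if "i \<in> Basis" for i using Basis_le_norm[OF that, of z] by simp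
      then show "z \<in> cbox (0 - (\<Sum>i\<in>Basis. (real n + 1) *\<^sub>R i)) (0 + (\<Sum>i\<in>Basis. (real n + 1) *\<^sub>R i))"
        by (force simp: mem_box inner_sum_left_Basis inner_diff_left abs_le_iff)
    qed
    then show ?thesis using C(1) by blast
  qed
  then obtain C :: "nat \<Rightarrow> 'a set" where C: "\<And>n. finite (C n)" "\<And>n. cball 0 (real n) \<subseteq> convex hull (C n)" by metis
  show thesis
  proof (rule that[of "D0 \<union> (\<Union>n. C n)"])
    show "countable (D0 \<union> (\<Union>n. C n))" using D0(1) C(1) by (auto intro: countable_finite)
    have "closure D0 = UNIV"
    proof (rule ccontr)
      assume "closure D0 \<noteq> UNIV"
      then have "\<exists>d\<in>D0. d \<in> - closure D0" by (intro D0(2)) auto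
      then show False using closure_subset by blast
    qed
    then show "closure (D0 \<union> (\<Union>n. C n)) = UNIV" by (simp add: closure_Un)
    show "\<forall>R. \<exists>C'\<subseteq>D0 \<union> (\<Union>n. C n). finite C' \<and> cball 0 R \<subseteq> convex hull C'"
    proof
      fix R :: real
      obtain n :: nat where "R \<le> real n" using real_arch_simple by blast
      then have "cball 0 R \<subseteq> convex hull (C n)" using C(2)[of n] by (meson subset_cball subset_trans)
      then show "\<exists>C'\<subseteq>D0 \<union> (\<Union>n. C n). finite C' \<and> cball 0 R \<subseteq> convex hull C'"
        using C(1) by (intro exI[of _ "C n"]) auto
    qed
  qed
qed

section \<open>The limit is a quadratic form at almost every point\<close>

definition homogeneous2 :: "('a::real_vector \<Rightarrow> real) \<Rightarrow> bool"
  where "homogeneous2 g \<longleftrightarrow> (\<forall>s z. 0 < s \<longrightarrow> g (s *\<^sub>R z) = s^2 * g z)"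

definition mixed_difference :: "('a::real_vector \<Rightarrow> real) \<Rightarrow> 'a \<Rightarrow> 'a \<Rightarrow> 'a \<Rightarrow> real"
  where "mixed_difference g h k1 k2 = g (h + (k1 + k2)) - g (h + k1) - g (h + k2) + g h"

lemma homogeneous2_0: "homogeneous2 g \<Longrightarrow> g 0 = 0"
  unfolding homogeneous2_def by (drule spec[of _ 2], drule spec[of _ 0]) simp

text \<open>
  The constant and the linear part of an expansion drop out of mixed second differences. Each of the four values of
  \<open>f\<close> contributes an error of at most \<open>\<epsilon> (t R)\<^sup>2\<close>.
\<close>

lemma mixed_difference_expansion:
  fixes f :: "'a::real_inner \<Rightarrow> real"
  assumes exp: "\<And>z. norm z < \<delta> \<Longrightarrow> \<bar>f (x + z) - f x - p \<bullet> z - g z\<bar> \<le> \<epsilon> * (norm z)^2"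
    and hom: "homogeneous2 g" and "0 \<le> \<epsilon>" and t: "0 < t" "t * R < \<delta>"
    and R: "norm h \<le> R" "norm (h + k1) \<le> R" "norm (h + k2) \<le> R" "norm (h + (k1 + k2)) \<le> R"
  shows "\<bar>mixed_difference f (x + t *\<^sub>R h) (t *\<^sub>R k1) (t *\<^sub>R k2) - t^2 * mixed_difference g h k1 k2\<bar> \<le> 4 * (\<epsilon> * (t * R)^2)"
proof -
  have *: "\<bar>f (x + t *\<^sub>R w) - (f x + t * (p \<bullet> w) + t^2 * g w)\<bar> \<le> \<epsilon> * (t * R)^2" if w: "norm w \<le> R" for w
  proof -
    have n: "norm (t *\<^sub>R w) \<le> t * R" using t w by simp
    then have "\<bar>f (x + t *\<^sub>R w) - f x - p \<bullet> (t *\<^sub>R w) - g (t *\<^sub>R w)\<bar> \<le> \<epsilon> * (norm (t *\<^sub>R w))^2" using t by (intro exp) linarith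
    also have "\<dots> \<le> \<epsilon> * (t * R)^2" using n \<open>0 \<le> \<epsilon>\<close> by (intro mult_left_mono power_mono) auto
    finally show ?thesis using hom t unfolding homogeneous2_def by (simp add: algebra_simps)
  qed
  have e: "x + t *\<^sub>R h + (t *\<^sub>R k1 + t *\<^sub>R k2) = x + t *\<^sub>R (h + (k1 + k2))" "x + t *\<^sub>R h + t *\<^sub>R k1 = x + t *\<^sub>R (h + k1)"
     "x + t *\<^sub>R h + t *\<^sub>R k2 = x + t *\<^sub>R (h + k2)" by (simp_all add: algebra_simps)
  define E where "E w = f (x + t *\<^sub>R w) - (f x + t * (p \<bullet> w) + t^2 * g w)" for w
  have "mixed_difference f (x + t *\<^sub>R h) (t *\<^sub>R k1) (t *\<^sub>R k2) - t^2 * mixed_difference g h k1 k2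
      = E (h + (k1 + k2)) - E (h + k1) - E (h + k2) + E h"
    unfolding mixed_difference_def e E_def by (simp add: inner_add_right algebra_simps)
  then show ?thesis using *[OF R(1)] *[OF R(2)] *[OF R(3)] *[OF R(4)] unfolding E_def[symmetric] by linarith
qed

text \<open>
  Points are sorted into countably many classes \<open>A m i\<close>: in one class the expansions hold up to \<open>\<epsilon>\<close> at a common scale, the
  functions \<open>g x\<close> have a common modulus of continuity, and their mixed differences at \<open>0\<close> agree up to \<open>\<epsilon>\<close>. If two points
  \<open>x\<close> and \<open>y\<close> of a class satisfy \<open>y \<approx> x + t h\<close>, the mixed difference of \<open>f\<close> at \<open>y\<close> can be computed from either
  expansion, and so the two mixed differences of \<open>g x\<close> are close. Where they are not close, the
  class has no point near \<open>x + t h\<close>: it is porous.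
\<close>

lemma negligible_mixed_difference_mismatch:
  fixes f :: "'a::euclidean_space \<Rightarrow> real"
  assumes exp: "\<And>x. x \<in> E \<Longrightarrow> second_order_expansion f x (p x) (g x)"
    and cont: "\<And>x. x \<in> E \<Longrightarrow> continuous_on UNIV (g x)" and hom: "\<And>x. x \<in> E \<Longrightarrow> homogeneous2 (g x)"
  shows "negligible {x \<in> E. mixed_difference (g x) h k1 k2 \<noteq> mixed_difference (g x) 0 k1 k2}"
proof -
  define R where "R = norm h + norm k1 + norm k2 + 1"
  define \<alpha> where "\<alpha> x = mixed_difference (g x) h k1 k2" for x
  define \<beta> where "\<beta> x = mixed_difference (g x) 0 k1 k2" for x
  \<comment> \<open>Two expansions with four errors \<open>\<epsilon> R\<^sup>2\<close> each, four errors \<open>\<epsilon>\<close> from moving \<open>h\<close>, and one from the rounding of \<open>\<beta>\<close>.\<close>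
  define C where "C = 8 * R^2 + 5"
  have R: "R \<ge> 1" unfolding R_def by simp
  then have C: "C > 0" unfolding C_def by (simp add: add_nonneg_pos)
  have RB: "norm (h + v) \<le> R \<and> norm (h + v + k1) \<le> R \<and> norm (h + v + k2) \<le> R \<and> norm (h + v + (k1 + k2)) \<le> R" if "norm v \<le> 1" for v
    unfolding R_def
    using that norm_triangle_ineq[of h v] norm_triangle_ineq[of "h + v" k1] norm_triangle_ineq[of "h + v" k2]
      norm_triangle_ineq[of "h + v" "k1 + k2"] norm_triangle_ineq[of k1 k2] norm_ge_zero[of k1] norm_ge_zero[of k2]
    by (intro conjI) linarith+
  have Rk: "norm k1 \<le> R" "norm k2 \<le> R" "norm (k1 + k2) \<le> R"
    using norm_triangle_ineq[of k1 k2] norm_ge_zero[of h] norm_ge_zero[of k1] norm_ge_zero[of k2] unfolding R_def by linarith+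
  have bad: "negligible {x \<in> E. C * \<epsilon> < \<bar>\<alpha> x - \<beta> x\<bar>}" if \<epsilon>: "0 < \<epsilon>" for \<epsilon>
  proof -
    define A where "A m i = {x \<in> E. C * \<epsilon> < \<bar>\<alpha> x - \<beta> x\<bar> \<and> i = \<lfloor>\<beta> x / \<epsilon>\<rfloor> \<and>
        (\<forall>z. norm z < 1 / real (Suc m) \<longrightarrow> \<bar>f (x + z) - f x - p x \<bullet> z - g x z\<bar> \<le> \<epsilon> * (norm z)^2) \<and>
        (\<forall>w\<in>cball 0 R. \<forall>w'\<in>cball 0 R. norm (w - w') < 1 / real (Suc m) \<longrightarrow> \<bar>g x w - g x w'\<bar> \<le> \<epsilon>)}" for m :: nat and i :: int
    have "negligible (A m i)" for m i
    proof (rule negligible_if_porous)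
      define \<eta> where "\<eta> = 1 / real (Suc m)"
      have \<eta>: "0 < \<eta>" "\<eta> \<le> 1" unfolding \<eta>_def by auto
      show "0 < \<eta> / R" "\<eta> / R \<le> 1" using \<eta> R by auto
      fix x and d :: real assume x: "x \<in> A m i" and d: "0 < d"
      have xE: "x \<in> E" using x unfolding A_def by blast
      obtain r where r: "0 < r" "r < d" "r < \<eta>" using field_lbound_gt_zero[OF d \<eta>(1)] by blast
      define t where "t = r / R"
      have t: "0 < t" "t * R = r" unfolding t_def using r R by auto
      have c: "\<eta> / R * r = t * \<eta>" unfolding t_def by simp
      show "\<exists>r y. 0 < r \<and> r < d \<and> ball y (\<eta> / R * r) \<subseteq> cball x r \<and> A m i \<inter> ball y (\<eta> / R * r) = {}"
      proof (rule exI[of _ r], rule exI[of _ "x + t *\<^sub>R h"], intro conjI r)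
        show "ball (x + t *\<^sub>R h) (\<eta> / R * r) \<subseteq> cball x r"
        proof
          fix y assume "y \<in> ball (x + t *\<^sub>R h) (\<eta> / R * r)"
          then have "dist y (x + t *\<^sub>R h) < t * \<eta>" unfolding c by (simp add: dist_commute)
          moreover have "dist (x + t *\<^sub>R h) x = t * norm h" using t by (simp add: dist_norm)
          ultimately have "dist y x \<le> t * \<eta> + t * norm h" using dist_triangle[of y x "x + t *\<^sub>R h"] by linarith
          also have "\<dots> = t * (\<eta> + norm h)" by (simp add: algebra_simps)
          also have "\<eta> + norm h \<le> R" using \<eta>(2) norm_ge_zero[of k1] norm_ge_zero[of k2] unfolding R_def by linarith
          then have "t * (\<eta> + norm h) \<le> t * R" using t(1) by (intro mult_left_mono) auto
          finally show "y \<in> cball x r" using t by (simp add: dist_commute)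
        qed
        show "A m i \<inter> ball (x + t *\<^sub>R h) (\<eta> / R * r) = {}"
        proof (rule ccontr)
          assume "A m i \<inter> ball (x + t *\<^sub>R h) (\<eta> / R * r) \<noteq> {}"
          then obtain y where y: "y \<in> A m i" "dist (x + t *\<^sub>R h) y < t * \<eta>" unfolding c by auto
          have yE: "y \<in> E" using y unfolding A_def by blast
          \<comment> \<open>In rescaled coordinates \<open>y\<close> lies at \<open>h + v\<close>, and \<open>v\<close> is small.\<close>
          define v where "v = (1 / t) *\<^sub>R (y - x) - h"
          have yv: "y = x + t *\<^sub>R (h + v)" unfolding v_def using t by simp
          have "t * norm v = dist (x + t *\<^sub>R h) y" unfolding yv using t by (simp add: dist_norm scaleR_add_right)
          then have "t * norm v < t * \<eta>" using y(2) by simp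
          then have v: "norm v < \<eta>" using t(1) by simp
          have v1: "norm v \<le> 1" using v \<eta> by simp
          have RB': "norm (h + v) \<le> R" "norm (h + v + k1) \<le> R" "norm (h + v + k2) \<le> R" "norm (h + v + (k1 + k2)) \<le> R"
            using RB[OF v1] by auto
          have RB0: "norm h \<le> R" "norm (h + k1) \<le> R" "norm (h + k2) \<le> R" "norm (h + (k1 + k2)) \<le> R"
            using RB[of 0] by auto
          have D1: "\<bar>mixed_difference f y (t *\<^sub>R k1) (t *\<^sub>R k2) - t^2 * mixed_difference (g x) (h + v) k1 k2\<bar> \<le> 4 * (\<epsilon> * (t * R)^2)"
            unfolding yv
            by (rule mixed_difference_expansion[where \<delta> = \<eta> and p = "p x"]) (use x r t RB' \<epsilon> hom[OF xE] in \<open>auto simp: A_def \<eta>_def\<close>)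
          have "\<bar>mixed_difference f (y + t *\<^sub>R 0) (t *\<^sub>R k1) (t *\<^sub>R k2) - t^2 * mixed_difference (g y) 0 k1 k2\<bar> \<le> 4 * (\<epsilon> * (t * R)^2)"
            by (rule mixed_difference_expansion[where \<delta> = \<eta> and p = "p y"]) (use y(1) r t Rk R \<epsilon> hom[OF yE] in \<open>auto simp: A_def \<eta>_def\<close>)
          then have D2: "\<bar>mixed_difference f y (t *\<^sub>R k1) (t *\<^sub>R k2) - t^2 * \<beta> y\<bar> \<le> 4 * (\<epsilon> * (t * R)^2)" unfolding \<beta>_def by simp
          have near: "\<bar>g x w - g x w'\<bar> \<le> \<epsilon>" if "norm w \<le> R" "norm w' \<le> R" "w - w' = v" for w w'
            using x v that unfolding A_def \<eta>_def by auto
          have "\<bar>g x (h + v + (k1 + k2)) - g x (h + (k1 + k2))\<bar> \<le> \<epsilon>" "\<bar>g x (h + v + k1) - g x (h + k1)\<bar> \<le> \<epsilon>"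
            "\<bar>g x (h + v + k2) - g x (h + k2)\<bar> \<le> \<epsilon>" "\<bar>g x (h + v) - g x h\<bar> \<le> \<epsilon>"
            using RB' RB0 by (auto intro!: near)
          then have "\<bar>mixed_difference (g x) (h + v) k1 k2 - \<alpha> x\<bar> \<le> 4 * \<epsilon>"
            unfolding \<alpha>_def mixed_difference_def by linarith
          then have "t^2 * \<bar>mixed_difference (g x) (h + v) k1 k2 - \<alpha> x\<bar> \<le> t^2 * (4 * \<epsilon>)" by (rule mult_left_mono) simp
          then have D3: "\<bar>t^2 * mixed_difference (g x) (h + v) k1 k2 - t^2 * \<alpha> x\<bar> \<le> t^2 * (4 * \<epsilon>)"
            by (simp add: abs_mult right_diff_distrib[symmetric])
          have "\<lfloor>\<beta> x / \<epsilon>\<rfloor> = \<lfloor>\<beta> y / \<epsilon>\<rfloor>" using x y(1) unfolding A_def by auto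
          then have "\<bar>\<beta> x / \<epsilon> - \<beta> y / \<epsilon>\<bar> \<le> 1" by linarith
          then have "\<bar>\<beta> x - \<beta> y\<bar> \<le> \<epsilon>" using \<epsilon> by (simp add: diff_divide_distrib[symmetric] abs_divide)
          then have "t^2 * \<bar>\<beta> x - \<beta> y\<bar> \<le> t^2 * \<epsilon>" by (rule mult_left_mono) simp
          then have D4: "\<bar>t^2 * \<beta> x - t^2 * \<beta> y\<bar> \<le> t^2 * \<epsilon>" by (simp add: abs_mult right_diff_distrib[symmetric])
          have "\<bar>t^2 * \<alpha> x - t^2 * \<beta> x\<bar> \<le> 8 * (\<epsilon> * (t * R)^2) + t^2 * (4 * \<epsilon>) + t^2 * \<epsilon>"
            using D1 D2 D3 D4 by linarith
          also have "\<dots> = t^2 * (C * \<epsilon>)" unfolding C_def by (simp add: power_mult_distrib algebra_simps)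
          finally have "t^2 * \<bar>\<alpha> x - \<beta> x\<bar> \<le> t^2 * (C * \<epsilon>)" by (simp add: abs_mult right_diff_distrib[symmetric])
          then have "\<bar>\<alpha> x - \<beta> x\<bar> \<le> C * \<epsilon>" using t(1) by simp
          then show False using x unfolding A_def by auto
        qed
      qed
    qed
    moreover have "{x \<in> E. C * \<epsilon> < \<bar>\<alpha> x - \<beta> x\<bar>} \<subseteq> (\<Union>(m,i)\<in>UNIV. A m i)"
    proof clarify
      fix x assume x: "x \<in> E" "C * \<epsilon> < \<bar>\<alpha> x - \<beta> x\<bar>"
      obtain d1 where d1: "d1 > 0" "\<And>z. norm z < d1 \<Longrightarrow> \<bar>f (x + z) - f x - p x \<bullet> z - g x z\<bar> \<le> \<epsilon> * (norm z)^2"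
        using exp[OF x(1)] \<epsilon> unfolding second_order_expansion_def by blast
      have "uniformly_continuous_on (cball 0 R) (g x)"
        by (intro compact_uniformly_continuous continuous_on_subset[OF cont[OF x(1)]]) auto
      then obtain d2 where d2: "d2 > 0" "\<And>w w'. w \<in> cball 0 R \<Longrightarrow> w' \<in> cball 0 R \<Longrightarrow> dist w' w < d2 \<Longrightarrow> dist (g x w') (g x w) < \<epsilon>"
        using \<epsilon> unfolding uniformly_continuous_on_def by blast
      obtain m where m: "1 / real (Suc m) < min d1 d2" using d1(1) d2(1) by (metis min_less_iff_conj nat_approx_posE)
      have "\<bar>g x w - g x w'\<bar> \<le> \<epsilon>" if "w \<in> cball 0 R" "w' \<in> cball 0 R" "norm (w - w') < 1 / real (Suc m)" for w w'
        using d2(2)[OF that(2,1)] that(3) m by (simp add: dist_norm dist_real_def)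
      then have "x \<in> A m \<lfloor>\<beta> x / \<epsilon>\<rfloor>" unfolding A_def using x d1(2) m by auto
      then show "x \<in> (\<Union>(m,i)\<in>UNIV. A m i)" by blast
    qed
    moreover have "negligible (\<Union>(m,i)\<in>UNIV. A m i)"
      by (rule negligible_countable_Union) (use \<open>\<And>m i. negligible (A m i)\<close> in auto)
    ultimately show ?thesis by (meson negligible_subset)
  qed
  have "{x \<in> E. \<alpha> x \<noteq> \<beta> x} \<subseteq> (\<Union>n. {x \<in> E. C * (1 / real (Suc n)) < \<bar>\<alpha> x - \<beta> x\<bar>})"
  proof clarify
    fix x assume x: "x \<in> E" "\<alpha> x \<noteq> \<beta> x"
    then have "0 < \<bar>\<alpha> x - \<beta> x\<bar> / C" using C by simp
    then obtain n where "1 / real (Suc n) < \<bar>\<alpha> x - \<beta> x\<bar> / C" by (metis nat_approx_posE)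
    then have "C * (1 / real (Suc n)) < \<bar>\<alpha> x - \<beta> x\<bar>" using C by (simp add: pos_less_divide_eq mult.commute)
    then show "x \<in> (\<Union>n. {x \<in> E. C * (1 / real (Suc n)) < \<bar>\<alpha> x - \<beta> x\<bar>})" using x by blast
  qed
  moreover have "negligible (\<Union>n. {x \<in> E. C * (1 / real (Suc n)) < \<bar>\<alpha> x - \<beta> x\<bar>})"
    by (intro negligible_Union_nat bad) simp
  ultimately show ?thesis unfolding \<alpha>_def \<beta>_def by (meson negligible_subset)
qed

lemma continuous_additive_imp_linear:
  fixes l :: "'a::real_normed_vector \<Rightarrow> real"
  assumes add: "\<And>x y. l (x + y) = l x + l y" and cont: "continuous_on UNIV l"
  shows "linear l"
proof
  show "l (x + y) = l x + l y" for x y by (rule add)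
  fix r :: real and x
  interpret additive l by standard (rule add)
  have nat: "l (real n *\<^sub>R y) = real n * l y" for n y
  proof (induction n)
    case (Suc n)
    have "real (Suc n) *\<^sub>R y = real n *\<^sub>R y + y" by (simp add: scaleR_left_distrib)
    then show ?case using Suc add[of "real n *\<^sub>R y" y] by (simp add: distrib_right)
  qed (simp add: zero)
  have int: "l (of_int i *\<^sub>R y) = of_int i * l y" for i y
    by (cases i rule: int_cases2) (simp_all add: nat minus)
  have rat: "l (q *\<^sub>R x) = q * l x" if q: "q \<in> \<rat>" for q
  proof -
    obtain a b where ab: "q = of_int a / of_int b" "b \<noteq> 0" using q by (elim Rats_cases') auto
    have "of_int b * l (q *\<^sub>R x) = l (of_int b *\<^sub>R (q *\<^sub>R x))" by (rule int[symmetric])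
    also have "of_int b *\<^sub>R (q *\<^sub>R x) = of_int a *\<^sub>R x" using ab by simp
    also have "l (of_int a *\<^sub>R x) = of_int a * l x" by (rule int)
    finally have "of_int b * l (q *\<^sub>R x) = of_int a * l x" .
    moreover have "of_int a = of_int b * q" using ab by simp
    ultimately show ?thesis using ab(2) by simp
  qed
  have "continuous_on (closure \<rat>) (\<lambda>q. l (q *\<^sub>R x) - q * l x)"
    by (intro continuous_intros continuous_on_compose2[OF cont]) auto
  then have "l (r *\<^sub>R x) - r * l x = 0"
    by (rule continuous_constant_on_closure) (use rat in \<open>auto simp: Rats_closure_real\<close>)
  then show "l (r *\<^sub>R x) = r *\<^sub>R l x" by simp
qed

text \<open>
  The hypothesis says that \<open>g (h + k) - g h - g k\<close> is additive in \<open>h\<close>; it is symmetric, continuous and hence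
  bilinear, and homogeneity identifies \<open>g\<close> with half of its diagonal.
\<close>

lemma quadratic_if_mixed_differences_const:
  fixes g :: "'a::euclidean_space \<Rightarrow> real"
  assumes cont: "continuous_on UNIV g" and hom: "homogeneous2 g"
    and const: "\<And>h k1 k2. mixed_difference g h k1 k2 = mixed_difference g 0 k1 k2"
  obtains L where "linear L" "\<And>v w. L v \<bullet> w = v \<bullet> L w" "\<And>z. g z = (L z \<bullet> z) / 2"
proof -
  define B where "B h k = g (h + k) - g h - g k" for h k
  have sym: "B h k = B k h" for h k unfolding B_def by (simp add: add.commute)
  have add: "B (h + h') k = B h k + B h' k" for h h' k
    using const[of h h' k] homogeneous2_0[OF hom] unfolding B_def mixed_difference_def by (simp add: add.assoc)
  have lin1: "linear (\<lambda>h. B h k)" for k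
    by (rule continuous_additive_imp_linear[OF add])
      (unfold B_def, intro continuous_intros continuous_on_compose2[OF cont], auto)
  have lin2: "linear (\<lambda>k. B h k)" for h using lin1[of h] by (simp add: sym[of h])
  define L where "L v = (\<Sum>b\<in>Basis. B v b *\<^sub>R b)" for v
  have LB: "L v \<bullet> w = B v w" for v w
  proof -
    have "B v w = B v (\<Sum>b\<in>Basis. (w \<bullet> b) *\<^sub>R b)" by (simp add: euclidean_representation)
    also have "\<dots> = (\<Sum>b\<in>Basis. (w \<bullet> b) * B v b)" by (simp add: linear_sum[OF lin2] linear_scale[OF lin2])
    also have "\<dots> = L v \<bullet> w" unfolding L_def by (simp add: inner_sum_left inner_commute[of w] mult.commute)
    finally show ?thesis by simp
  qed
  show thesis
  proof
    show "linear L"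
      by (rule linearI) (auto simp: L_def linear_add[OF lin1] linear_scale[OF lin1] scaleR_add_left sum.distrib scaleR_sum_right)
    show "L v \<bullet> w = v \<bullet> L w" for v w using LB[of v w] LB[of w v] sym[of v w] by (simp add: inner_commute)
    have "g (z + z) = 4 * g z" for z using hom[unfolded homogeneous2_def, rule_format, of 2 z] by (simp add: scaleR_2)
    then show "g z = (L z \<bullet> z) / 2" for z unfolding LB B_def by simp
  qed
qed

text \<open>
  The mixed difference identity holds off a null set for all directions from the countable set \<open>D\<close>, and extends to
  all directions by continuity.
\<close>

theorem Alexandrov:
  fixes f :: "'a::euclidean_space \<Rightarrow> real"
  assumes S: "open S" and f: "convex_on S f"
  shows "negligible {x \<in> S. \<nexists>p L. linear L \<and> (\<forall>v w. L v \<bullet> w = v \<bullet> L w) \<and> second_order_expansion f x p (\<lambda>z. (L z \<bullet> z) / 2)}"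
proof -
  obtain D :: "'a set" where D: "countable D" "closure D = UNIV" "\<forall>R. \<exists>C\<subseteq>D. finite C \<and> cball 0 R \<subseteq> convex hull C"
    by (rule countable_dense_with_hulls)
  define N1 where "N1 = (\<Union>h\<in>D. {x \<in> S. \<nexists>a q. second_order_expansion (\<lambda>t. f (x + t *\<^sub>R h)) 0 a (\<lambda>s. q * s^2)})"
  have N1: "negligible N1" unfolding N1_def
    using D(1) negligible_no_directional_expansion[OF S f] by (intro negligible_countable_Union) auto
  have "\<exists>p g. second_order_expansion f x p g \<and> continuous_on UNIV g \<and> homogeneous2 g" if x: "x \<in> S - N1" for x
  proof -
    obtain p where p: "\<And>y. y \<in> S \<Longrightarrow> f x + p \<bullet> (y - x) \<le> f y" using convex_on_subgradient[OF S f, of x] x by blast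
    obtain g where "second_order_expansion f x p g" "continuous_on UNIV g" "\<And>s z. 0 < s \<Longrightarrow> g (s *\<^sub>R z) = s^2 * g z"
      by (rule second_order_expansion_if_directional[OF S f _ p D(2) D(3)[rule_format]]) (use x in \<open>auto simp: N1_def\<close>)
    then show ?thesis unfolding homogeneous2_def by blast
  qed
  then obtain p g where pg: "\<And>x. x \<in> S - N1 \<Longrightarrow> second_order_expansion f x (p x) (g x)"
    "\<And>x. x \<in> S - N1 \<Longrightarrow> continuous_on UNIV (g x)" "\<And>x. x \<in> S - N1 \<Longrightarrow> homogeneous2 (g x)" by metis
  define N2 where "N2 = (\<Union>(h,k1,k2)\<in>D \<times> D \<times> D. {x \<in> S - N1. mixed_difference (g x) h k1 k2 \<noteq> mixed_difference (g x) 0 k1 k2})"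
  have N2: "negligible N2" unfolding N2_def
    using D(1) negligible_mixed_difference_mismatch[where E = "S - N1", OF pg] by (intro negligible_countable_Union) auto
  have "\<exists>p L. linear L \<and> (\<forall>v w. L v \<bullet> w = v \<bullet> L w) \<and> second_order_expansion f x p (\<lambda>z. (L z \<bullet> z) / 2)"
    if x: "x \<in> S" "x \<notin> N1" "x \<notin> N2" for x
  proof -
    have x': "x \<in> S - N1" using x by blast
    have const: "mixed_difference (g x) h k1 k2 = mixed_difference (g x) 0 k1 k2" for h k1 k2
    proof -
      define M where "M w = mixed_difference (g x) (fst w) (fst (snd w)) (snd (snd w)) - mixed_difference (g x) 0 (fst (snd w)) (snd (snd w))" for w :: "'a \<times> 'a \<times> 'a"
      have cl: "closure (D \<times> D \<times> D) = UNIV" by (simp add: closure_Times D(2))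
      have "continuous_on (closure (D \<times> D \<times> D)) M"
        unfolding M_def mixed_difference_def by (intro continuous_intros continuous_on_compose2[OF pg(2)[OF x']]) auto
      then have "M (h, k1, k2) = 0"
      proof (rule continuous_constant_on_closure)
        fix w assume "w \<in> D \<times> D \<times> D"
        then show "M w = 0" using x unfolding N2_def M_def by fastforce
      qed (simp add: cl)
      then show ?thesis unfolding M_def by simp
    qed
    obtain L where L: "linear L" "\<And>v w. L v \<bullet> w = v \<bullet> L w" "\<And>z. g x z = (L z \<bullet> z) / 2"
      by (rule quadratic_if_mixed_differences_const[OF pg(2)[OF x'] pg(3)[OF x'] const]) blast
    have "g x = (\<lambda>z. (L z \<bullet> z) / 2)" using L(3) by blast
    then have "second_order_expansion f x (p x) (\<lambda>z. (L z \<bullet> z) / 2)" using pg(1)[OF x'] by simp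
    then show ?thesis using L(1,2) by blast
  qed
  then show ?thesis by (intro negligible_subset[OF negligible_Un[OF N1 N2]]) blast
qed

section \<open>Contact points of paraboloids\<close>

text \<open>
  The first and second derivative tests for a local maximum, at a point where \<open>u\<close> is only twice differentiable in the Peano sense.
\<close>

lemma second_order_expansion_le_upper_contact:
  fixes u :: "'a::euclidean_space \<Rightarrow> real"
  assumes exp: "second_order_expansion u x p (\<lambda>z. (L z \<bullet> z) / 2)" and L: "linear L" and M: "linear M"
    and r: "0 < r" and upper: "\<And>z. norm z < r \<Longrightarrow> u (x + z) \<le> u x + b \<bullet> z + (M z \<bullet> z) / 2"
  shows "p = b" and "L v \<bullet> v \<le> M v \<bullet> v"
proof -
  have quad: "\<exists>B. \<forall>z. \<bar>(T z \<bullet> z) / 2\<bar> \<le> B * (norm z)^2" if T: "linear T" for T :: "'a \<Rightarrow> 'a"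
  proof -
    obtain B where B: "\<And>z. norm (T z) \<le> B * norm z" using linear_bounded[OF T] by blast
    have "\<bar>(T z \<bullet> z) / 2\<bar> \<le> B * (norm z)^2" for z
    proof -
      have "\<bar>T z \<bullet> z\<bar> \<le> norm (T z) * norm z" by (rule Cauchy_Schwarz_ineq2)
      also have "\<dots> \<le> B * norm z * norm z" by (intro mult_right_mono B) auto
      finally show ?thesis by (simp add: power2_eq_square)
    qed
    then show ?thesis by blast
  qed
  obtain BL where BL: "\<And>z. \<bar>(L z \<bullet> z) / 2\<bar> \<le> BL * (norm z)^2" using quad[OF L] by blast
  obtain BM where BM: "\<And>z. \<bar>(M z \<bullet> z) / 2\<bar> \<le> BM * (norm z)^2" using quad[OF M] by blast
  obtain d where d: "d > 0" "\<And>z. norm z < d \<Longrightarrow> \<bar>u (x + z) - u x - p \<bullet> z - (L z \<bullet> z) / 2\<bar> \<le> 1 * (norm z)^2"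
    using exp[unfolded second_order_expansion_def, rule_format, of 1] by auto
  show pb: "p = b"
  proof (rule slope_eq_if_touched_from_both_sides)
    show "0 < min d r" using d r by simp
    fix z :: 'a assume z: "norm z < min d r"
    then show "u x + p \<bullet> z - (BL + 1) * (norm z)^2 \<le> u (x + z)" using d(2)[of z] BL[of z] unfolding distrib_right by linarith
    show "u (x + z) \<le> u x + b \<bullet> z + BM * (norm z)^2" using upper[of z] z BM[of z] by linarith
  qed
  show "L v \<bullet> v \<le> M v \<bullet> v"
  proof (cases "v = 0")
    case False
    show ?thesis
    proof (rule field_le_epsilon)
      fix e :: real assume e: "0 < e"
      define e' where "e' = e / (2 * (norm v)^2)"
      have e': "e' > 0" "2 * e' * (norm v)^2 = e" unfolding e'_def using e False by auto
      obtain d where d: "d > 0" "\<And>z. norm z < d \<Longrightarrow> \<bar>u (x + z) - u x - p \<bullet> z - (L z \<bullet> z) / 2\<bar> \<le> e' * (norm z)^2"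
        using exp e'(1) unfolding second_order_expansion_def by blast
      define t where "t = min d r / (2 * norm v)"
      have t: "t > 0" "t * norm v < d" "t * norm v < r" unfolding t_def using d(1) r False by auto
      have n: "norm (t *\<^sub>R v) < d" "norm (t *\<^sub>R v) < r" using t by auto
      have "(L (t *\<^sub>R v) \<bullet> (t *\<^sub>R v)) / 2 \<le> (M (t *\<^sub>R v) \<bullet> (t *\<^sub>R v)) / 2 + e' * (norm (t *\<^sub>R v))^2"
        using d(2)[OF n(1)] upper[OF n(2)] unfolding pb by linarith
      then have "t^2 * (L v \<bullet> v) \<le> t^2 * (M v \<bullet> v + 2 * e' * (norm v)^2)"
        by (simp add: linear_scale[OF L] linear_scale[OF M] power_mult_distrib power2_eq_square algebra_simps)
      then show "L v \<bullet> v \<le> M v \<bullet> v + e" using t(1) e'(2) by simp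
    qed
  qed (simp add: linear_0[OF L])
qed

text \<open>
  Compare the upper paraboloid at \<open>x1\<close> with the lower one at \<open>x2\<close>, at the point reached from \<open>x2\<close> by a step of length
  \<open>\<sigma>\<close>, slightly more than \<open>norm (x1 - x2)\<close>, against the direction of \<open>p1 - p2\<close>. The linear parts differ there by
  \<open>\<sigma> * norm (p1 - p2)\<close>, and the quadratic terms sum to at most \<open>(4 + 1 + 1) * C * \<sigma>\<^sup>2\<close>.
\<close>

lemma contact_gradient_Lipschitz:
  fixes u :: "'a::real_inner \<Rightarrow> real"
  assumes "0 \<le> C"
    and x: "dist c x1 < R / 4" "dist c x2 < R / 4"
    and upper1: "\<And>y. y \<in> ball c R \<Longrightarrow> u y \<le> u x1 + p1 \<bullet> (y - x1) + C * (norm (y - x1))^2"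
    and lower1: "\<And>y. y \<in> ball c R \<Longrightarrow> u x1 + p1 \<bullet> (y - x1) - C * (norm (y - x1))^2 \<le> u y"
    and lower2: "\<And>y. y \<in> ball c R \<Longrightarrow> u x2 + p2 \<bullet> (y - x2) - C * (norm (y - x2))^2 \<le> u y"
  shows "norm (p1 - p2) \<le> 6 * C * norm (x1 - x2)"
proof (cases "p1 = p2")
  case False
  define n where "n = norm (p1 - p2)"
  have n: "n > 0" using False unfolding n_def by simp
  define s where "s = norm (x1 - x2)"
  have R: "R > 0" using x(1) zero_le_dist[of c x1] by linarith
  have sR: "s < R / 2" using x dist_triangle[of x1 x2 c] unfolding s_def by (simp add: dist_norm[symmetric] dist_commute)
  have est: "n \<le> 6 * C * \<sigma>" if \<sigma>: "s < \<sigma>" "\<sigma> < 3 * R / 4" for \<sigma>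
  proof -
    have \<sigma>0: "\<sigma> > 0" using \<sigma> norm_ge_zero[of "x1 - x2"] unfolding s_def by linarith
    define y where "y = x2 - (\<sigma> / n) *\<^sub>R (p1 - p2)"
    have yx2: "norm (y - x2) = \<sigma>" unfolding y_def using n \<sigma>0 by (simp add: n_def)
    have "dist c y < R" using dist_triangle[of c y x2] x(2) yx2 \<sigma>(2) by (simp add: dist_norm norm_minus_commute)
    then have yB: "y \<in> ball c R" by simp
    have x2B: "x2 \<in> ball c R" using x(2) R by simp
    have yx1: "norm (y - x1) \<le> 2 * \<sigma>" using norm_triangle_ineq[of "y - x2" "x2 - x1"] yx2 \<sigma>(1) unfolding s_def by (simp add: norm_minus_commute)
    have "(norm (y - x1))^2 \<le> (2 * \<sigma>)^2" using yx1 by (rule power_mono) simp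
    then have a: "C * (norm (y - x1))^2 \<le> C * (4 * \<sigma>^2)" using \<open>0 \<le> C\<close> by (intro mult_left_mono) (auto simp: power2_eq_square)
    have "(norm (x2 - x1))^2 \<le> \<sigma>^2" using \<sigma>(1) unfolding s_def by (intro power_mono) (auto simp: norm_minus_commute)
    then have b: "C * (norm (x2 - x1))^2 \<le> C * \<sigma>^2" using \<open>0 \<le> C\<close> by (rule mult_left_mono)
    have "p1 \<bullet> (x2 - x1) + p2 \<bullet> (y - x2) - C * (norm (x2 - x1))^2 - C * \<sigma>^2 \<le> p1 \<bullet> (y - x1) + C * (norm (y - x1))^2"
      using upper1[OF yB] lower2[OF yB] lower1[OF x2B] unfolding yx2 by linarith
    then have "- ((p1 - p2) \<bullet> (y - x2)) \<le> 6 * C * \<sigma>^2" using a b by (simp add: inner_diff_left inner_diff_right algebra_simps)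
    moreover have "- ((p1 - p2) \<bullet> (y - x2)) = \<sigma> * n"
    proof -
      have "- ((p1 - p2) \<bullet> (y - x2)) = \<sigma> / n * ((p1 - p2) \<bullet> (p1 - p2))" unfolding y_def by simp
      also have "\<dots> = \<sigma> / n * n^2" unfolding n_def by (simp add: power2_norm_eq_inner)
      finally show ?thesis using n by (simp add: power2_eq_square)
    qed
    ultimately have "\<sigma> * n \<le> \<sigma> * (6 * C * \<sigma>)" by (simp add: power2_eq_square algebra_simps)
    then show ?thesis using \<sigma>0 by simp
  qed
  have "n \<le> 6 * C * s"
  proof (rule tendsto_lowerbound[of "\<lambda>\<sigma>. 6 * C * \<sigma>" _ "at_right s"])
    show "((\<lambda>\<sigma>. 6 * C * \<sigma>) \<longlongrightarrow> 6 * C * s) (at_right s)" by (auto intro!: tendsto_eq_intros)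
    show "\<forall>\<^sub>F \<sigma> in at_right s. n \<le> 6 * C * \<sigma>"
      unfolding eventually_at_right_field using est sR R by (intro exI[of _ "3 * R / 4"]) auto
  qed auto
  then show ?thesis unfolding n_def s_def .
qed (use \<open>0 \<le> C\<close> in auto)

text \<open>
  Jensen's lemma, for a quadratic test function with strict contact at \<open>x0\<close>. For every \<open>q\<close> in a small ball the tilted test
  function has a contact point \<open>X q\<close> near \<open>x0\<close>, and \<open>q\<close> is a Lipschitz function of \<open>X q\<close> because \<open>u\<close> lies between two
  paraboloids of the same slope there. If all contact points were in the null set \<open>N\<close>, the ball of all \<open>q\<close> would be the
  Lipschitz image of a null set.
\<close>

lemma tilted_contact_outside_negligible:
  fixes u :: "'a::euclidean_space \<Rightarrow> real"
  assumes R: "0 < R" and e: "0 < e" and C: "0 \<le> C" and \<kappa>: "0 < \<kappa>" and N: "negligible N"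
    and M: "linear M" and sym: "\<And>v w. M v \<bullet> w = v \<bullet> M w"
    and cont: "continuous_on (ball x0 R) u"
    and lower: "\<And>x. x \<in> ball x0 R \<Longrightarrow> \<exists>p. \<forall>y\<in>ball x0 R. u x + p \<bullet> (y - x) - C * (norm (y - x))^2 \<le> u y"
    and upper: "\<And>y. y \<in> ball x0 R \<Longrightarrow> u y \<le> u x0 + p0 \<bullet> (y - x0) + (M (y - x0) \<bullet> (y - x0)) / 2 - \<kappa> * (norm (y - x0))^2"
  obtains x q where "x \<in> ball x0 e" "x \<in> ball x0 R" "x \<notin> N" "norm q < e"
    "\<And>y. y \<in> ball x0 R \<Longrightarrow> u y \<le> u x + (p0 + M (x - x0) + q) \<bullet> (y - x) + (M (y - x) \<bullet> (y - x)) / 2"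
proof -
  define r where "r = min e R / 5"
  have r: "0 < r" "r < e" "r < R / 4" unfolding r_def using e R by auto
  \<comment> \<open>For \<open>norm q \<le> \<kappa> * r\<close> the tilt cannot beat the strictness term outside the ball of radius \<open>r\<close>, so a maximum over that ball is a maximum over all of \<open>ball x0 R\<close>.\<close>
  define \<delta> where "\<delta> = min e (\<kappa> * r)"
  have \<delta>: "0 < \<delta>" "\<delta> \<le> e" "\<delta> \<le> \<kappa> * r" unfolding \<delta>_def using e \<kappa> r by auto
  define w where "w y = u y - p0 \<bullet> (y - x0) - (M (y - x0) \<bullet> (y - x0)) / 2" for y
  have cb: "cball x0 r \<subseteq> ball x0 R" using r R by auto
  have blM: "bounded_linear M" using M by (simp add: linear_conv_bounded_linear)
  have wcont: "continuous_on (cball x0 r) (\<lambda>y. w y - q \<bullet> y)" for q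
    unfolding w_def by (intro continuous_intros continuous_on_subset[OF cont cb] bounded_linear.continuous_on[OF blM]) auto
  have w0: "w x0 = u x0" unfolding w_def by (simp add: linear_0[OF M])
  have wup: "w y \<le> u x0 - \<kappa> * (norm (y - x0))^2" if "y \<in> ball x0 R" for y using upper[OF that] unfolding w_def by simp
  have contact: "\<exists>x\<in>cball x0 r. \<forall>y\<in>ball x0 R. w y - q \<bullet> y \<le> w x - q \<bullet> x" if q: "norm q < \<delta>" for q
  proof -
    obtain x where x: "x \<in> cball x0 r" "\<And>y. y \<in> cball x0 r \<Longrightarrow> w y - q \<bullet> y \<le> w x - q \<bullet> x"
      using continuous_attains_sup[OF _ _ wcont[of q]] r by (metis cball_eq_empty compact_cball less_asym)
    have "w y - q \<bullet> y \<le> w x - q \<bullet> x" if y: "y \<in> ball x0 R" "y \<notin> cball x0 r" for y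
    proof -
      have ny: "norm (y - x0) > r" using y(2) by (simp add: dist_norm norm_minus_commute)
      have "- (q \<bullet> (y - x0)) \<le> norm q * norm (y - x0)" using Cauchy_Schwarz_ineq2[of q "y - x0"] by linarith
      also have "\<dots> \<le> \<kappa> * norm (y - x0) * norm (y - x0)"
      proof (rule mult_right_mono)
        have "norm q \<le> \<kappa> * r" using q \<delta>(3) by simp
        also have "\<dots> \<le> \<kappa> * norm (y - x0)" using ny \<kappa> by (intro mult_left_mono) auto
        finally show "norm q \<le> \<kappa> * norm (y - x0)" .
      qed simp
      finally have "- (q \<bullet> (y - x0)) \<le> \<kappa> * (norm (y - x0))^2" by (simp add: power2_eq_square mult.assoc)
      then have "w y - q \<bullet> y \<le> w x0 - q \<bullet> x0" using wup[OF y(1)] unfolding w0 inner_diff_right by linarith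
      also have "\<dots> \<le> w x - q \<bullet> x" using x(2)[of x0] r by simp
      finally show ?thesis .
    qed
    then show ?thesis using x by blast
  qed
  then obtain X where X: "\<And>q. norm q < \<delta> \<Longrightarrow> X q \<in> cball x0 r"
    "\<And>q y. norm q < \<delta> \<Longrightarrow> y \<in> ball x0 R \<Longrightarrow> w y - q \<bullet> y \<le> w (X q) - q \<bullet> X q" by metis
  \<comment> \<open>The slope of the tilted test function at its contact point.\<close>
  define P where "P q = p0 + M (X q - x0) + q" for q
  have touch: "u y \<le> u (X q) + P q \<bullet> (y - X q) + (M (y - X q) \<bullet> (y - X q)) / 2" if "norm q < \<delta>" "y \<in> ball x0 R" for q y
  proof -
    define a b where "a = X q - x0" and "b = y - X q"
    have ab: "y - x0 = a + b" unfolding a_def b_def by simp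
    have "M (a + b) \<bullet> (a + b) = M a \<bullet> a + 2 * (M a \<bullet> b) + M b \<bullet> b"
      using sym[of b a] by (simp add: linear_add[OF M] inner_add_left inner_add_right inner_commute)
    moreover have "u y - p0 \<bullet> (a + b) - (M (a + b) \<bullet> (a + b)) / 2 - q \<bullet> y \<le> u (X q) - p0 \<bullet> a - (M a \<bullet> a) / 2 - q \<bullet> X q"
      using X(2)[OF that] unfolding w_def ab a_def[symmetric] .
    moreover have "q \<bullet> y - q \<bullet> X q = q \<bullet> b" unfolding b_def by (simp add: inner_diff_right)
    ultimately have "u y \<le> u (X q) + (p0 \<bullet> b + M a \<bullet> b + q \<bullet> b) + (M b \<bullet> b) / 2" unfolding inner_add_right by argo
    then show ?thesis unfolding P_def a_def b_def by (simp add: inner_add_left)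
  qed
  obtain B where B: "B > 0" "\<And>z. norm (M z) \<le> B * norm z" using linear_bounded_pos[OF M] by blast
  have MB: "(M z \<bullet> z) / 2 \<le> B * (norm z)^2" for z
  proof -
    have "M z \<bullet> z \<le> norm (M z) * norm z" by (rule norm_cauchy_schwarz)
    also have "\<dots> \<le> B * norm z * norm z" by (intro mult_right_mono B) auto
    finally have "M z \<bullet> z \<le> B * (norm z)^2" by (simp add: power2_eq_square)
    moreover have "0 \<le> B * (norm z)^2" using B(1) by simp
    ultimately show ?thesis by linarith
  qed
  define K where "K = B + C"
  have K: "0 \<le> K" "B \<le> K" "C \<le> K" unfolding K_def using B(1) C by auto
  have XR: "X q \<in> ball x0 R" "dist x0 (X q) < R / 4" if "norm q < \<delta>" for q using X(1)[OF that] r R by auto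
  have up: "u y \<le> u (X q) + P q \<bullet> (y - X q) + K * (norm (y - X q))^2" if "norm q < \<delta>" "y \<in> ball x0 R" for q y
    using touch[OF that] MB[of "y - X q"] mult_right_mono[OF K(2), of "(norm (y - X q))^2"] by simp
  have lo: "u (X q) + P q \<bullet> (y - X q) - K * (norm (y - X q))^2 \<le> u y" if q: "norm q < \<delta>" and y: "y \<in> ball x0 R" for q y
  proof -
    obtain p where p: "\<And>y. y \<in> ball x0 R \<Longrightarrow> u (X q) + p \<bullet> (y - X q) - C * (norm (y - X q))^2 \<le> u y"
      using lower[OF XR(1)[OF q]] by blast
    have near: "X q + z \<in> ball x0 R" if "norm z < R / 2" for z
      using XR(2)[OF q] that R dist_triangle[of x0 "X q + z" "X q"] by (simp add: dist_norm)
    have "p = P q"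
    proof (rule slope_eq_if_touched_from_both_sides)
      show "0 < R / 2" using R by simp
      fix z :: 'a assume z: "norm z < R / 2"
      show "u (X q) + p \<bullet> z - C * (norm z)^2 \<le> u (X q + z)" using p[OF near[OF z]] by simp
      show "u (X q + z) \<le> u (X q) + P q \<bullet> z + K * (norm z)^2" using up[OF q near[OF z]] by simp
    qed
    then show ?thesis using p[OF y] mult_right_mono[OF K(3), of "(norm (y - X q))^2"] by simp
  qed
  have lip: "norm (q1 - q2) \<le> (6 * K + B) * norm (X q1 - X q2)" if q: "norm q1 < \<delta>" "norm q2 < \<delta>" for q1 q2
  proof -
    have "norm (P q1 - P q2) \<le> 6 * K * norm (X q1 - X q2)"
      by (rule contact_gradient_Lipschitz[OF K(1) XR(2)[OF q(1)] XR(2)[OF q(2)] up[OF q(1)] lo[OF q(1)] lo[OF q(2)]])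
    moreover have "norm (M (X q1 - X q2)) \<le> B * norm (X q1 - X q2)" by (rule B)
    moreover have "q1 - q2 = (P q1 - P q2) - M (X q1 - X q2)" unfolding P_def by (simp add: linear_diff[OF M])
    ultimately show ?thesis using norm_triangle_ineq4[of "P q1 - P q2" "M (X q1 - X q2)"] by (simp add: distrib_right)
  qed
  have inj: "inj_on X (ball 0 \<delta>)"
  proof (rule inj_onI)
    fix q1 q2 assume "q1 \<in> ball 0 \<delta>" "q2 \<in> ball 0 \<delta>" "X q1 = X q2"
    then show "q1 = q2" using lip[of q1 q2] by simp
  qed
  have "\<exists>q\<in>ball 0 \<delta>. X q \<notin> N"
  proof (rule ccontr)
    assume "\<not> ?thesis"
    then have "negligible (X ` ball 0 \<delta>)" using negligible_subset[OF N] by blast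
    then have "negligible (inv_into (ball 0 \<delta>) X ` (X ` ball 0 \<delta>))"
    proof (rule negligible_locally_Lipschitz_image[rotated])
      fix x assume "x \<in> X ` ball 0 \<delta>"
      then show "\<exists>T B. open T \<and> x \<in> T \<and> (\<forall>y\<in>X ` ball 0 \<delta> \<inter> T.
          norm (inv_into (ball 0 \<delta>) X y - inv_into (ball 0 \<delta>) X x) \<le> B * norm (y - x))"
        using lip inj by (intro exI[of _ UNIV] exI[of _ "6 * K + B"]) auto
    qed simp
    moreover have "inv_into (ball 0 \<delta>) X ` (X ` ball 0 \<delta>) = ball 0 \<delta>" using inj by (rule inv_into_image_cancel) simp
    ultimately show False using open_not_negligible[of "ball (0::'a) \<delta>"] \<delta>(1) by simp
  qed
  then obtain q where q: "norm q < \<delta>" "X q \<notin> N" by auto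
  show thesis
  proof (rule that[of "X q" q])
    show "X q \<in> ball x0 e" using X(1)[OF q(1)] r by simp
    show "norm q < e" using q \<delta> by simp
    show "u y \<le> u (X q) + (p0 + M (X q - x0) + q) \<bullet> (y - X q) + (M (y - X q) \<bullet> (y - X q)) / 2" if "y \<in> ball x0 R" for y
      using touch[OF q(1) that] unfolding P_def .
  qed (use XR q in auto)
qed

section \<open>Second derivatives of test functions\<close>

lemma gradient_along_segment:
  fixes \<phi> :: "'a::real_inner \<Rightarrow> real"
  assumes "(\<phi> has_derivative (\<lambda>h. g \<bullet> h)) (at (a + s *\<^sub>R k))"
  shows "((\<lambda>s. \<phi> (a + s *\<^sub>R k)) has_real_derivative (g \<bullet> k)) (at s)"
proof -
  have "((\<lambda>s. a + s *\<^sub>R k) has_derivative (\<lambda>t. t *\<^sub>R k)) (at s)" by (auto intro!: derivative_eq_intros)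
  from has_derivative_compose[OF this assms] show ?thesis
    unfolding has_field_derivative_def by (simp add: inner_scaleR_right mult.commute[of _ "g \<bullet> k"])
qed

lemma gradient_linearization:
  fixes g :: "'a::real_normed_vector \<Rightarrow> 'b::real_normed_vector"
  assumes "(g has_derivative H) (at x)" "0 < e"
  obtains d where "0 < d" "\<And>z. norm z < d \<Longrightarrow> norm (g (x + z) - g x - H z) \<le> e * norm z"
proof -
  obtain d where d: "d > 0" "\<And>y. norm (y - x) < d \<Longrightarrow> norm (g y - g x - H (y - x)) \<le> e * norm (y - x)"
    using assms unfolding has_derivative_at_alt by blast
  show thesis
  proof
    show "norm (g (x + z) - g x - H z) \<le> e * norm z" if "norm z < d" for z using d(2)[of "x + z"] that by simp
  qed (rule d)
qed

text \<open>
  The mean value theorem applied to \<open>s \<mapsto> \<phi> (x + t h + s k) - \<phi> (x + s k)\<close> shows that the mixed second difference of \<open>\<phi>\<close> is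
  \<open>t\<^sup>2 * (H h \<bullet> k)\<close> up to \<open>o(t\<^sup>2)\<close>; that difference is symmetric in \<open>h\<close> and \<open>k\<close>.
\<close>

lemma second_derivative_symmetric:
  fixes \<phi> :: "'a::real_inner \<Rightarrow> real"
  assumes U: "open U" "x \<in> U" and \<phi>: "\<And>y. y \<in> U \<Longrightarrow> (\<phi> has_derivative (\<lambda>h. g y \<bullet> h)) (at y)"
    and g: "(g has_derivative H) (at x)"
  shows "H h \<bullet> k = H k \<bullet> h"
proof -
  have H: "linear H" using g has_derivative_linear by blast
  define \<Delta> where "\<Delta> t h k = \<phi> (x + t *\<^sub>R (h + k)) - \<phi> (x + t *\<^sub>R h) - \<phi> (x + t *\<^sub>R k) + \<phi> x" for t :: real and h k
  have est: "\<exists>r>0. \<forall>t. 0 < t \<and> t < r \<longrightarrow> \<bar>\<Delta> t h k - t^2 * (H h \<bullet> k)\<bar> \<le> e * t^2" if e: "0 < e" for e h k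
  proof -
    obtain \<rho> where \<rho>: "\<rho> > 0" "ball x \<rho> \<subseteq> U" using U by (auto elim: openE)
    define m where "m = norm h + norm k + 1"
    have m: "m > 0" "norm h \<le> m" "norm k \<le> m" "norm h + norm k \<le> m" unfolding m_def by (auto simp: add_nonneg_pos)
    obtain d where d: "0 < d" "\<And>z. norm z < d \<Longrightarrow> norm (g (x + z) - g x - H z) \<le> e / (2 * m * m) * norm z"
      using gradient_linearization[OF g, of "e / (2 * m * m)"] e m by auto
    show ?thesis
    proof (intro exI[of _ "min d \<rho> / m"] conjI allI impI)
      show "0 < min d \<rho> / m" using d \<rho> m by simp
      fix t assume t: "0 < t \<and> t < min d \<rho> / m"
      then have tm: "t * m < d" "t * m < \<rho>" using m by (auto simp: pos_less_divide_eq)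
      have small: "norm (a *\<^sub>R h + s *\<^sub>R k) \<le> t * m" if "0 \<le> a" "a \<le> t" "0 \<le> s" "s \<le> t" for a s
      proof -
        have "norm (a *\<^sub>R h + s *\<^sub>R k) \<le> a * norm h + s * norm k" using norm_triangle_ineq[of "a *\<^sub>R h" "s *\<^sub>R k"] that by simp
        also have "\<dots> \<le> t * norm h + t * norm k" using that by (intro add_mono mult_right_mono) auto
        also have "\<dots> = t * (norm h + norm k)" by (simp add: algebra_simps)
        also have "\<dots> \<le> t * m" using t m by (intro mult_left_mono) auto
        finally show ?thesis .
      qed
      have inU: "x + (a *\<^sub>R h + s *\<^sub>R k) \<in> U" if "0 \<le> a" "a \<le> t" "0 \<le> s" "s \<le> t" for a s
      proof (rule set_mp[OF \<rho>(2)])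
        have "dist x (x + w) = norm w" for w by (simp add: dist_norm)
        then show "x + (a *\<^sub>R h + s *\<^sub>R k) \<in> ball x \<rho>" using small[OF that] tm by (simp only: mem_ball)
      qed
      define E where "E a s = g (x + (a *\<^sub>R h + s *\<^sub>R k)) - g x - H (a *\<^sub>R h + s *\<^sub>R k)" for a s
      have gest: "norm (E a s) \<le> e / (2 * m) * t" if "0 \<le> a" "a \<le> t" "0 \<le> s" "s \<le> t" for a s
      proof -
        have "norm (E a s) \<le> e / (2 * m * m) * norm (a *\<^sub>R h + s *\<^sub>R k)"
          unfolding E_def using small[OF that] tm by (intro d(2)) linarith
        also have "\<dots> \<le> e / (2 * m * m) * (t * m)" using small[OF that] e m by (intro mult_left_mono) auto
        also have "\<dots> = e / (2 * m) * t" using m by simp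
        finally show ?thesis .
      qed
      define \<psi> where "\<psi> s = \<phi> (x + t *\<^sub>R h + s *\<^sub>R k) - \<phi> (x + s *\<^sub>R k)" for s
      have "(\<psi> has_real_derivative (g (x + t *\<^sub>R h + s *\<^sub>R k) \<bullet> k - g (x + s *\<^sub>R k) \<bullet> k)) (at s)" if "0 \<le> s" "s \<le> t" for s
        unfolding \<psi>_def using inU[of t s] inU[of 0 s] that t
        by (intro DERIV_diff gradient_along_segment \<phi>) (auto simp: add.assoc)
      then obtain s where s: "0 < s" "s < t" "\<psi> t - \<psi> 0 = (t - 0) * (g (x + t *\<^sub>R h + s *\<^sub>R k) \<bullet> k - g (x + s *\<^sub>R k) \<bullet> k)"
        using MVT2[of 0 t \<psi> "\<lambda>s. g (x + t *\<^sub>R h + s *\<^sub>R k) \<bullet> k - g (x + s *\<^sub>R k) \<bullet> k"] t by auto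
      define E1 E2 where "E1 = E t s" and "E2 = E 0 s"
      have "norm E1 \<le> e / (2 * m) * t" "norm E2 \<le> e / (2 * m) * t"
        unfolding E1_def E2_def using s t by (intro gest; simp)+
      then have "norm (E1 - E2) \<le> e / m * t" using norm_triangle_ineq4[of E1 E2] by (simp add: field_simps)
      have "\<bar>(E1 - E2) \<bullet> k\<bar> \<le> norm (E1 - E2) * norm k" by (rule Cauchy_Schwarz_ineq2)
      also have "\<dots> \<le> e / m * t * m" using \<open>norm (E1 - E2) \<le> e / m * t\<close> m e t by (intro mult_mono) auto
      also have "\<dots> = e * t" using m by simp
      finally have E: "\<bar>(E1 - E2) \<bullet> k\<bar> \<le> e * t" .
      have "g (x + t *\<^sub>R h + s *\<^sub>R k) - g (x + s *\<^sub>R k) = t *\<^sub>R H h + (E1 - E2)"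
        unfolding E1_def E2_def E_def by (simp add: linear_add[OF H] linear_scale[OF H] add.assoc)
      then have "\<psi> t - \<psi> 0 = t * ((t *\<^sub>R H h + (E1 - E2)) \<bullet> k)" using s(3) by (simp add: inner_diff_left[symmetric])
      then have "\<Delta> t h k - t^2 * (H h \<bullet> k) = t * ((E1 - E2) \<bullet> k)"
        unfolding \<Delta>_def \<psi>_def by (simp add: algebra_simps power2_eq_square)
      then have "\<bar>\<Delta> t h k - t^2 * (H h \<bullet> k)\<bar> = t * \<bar>(E1 - E2) \<bullet> k\<bar>" using t by (simp add: abs_mult)
      also have "\<dots> \<le> t * (e * t)" using E t by (intro mult_left_mono) auto
      finally show "\<bar>\<Delta> t h k - t^2 * (H h \<bullet> k)\<bar> \<le> e * t^2" by (simp add: power2_eq_square algebra_simps)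
    qed
  qed
  have "\<bar>H h \<bullet> k - H k \<bullet> h\<bar> \<le> e" if e: "0 < e" for e
  proof -
    obtain r1 where r1: "r1 > 0" "\<And>t. 0 < t \<and> t < r1 \<Longrightarrow> \<bar>\<Delta> t h k - t^2 * (H h \<bullet> k)\<bar> \<le> e / 2 * t^2" using est[of "e/2" h k] e by auto
    obtain r2 where r2: "r2 > 0" "\<And>t. 0 < t \<and> t < r2 \<Longrightarrow> \<bar>\<Delta> t k h - t^2 * (H k \<bullet> h)\<bar> \<le> e / 2 * t^2" using est[of "e/2" k h] e by auto
    obtain t where t: "0 < t" "t < r1" "t < r2" using field_lbound_gt_zero[OF r1(1) r2(1)] by blast
    have eq: "\<Delta> t h k = \<Delta> t k h" unfolding \<Delta>_def by (simp add: add.commute)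
    have "\<bar>\<Delta> t k h - t^2 * (H h \<bullet> k)\<bar> \<le> e / 2 * t^2" using r1(2)[of t] t unfolding eq by blast
    moreover have "\<bar>\<Delta> t k h - t^2 * (H k \<bullet> h)\<bar> \<le> e / 2 * t^2" using r2(2)[of t] t by blast
    ultimately have "\<bar>t^2 * (H h \<bullet> k) - t^2 * (H k \<bullet> h)\<bar> \<le> e * t^2" by linarith
    moreover have "\<bar>t^2 * (H h \<bullet> k) - t^2 * (H k \<bullet> h)\<bar> = t^2 * \<bar>H h \<bullet> k - H k \<bullet> h\<bar>"
      by (simp add: abs_mult flip: right_diff_distrib)
    ultimately have "t^2 * \<bar>H h \<bullet> k - H k \<bullet> h\<bar> \<le> t^2 * e" by (simp only: mult.commute)
    then show ?thesis using t(1) by simp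
  qed
  then have "\<bar>H h \<bullet> k - H k \<bullet> h\<bar> \<le> 0" by (rule field_le_epsilon[of _ 0]) simp
  then show ?thesis by simp
qed

lemma second_order_expansion_if_gradient_differentiable:
  fixes \<phi> :: "'a::real_inner \<Rightarrow> real"
  assumes U: "open U" "x \<in> U" and \<phi>: "\<And>y. y \<in> U \<Longrightarrow> (\<phi> has_derivative (\<lambda>h. g y \<bullet> h)) (at y)"
    and g: "(g has_derivative H) (at x)"
  shows "second_order_expansion \<phi> x (g x) (\<lambda>z. (H z \<bullet> z) / 2)"
  unfolding second_order_expansion_def
proof (intro allI impI)
  fix e :: real assume e: "0 < e"
  have H: "linear H" using g has_derivative_linear by blast
  obtain \<rho> where \<rho>: "\<rho> > 0" "ball x \<rho> \<subseteq> U" using U by (auto elim: openE)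
  obtain d where d: "0 < d" "\<And>z. norm z < d \<Longrightarrow> norm (g (x + z) - g x - H z) \<le> e * norm z"
    using gradient_linearization[OF g e] by blast
  show "\<exists>d>0. \<forall>z. norm z < d \<longrightarrow> \<bar>\<phi> (x + z) - \<phi> x - g x \<bullet> z - (H z \<bullet> z) / 2\<bar> \<le> e * (norm z)^2"
  proof (intro exI[of _ "min d \<rho>"] conjI allI impI)
    fix z :: 'a assume z: "norm z < min d \<rho>"
    have n: "norm (s *\<^sub>R z) \<le> norm z" if "0 \<le> s" "s \<le> 1" for s using that by (simp add: mult_left_le_one_le)
    define \<psi> where "\<psi> s = \<phi> (x + s *\<^sub>R z) - s * (g x \<bullet> z) - s^2 * ((H z \<bullet> z) / 2)" for s
    have "(\<psi> has_real_derivative (g (x + s *\<^sub>R z) \<bullet> z - g x \<bullet> z - s * (H z \<bullet> z))) (at s)" if s: "0 \<le> s" "s \<le> 1" for s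
    proof -
      have "x + s *\<^sub>R z \<in> U" using n[OF s] z by (intro set_mp[OF \<rho>(2)]) (simp add: dist_norm)
      then show ?thesis unfolding \<psi>_def by (auto intro!: derivative_eq_intros gradient_along_segment \<phi>)
    qed
    then obtain s where s: "0 < s" "s < 1" "\<psi> 1 - \<psi> 0 = (1 - 0) * (g (x + s *\<^sub>R z) \<bullet> z - g x \<bullet> z - s * (H z \<bullet> z))"
      using MVT2[of 0 1 \<psi> "\<lambda>s. g (x + s *\<^sub>R z) \<bullet> z - g x \<bullet> z - s * (H z \<bullet> z)"] by auto
    have "\<bar>\<psi> 1 - \<psi> 0\<bar> = \<bar>(g (x + s *\<^sub>R z) - g x - H (s *\<^sub>R z)) \<bullet> z\<bar>"
      unfolding s(3) by (simp add: inner_diff_left linear_scale[OF H])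
    also have "\<dots> \<le> norm (g (x + s *\<^sub>R z) - g x - H (s *\<^sub>R z)) * norm z" by (rule Cauchy_Schwarz_ineq2)
    also have "\<dots> \<le> e * norm (s *\<^sub>R z) * norm z" using d(2)[of "s *\<^sub>R z"] n[of s] s z by (intro mult_right_mono) auto
    also have "\<dots> \<le> e * norm z * norm z" using n[of s] s e by (intro mult_right_mono mult_left_mono) auto
    finally show "\<bar>\<phi> (x + z) - \<phi> x - g x \<bullet> z - (H z \<bullet> z) / 2\<bar> \<le> e * (norm z)^2"
      unfolding \<psi>_def by (simp add: power2_eq_square algebra_simps)
  qed (use d \<rho> in auto)
qed

section \<open>Symmetric matrices and Peano derivatives\<close>

lemma sym_matrices_iff: "A \<in> sym_matrices \<longleftrightarrow> (\<forall>v w. (A *v v) \<bullet> w = v \<bullet> (A *v w))"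
proof
  assume "A \<in> sym_matrices"
  then have "transpose A = A" unfolding sym_matrices_def by simp
  then show "\<forall>v w. (A *v v) \<bullet> w = v \<bullet> (A *v w)" by (metis dot_lmul_matrix vector_transpose_matrix inner_commute)
next
  assume *: "\<forall>v w. (A *v v) \<bullet> w = v \<bullet> (A *v w)"
  have "A $ i $ j = A $ j $ i" for i j
  proof -
    have "(A *v axis j 1) \<bullet> axis i 1 = axis j 1 \<bullet> (A *v axis i 1)" using * by blast
    then show ?thesis by (simp add: matrix_vector_mul_component inner_axis inner_axis' column_def matrix_vector_mult_basis)
  qed
  then show "A \<in> sym_matrices" unfolding sym_matrices_def transpose_def by (simp add: vec_eq_iff)
qed

lemma sym_matrices_add: "A \<in> sym_matrices \<Longrightarrow> B \<in> sym_matrices \<Longrightarrow> A + B \<in> sym_matrices"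
  by (simp add: sym_matrices_def transpose_def vec_eq_iff)

lemma sym_matrices_diff: "A \<in> sym_matrices \<Longrightarrow> B \<in> sym_matrices \<Longrightarrow> A - B \<in> sym_matrices"
  by (simp add: sym_matrices_def transpose_def vec_eq_iff)

lemma sym_matrices_scaled_id: "c *\<^sub>R mat 1 \<in> sym_matrices"
  by (simp add: sym_matrices_def transpose_def mat_def vec_eq_iff)

lemma scaled_id_mult: "(c *\<^sub>R mat 1) *v v = c *\<^sub>R v" for v :: "real ^ 'n"
  by (simp add: scaleR_matrix_vector_assoc[symmetric])

lemma has_peano_derivatives_iff:
  "has_peano_derivatives u p A x \<longleftrightarrow> A \<in> sym_matrices \<and> second_order_expansion u x p (\<lambda>z. ((A *v z) \<bullet> z) / 2)"
proof -
  define E where "E z = u (x + z) - u x - p \<bullet> z - ((A *v z) \<bullet> z) / 2" for z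
  have E: "u y - (u x + p \<bullet> (y - x) + 1 / 2 * ((A *v (y - x)) \<bullet> (y - x))) = E (y - x)" for y
    unfolding E_def by simp
  have shift: "(\<forall>y. y \<noteq> x \<and> dist y x < d \<longrightarrow> \<bar>E (y - x)\<bar> \<le> e * (norm (y - x))^2) \<longleftrightarrow>
      (\<forall>z. norm z < d \<longrightarrow> \<bar>E z\<bar> \<le> e * (norm z)^2)" for d e
  proof (intro iffI allI impI)
    fix z :: "real ^ 'a" assume *: "\<forall>y. y \<noteq> x \<and> dist y x < d \<longrightarrow> \<bar>E (y - x)\<bar> \<le> e * (norm (y - x))^2" "norm z < d"
    show "\<bar>E z\<bar> \<le> e * (norm z)^2"
    proof (cases "z = 0")
      case False
      then show ?thesis using *(1)[rule_format, of "x + z"] *(2) by (simp add: dist_norm)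
    qed (simp add: E_def)
  qed (simp add: dist_norm)
  show ?thesis
    unfolding has_peano_derivatives_def second_order_expansion_def E E_def[symmetric] shift[symmetric]
    by (simp add: smallo_def eventually_at)
qed

section \<open>Locally semiconvex functions\<close>

lemma norm_square_expand: "(norm (x + z))^2 = (norm x)^2 + 2 * (x \<bullet> z) + (norm z)^2" for x z :: "'a::real_inner"
  unfolding power2_norm_eq_inner by (simp add: inner_add_left inner_add_right inner_commute)

lemma locally_semiconvex_convex_ball:
  assumes "locally_semiconvex X u" "x \<in> X"
  obtains \<rho> \<mu> where "0 < \<rho>" "ball x \<rho> \<subseteq> X" "0 \<le> \<mu>" "convex_on (ball x \<rho>) (\<lambda>y. u y + \<mu> / 2 * (norm y)^2)"
proof -
  obtain c r \<mu> where c: "x \<in> ball c r" "ball c r \<subseteq> X" "0 \<le> \<mu>" "convex_on (ball c r) (\<lambda>y. u y + \<mu> / 2 * (norm y)^2)"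
    using assms unfolding locally_semiconvex_def by blast
  obtain \<rho> where \<rho>: "\<rho> > 0" "ball x \<rho> \<subseteq> ball c r" using openE[OF open_ball c(1)] by blast
  show thesis
    by (rule that[of \<rho> \<mu>]) (use \<rho> c convex_on_subset[OF c(4) \<rho>(2)] in auto)
qed

text \<open>
  The subgradient inequality of the convex function \<open>u + \<mu>/2 norm\<^sup>2\<close>, with the quadratic part expanded at \<open>x\<close>.
\<close>

lemma semiconvex_lower_paraboloid:
  fixes u :: "'a::euclidean_space \<Rightarrow> real"
  assumes S: "open S" and conv: "convex_on S (\<lambda>y. u y + \<mu> / 2 * (norm y)^2)" and x: "x \<in> S"
  shows "\<exists>p. \<forall>y\<in>S. u x + p \<bullet> (y - x) - \<mu> / 2 * (norm (y - x))^2 \<le> u y"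
proof -
  obtain p where p: "\<And>y. y \<in> S \<Longrightarrow> u x + \<mu> / 2 * (norm x)^2 + p \<bullet> (y - x) \<le> u y + \<mu> / 2 * (norm y)^2"
    by (rule convex_on_subgradient[OF S conv x]) blast
  show ?thesis
  proof (intro exI[of _ "p - \<mu> *\<^sub>R x"] ballI)
    fix y assume y: "y \<in> S"
    have "\<mu> / 2 * (norm y)^2 = \<mu> / 2 * (norm x)^2 + \<mu> * (x \<bullet> (y - x)) + \<mu> / 2 * (norm (y - x))^2"
    proof -
      have "(norm y)^2 = (norm x)^2 + 2 * (x \<bullet> (y - x)) + (norm (y - x))^2"
        using norm_square_expand[of x "y - x"] by simp
      then show ?thesis by (simp only: distrib_left)
    qed
    moreover have "(p - \<mu> *\<^sub>R x) \<bullet> (y - x) = p \<bullet> (y - x) - \<mu> * (x \<bullet> (y - x))" by (simp add: inner_diff_left)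
    ultimately show "u x + (p - \<mu> *\<^sub>R x) \<bullet> (y - x) - \<mu> / 2 * (norm (y - x))^2 \<le> u y"
      using p[OF y] by linarith
  qed
qed

lemma locally_semiconvex_continuous_on:
  assumes "locally_semiconvex X u" shows "continuous_on X u"
proof (rule continuous_at_imp_continuous_on, rule ballI)
  fix x assume "x \<in> X"
  then obtain \<rho> \<mu> where \<rho>: "0 < \<rho>" and conv: "convex_on (ball x \<rho>) (\<lambda>y. u y + \<mu> / 2 * (norm y)^2)"
    using locally_semiconvex_convex_ball[OF assms] by metis
  have "continuous_on (ball x \<rho>) (\<lambda>y. (u y + \<mu> / 2 * (norm y)^2) - \<mu> / 2 * (norm y)^2)"
    by (intro continuous_on_diff convex_on_continuous[OF open_ball conv] continuous_intros)
  then have "continuous_on (ball x \<rho>) u" by simp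
  then show "isCont u x" using \<rho> by (simp add: continuous_on_eq_continuous_at)
qed

text \<open>
  Alexandrov's theorem is applied on balls to \<open>u + \<mu>/2 norm\<^sup>2\<close>; subtracting the quadratic part shifts the Hessian by \<open>- \<mu> I\<close>.
  A set is null if each of its points has a relative neighbourhood that is null.
\<close>

lemma negligible_no_peano_derivatives:
  fixes u :: "real ^ 'n \<Rightarrow> real"
  assumes u: "locally_semiconvex X u"
  shows "negligible {x \<in> X. \<nexists>p A. has_peano_derivatives u p A x}" (is "negligible ?Z")
proof (rule locally_negligible_alt[THEN iffD2], rule ballI)
  fix x assume "x \<in> ?Z"
  then have "x \<in> X" by simp
  obtain \<rho> \<mu> where \<rho>: "0 < \<rho>" "ball x \<rho> \<subseteq> X" and "0 \<le> \<mu>" and conv: "convex_on (ball x \<rho>) (\<lambda>y. u y + \<mu> / 2 * (norm y)^2)"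
    by (rule locally_semiconvex_convex_ball[OF u \<open>x \<in> X\<close>])
  let ?v = "\<lambda>y. u y + \<mu> / 2 * (norm y)^2"
  define bad where "bad = {y \<in> ball x \<rho>. \<nexists>p L. linear L \<and> (\<forall>v w. L v \<bullet> w = v \<bullet> L w) \<and> second_order_expansion ?v y p (\<lambda>z. (L z \<bullet> z) / 2)}"
  have bad: "negligible bad" unfolding bad_def by (rule Alexandrov[OF open_ball conv])
  have "\<exists>p A. has_peano_derivatives u p A y" if y: "y \<in> ball x \<rho>" "y \<notin> bad" for y
  proof -
    obtain p L where L: "linear L" "\<And>v w. L v \<bullet> w = v \<bullet> L w" and exp: "second_order_expansion ?v y p (\<lambda>z. (L z \<bullet> z) / 2)"
      using y unfolding bad_def by blast
    define A where "A = matrix L - \<mu> *\<^sub>R mat 1"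
    have A: "A *v z = L z - \<mu> *\<^sub>R z" for z
      unfolding A_def by (simp add: matrix_vector_mult_diff_rdistrib scaled_id_mult matrix_works L(1))
    have "A \<in> sym_matrices" unfolding sym_matrices_iff A using L(2) by (simp add: inner_diff_left inner_diff_right)
    moreover have "second_order_expansion u y (p - \<mu> *\<^sub>R y) (\<lambda>z. ((A *v z) \<bullet> z) / 2)"
    proof -
      have h1: "((A *v z) \<bullet> z) / 2 = (L z \<bullet> z) / 2 - \<mu> / 2 * (norm z)^2" for z
        unfolding A by (simp add: inner_diff_left power2_norm_eq_inner[of z] diff_divide_distrib)
      have h2: "(p - \<mu> *\<^sub>R y) \<bullet> z = p \<bullet> z - \<mu> * (y \<bullet> z)" for z by (simp add: inner_diff_left)
      have h3: "\<mu> / 2 * (norm (y + z))^2 = \<mu> / 2 * (norm y)^2 + \<mu> * (y \<bullet> z) + \<mu> / 2 * (norm z)^2" for z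
        unfolding norm_square_expand by (simp only: distrib_left)
      have eq: "u (y + z) - u y - (p - \<mu> *\<^sub>R y) \<bullet> z - ((A *v z) \<bullet> z) / 2 = ?v (y + z) - ?v y - p \<bullet> z - (L z \<bullet> z) / 2" for z
        using h1[of z] h2[of z] h3[of z] by linarith
      show ?thesis using exp unfolding second_order_expansion_def by (simp only: eq)
    qed
    ultimately show ?thesis unfolding has_peano_derivatives_iff by blast
  qed
  then have "?Z \<inter> ball x \<rho> \<subseteq> bad" by blast
  then show "\<exists>U. openin (top_of_set ?Z) U \<and> x \<in> U \<and> negligible U"
    using \<rho>(1) \<open>x \<in> ?Z\<close> bad negligible_subset by (intro exI[of _ "?Z \<inter> ball x \<rho>"]) (auto simp: openin_open_Int)
qed

section \<open>Jets in the fibers of a primitive subequation\<close>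

lemma dist_Pair_le: "dist (a, b) (c, d) \<le> dist a c + dist b d"
  unfolding dist_Pair_Pair by (rule sqrt_sum_squares_le_sum) auto

lemma primitive_subequation_closed:
  assumes F: "primitive_subequation X F" and x: "x \<in> X" and A: "A \<in> sym_matrices"
    and approx: "\<And>e. 0 < e \<Longrightarrow> \<exists>y r' p' A'. (r', p', A') \<in> fiber F y \<and> dist y x < e \<and> dist r' r < e \<and> dist p' p < e \<and> dist A' A < e"
  shows "(r, p, A) \<in> fiber F x"
proof -
  obtain T where T: "closed T" "F = jet_space X \<inter> T"
    using F unfolding primitive_subequation_def closedin_closed by blast
  have "(x, r, p, A) \<in> closure F"
    unfolding closure_approachable
  proof (intro allI impI)
    fix e :: real assume "0 < e"
    then obtain y r' p' A' where y: "(r', p', A') \<in> fiber F y" "dist y x < e / 4" "dist r' r < e / 4" "dist p' p < e / 4" "dist A' A < e / 4"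
      using approx[of "e / 4"] by auto
    have "dist (y, r', p', A') (x, r, p, A) < e"
      using dist_Pair_le[of y "(r', p', A')" x "(r, p, A)"] dist_Pair_le[of r' "(p', A')" r "(p, A)"] dist_Pair_le[of p' A' p A] y(2-5)
      by linarith
    then show "\<exists>w\<in>F. dist w (x, r, p, A) < e" using y(1) unfolding fiber_def by blast
  qed
  moreover have "closure F \<subseteq> T" using T by (simp add: closure_minimal)
  moreover have "(x, r, p, A) \<in> jet_space X" unfolding jet_space_def using x A by simp
  ultimately show ?thesis unfolding fiber_def T(2) by blast
qed

lemma C2_near_quadratic:
  fixes x :: "real ^ 'n"
  assumes B: "B \<in> sym_matrices"
  shows "C2_near x (\<lambda>y. c + p \<bullet> (y - x) + ((B *v (y - x)) \<bullet> (y - x)) / 2) (\<lambda>y. p + B *v (y - x)) (\<lambda>y. B)"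
  unfolding C2_near_def
proof (intro exI[of _ UNIV] conjI ballI)
  fix y :: "real ^ 'n"
  have lin: "((\<lambda>y. B *v (y - x)) has_derivative (\<lambda>h. B *v h)) (at y)"
    by (rule bounded_linear.has_derivative[OF matrix_vector_mul_bounded_linear]) (auto intro!: derivative_eq_intros)
  show "((\<lambda>y. p + B *v (y - x)) has_derivative (\<lambda>h. B *v h)) (at y)"
    using lin by (auto intro!: derivative_eq_intros)
  have "((\<lambda>y. c + p \<bullet> (y - x) + ((B *v (y - x)) \<bullet> (y - x)) / 2) has_derivative
      (\<lambda>h. p \<bullet> h + ((B *v (y - x)) \<bullet> h + (B *v h) \<bullet> (y - x)) / 2)) (at y)"
    by (auto intro!: derivative_eq_intros lin)
  moreover have "p \<bullet> h + ((B *v (y - x)) \<bullet> h + (B *v h) \<bullet> (y - x)) / 2 = (p + B *v (y - x)) \<bullet> h" for h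
    using B[unfolded sym_matrices_iff, rule_format, of h "y - x"] by (simp add: inner_add_left inner_commute[of h])
  ultimately show "((\<lambda>y. c + p \<bullet> (y - x) + ((B *v (y - x)) \<bullet> (y - x)) / 2) has_derivative (\<lambda>h. (p + B *v (y - x)) \<bullet> h)) (at y)"
    by simp
qed auto

text \<open>
  The expansion at \<open>x\<close> is dominated by the quadratic polynomial with Hessian \<open>A + \<epsilon> I\<close>, which is therefore a test function.
\<close>

lemma subharmonic_peano_jet_in_fiber:
  fixes u :: "real ^ 'n \<Rightarrow> real"
  assumes F: "primitive_subequation X F" and u: "(\<lambda>x. ereal (u x)) \<in> subharmonics F X"
    and x: "x \<in> X" and peano: "has_peano_derivatives u p A x"
  shows "(u x, p, A) \<in> fiber F x"
proof (rule primitive_subequation_closed[OF F x])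
  show A: "A \<in> sym_matrices" using peano unfolding has_peano_derivatives_def by blast
  have exp: "second_order_expansion u x p (\<lambda>z. ((A *v z) \<bullet> z) / 2)" using peano unfolding has_peano_derivatives_iff by blast
  fix e :: real assume e: "0 < e"
  define \<epsilon> where "\<epsilon> = e / (norm (mat 1 :: real ^ 'n ^ 'n) + 1)"
  have \<epsilon>: "\<epsilon> > 0" unfolding \<epsilon>_def using e by (simp add: add_nonneg_pos)
  have small: "\<epsilon> * norm (mat 1 :: real ^ 'n ^ 'n) < e"
  proof -
    have "\<epsilon> * (norm (mat 1 :: real ^ 'n ^ 'n) + 1) = e" unfolding \<epsilon>_def by (simp add: add_nonneg_pos less_imp_neq[symmetric])
    then show ?thesis using \<epsilon> unfolding distrib_left by linarith
  qed
  define B where "B = A + \<epsilon> *\<^sub>R mat 1"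
  define \<phi> where "\<phi> y = u x + p \<bullet> (y - x) + ((B *v (y - x)) \<bullet> (y - x)) / 2" for y
  have C2: "C2_near x \<phi> (\<lambda>y. p + B *v (y - x)) (\<lambda>y. B)"
    unfolding \<phi>_def by (rule C2_near_quadratic) (use A in \<open>simp add: B_def sym_matrices_add sym_matrices_scaled_id\<close>)
  obtain d where d: "d > 0" "\<And>z. norm z < d \<Longrightarrow> \<bar>u (x + z) - u x - p \<bullet> z - ((A *v z) \<bullet> z) / 2\<bar> \<le> \<epsilon> / 2 * (norm z)^2"
    using exp[unfolded second_order_expansion_def, rule_format, of "\<epsilon> / 2"] \<epsilon> by auto
  have below: "u y \<le> \<phi> y" if y: "dist y x < d" for y
  proof -
    have "((B *v (y - x)) \<bullet> (y - x)) / 2 = ((A *v (y - x)) \<bullet> (y - x)) / 2 + \<epsilon> / 2 * (norm (y - x))^2"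
      unfolding B_def matrix_vector_mult_add_rdistrib scaled_id_mult
      by (simp add: inner_add_left power2_norm_eq_inner[of "y - x"] add_divide_distrib)
    moreover have "\<bar>u y - u x - p \<bullet> (y - x) - ((A *v (y - x)) \<bullet> (y - x)) / 2\<bar> \<le> \<epsilon> / 2 * (norm (y - x))^2"
      using d(2)[of "y - x"] y by (metis add.commute diff_add_cancel dist_norm)
    ultimately show ?thesis unfolding \<phi>_def by linarith
  qed
  have "\<forall>\<^sub>F y in nhds x. y \<in> X \<longrightarrow> ereal (u y) - ereal (\<phi> y) \<le> 0"
    unfolding eventually_nhds_metric using d(1) below by (intro exI[of _ d]) (auto simp: zero_ereal_def)
  moreover have "ereal (u x) - ereal (\<phi> x) = 0" unfolding \<phi>_def by (simp add: zero_ereal_def)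
  ultimately have "(\<phi> x, p + B *v (x - x), B) \<in> fiber F x"
    using u x C2 unfolding subharmonics_def by blast
  then have "(u x, p, B) \<in> fiber F x" unfolding \<phi>_def by simp
  moreover have "dist B A < e" using small \<epsilon> unfolding B_def by (simp add: dist_norm)
  ultimately show "\<exists>y r' p' A'. (r', p', A') \<in> fiber F y \<and> dist y x < e \<and> dist r' (u x) < e \<and> dist p' p < e \<and> dist A' A < e"
    using e by (intro exI[of _ x] exI[of _ "u x"] exI[of _ p] exI[of _ B]) auto
qed

text \<open>
  Jensen's lemma is applied to the second-order Taylor polynomial of \<open>\<phi>\<close> at \<open>x0\<close> with \<open>4 \<epsilon> I\<close> added to its Hessian. This adds
  \<open>2 \<epsilon> |z|\<^sup>2\<close> to the polynomial: one half absorbs the Taylor remainder, the other makes the contact strict.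
\<close>

lemma test_jet_in_fiber:
  fixes u :: "real ^ 'n \<Rightarrow> real"
  assumes X: "open X" and F: "primitive_subequation X F" and u: "locally_semiconvex X u"
    and N: "negligible {x \<in> X. \<not> (\<exists>p A. has_peano_derivatives u p A x \<and> (u x, p, A) \<in> fiber F x)}" (is "negligible ?N")
    and x0: "x0 \<in> X" and C2: "C2_near x0 \<phi> g H" and touch: "u x0 = \<phi> x0"
    and below: "\<forall>\<^sub>F y in nhds x0. y \<in> X \<longrightarrow> u y \<le> \<phi> y"
  shows "(\<phi> x0, g x0, H x0) \<in> fiber F x0"
proof -
  obtain U where U: "open U" "x0 \<in> U" and d\<phi>: "\<And>y. y \<in> U \<Longrightarrow> (\<phi> has_derivative (\<lambda>h. g y \<bullet> h)) (at y)"
    and dg: "\<And>y. y \<in> U \<Longrightarrow> (g has_derivative (\<lambda>h. H y *v h)) (at y)"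
    using C2 unfolding C2_near_def by blast
  have Hsym: "H x0 \<in> sym_matrices"
    unfolding sym_matrices_iff using second_derivative_symmetric[OF U d\<phi> dg[OF U(2)]] by (simp add: inner_commute)
  have taylor: "second_order_expansion \<phi> x0 (g x0) (\<lambda>z. ((H x0 *v z) \<bullet> z) / 2)"
    by (rule second_order_expansion_if_gradient_differentiable[OF U d\<phi> dg[OF U(2)]])
  obtain \<rho> \<mu> where \<rho>: "0 < \<rho>" "ball x0 \<rho> \<subseteq> X" and \<mu>: "0 \<le> \<mu>" "convex_on (ball x0 \<rho>) (\<lambda>y. u y + \<mu> / 2 * (norm y)^2)"
    by (rule locally_semiconvex_convex_ball[OF u x0])
  obtain d0 where d0: "d0 > 0" "\<And>y. dist y x0 < d0 \<Longrightarrow> y \<in> X \<Longrightarrow> u y \<le> \<phi> y"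
    using below unfolding eventually_nhds_metric by blast
  have ucont: "continuous_on X u" by (rule locally_semiconvex_continuous_on[OF u])
  show ?thesis
  proof (rule primitive_subequation_closed[OF F x0 Hsym])
    fix e :: real assume e: "0 < e"
    define c where "c = norm (mat 1 :: real ^ 'n ^ 'n)"
    define \<epsilon> where "\<epsilon> = e / (6 * (c + 1))"
    have n1: "c + 1 > 0" unfolding c_def by (simp add: add_nonneg_pos)
    have \<epsilon>: "\<epsilon> > 0" unfolding \<epsilon>_def using e n1 by simp
    have small: "5 * \<epsilon> * c < e"
    proof -
      have "K \<noteq> 0 \<Longrightarrow> 6 * (e / (6 * K)) * K = e" for K by simp
      from this[OF less_imp_neq[OF n1, symmetric]]
      have "6 * \<epsilon> * (c + 1) = e" unfolding \<epsilon>_def .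
      moreover have "5 * \<epsilon> * c < 6 * \<epsilon> * (c + 1)"
        using \<epsilon> by (intro mult_less_le_imp_less mult_strict_mono') (auto simp: c_def)
      ultimately show ?thesis by linarith
    qed
    define M where "M = H x0 + (4 * \<epsilon>) *\<^sub>R mat 1"
    have Msym: "M \<in> sym_matrices" unfolding M_def using Hsym by (intro sym_matrices_add sym_matrices_scaled_id)
    have Mv: "M *v z = H x0 *v z + (4 * \<epsilon>) *\<^sub>R z" for z
      unfolding M_def by (simp add: matrix_vector_mult_add_rdistrib scaled_id_mult)
    obtain d1 where d1: "d1 > 0" "\<And>z. norm z < d1 \<Longrightarrow> \<bar>\<phi> (x0 + z) - \<phi> x0 - g x0 \<bullet> z - ((H x0 *v z) \<bullet> z) / 2\<bar> \<le> \<epsilon> * (norm z)^2"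
      using taylor \<epsilon> unfolding second_order_expansion_def by blast
    define R where "R = min \<rho> (min d0 d1)"
    have R: "0 < R" "R \<le> \<rho>" "R \<le> d0" "R \<le> d1" unfolding R_def using \<rho> d0 d1 by auto
    have BX: "ball x0 R \<subseteq> X" using \<rho>(2) R(2) by auto
    have upper: "u y \<le> u x0 + g x0 \<bullet> (y - x0) + ((M *v (y - x0)) \<bullet> (y - x0)) / 2 - \<epsilon> * (norm (y - x0))^2" if y: "y \<in> ball x0 R" for y
    proof -
      have dy: "dist y x0 < R" using y by (simp add: dist_commute)
      have "u y \<le> \<phi> y" using d0(2) dy R BX y by auto
      moreover have "\<phi> y \<le> \<phi> x0 + g x0 \<bullet> (y - x0) + ((H x0 *v (y - x0)) \<bullet> (y - x0)) / 2 + \<epsilon> * (norm (y - x0))^2"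
        using d1(2)[of "y - x0"] dy R(4) by (simp add: dist_norm abs_le_iff)
      moreover have "((M *v (y - x0)) \<bullet> (y - x0)) / 2 = ((H x0 *v (y - x0)) \<bullet> (y - x0)) / 2 + 2 * (\<epsilon> * (norm (y - x0))^2)"
        unfolding Mv by (simp add: inner_add_left power2_norm_eq_inner[of "y - x0"] add_divide_distrib)
      ultimately show ?thesis using touch by linarith
    qed
    obtain B where B: "B > 0" "\<And>z. norm (M *v z) \<le> B * norm z"
      using linear_bounded_pos[OF matrix_vector_mul_linear[of M]] by blast
    obtain \<delta> where \<delta>: "\<delta> > 0" "\<And>y. y \<in> X \<Longrightarrow> dist y x0 < \<delta> \<Longrightarrow> dist (u y) (u x0) < e"
      using ucont x0 e unfolding continuous_on_iff by blast
    define \<eta> where "\<eta> = min (min e \<delta>) (e / (B + 1))"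
    have \<eta>: "0 < \<eta>" "\<eta> \<le> e" "\<eta> \<le> \<delta>" "\<eta> \<le> e / (B + 1)" unfolding \<eta>_def using e \<delta> B by auto
    obtain x q where x: "x \<in> ball x0 \<eta>" "x \<in> ball x0 R" "x \<notin> ?N" and q: "norm q < \<eta>"
      and contact: "\<And>y. y \<in> ball x0 R \<Longrightarrow> u y \<le> u x + (g x0 + M *v (x - x0) + q) \<bullet> (y - x) + ((M *v (y - x)) \<bullet> (y - x)) / 2"
    proof (rule tilted_contact_outside_negligible[where M = "\<lambda>z. M *v z" and C = "\<mu> / 2" and u = u and ?p0.0 = "g x0", OF R(1) \<eta>(1) _ \<epsilon> N])
      show "(M *v v) \<bullet> w = v \<bullet> (M *v w)" for v w using Msym unfolding sym_matrices_iff by blast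
      show "continuous_on (ball x0 R) u" by (rule continuous_on_subset[OF ucont BX])
      show "\<exists>p. \<forall>y\<in>ball x0 R. u x + p \<bullet> (y - x) - \<mu> / 2 * (norm (y - x))^2 \<le> u y" if "x \<in> ball x0 R" for x
      proof (rule semiconvex_lower_paraboloid[OF open_ball _ that])
        show "convex_on (ball x0 R) (\<lambda>y. u y + \<mu> / 2 * (norm y)^2)" by (rule convex_on_subset[OF \<mu>(2)]) (use R in auto)
      qed
    qed (use \<mu> upper matrix_vector_mul_linear in auto)
    have xX: "x \<in> X" using x(2) BX by blast
    then obtain p A where pA: "has_peano_derivatives u p A x" "(u x, p, A) \<in> fiber F x" using x(3) by blast
    have Asym: "A \<in> sym_matrices" and exp: "second_order_expansion u x p (\<lambda>z. ((A *v z) \<bullet> z) / 2)"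
      using pA(1) unfolding has_peano_derivatives_iff by blast+
    obtain r where r: "r > 0" "ball x r \<subseteq> ball x0 R" using openE[OF open_ball x(2)] by blast
    have up: "u (x + z) \<le> u x + (g x0 + M *v (x - x0) + q) \<bullet> z + ((M *v z) \<bullet> z) / 2" if z: "norm z < r" for z
    proof -
      have "x + z \<in> ball x r" using z by (simp add: dist_norm)
      then show ?thesis using contact[of "x + z"] r(2) by auto
    qed
    note cmp = second_order_expansion_le_upper_contact[OF exp matrix_vector_mul_linear matrix_vector_mul_linear r(1) up]
    have p_eq: "p = g x0 + M *v (x - x0) + q" by (rule cmp(1))
    \<comment> \<open>At the contact point \<open>A \<le> M\<close>; the extra \<open>\<epsilon> I\<close> makes the difference positive definite, as positivity requires.\<close>
    define P where "P = (M - A) + \<epsilon> *\<^sub>R mat 1"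
    have "pos_def P" unfolding pos_def_def
    proof (intro conjI allI impI)
      show "P \<in> sym_matrices" unfolding P_def using Msym Asym by (intro sym_matrices_add sym_matrices_diff sym_matrices_scaled_id)
      fix v :: "real ^ 'n" assume "v \<noteq> 0"
      then have "0 < \<epsilon> * (v \<bullet> v)" using \<epsilon> by simp
      moreover have "(P *v v) \<bullet> v = (M *v v) \<bullet> v - (A *v v) \<bullet> v + \<epsilon> * (v \<bullet> v)"
        unfolding P_def by (simp add: matrix_vector_mult_add_rdistrib matrix_vector_mult_diff_rdistrib scaled_id_mult inner_add_left inner_diff_left)
      ultimately show "0 < (P *v v) \<bullet> v" using cmp(2)[of v] by linarith
    qed
    then have "(u x, p, A + P) \<in> fiber F x" using F pA(2) xX unfolding primitive_subequation_def by blast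
    moreover have "dist x x0 < e" "dist (u x) (\<phi> x0) < e"
      using x(1) \<eta> \<delta>(2)[OF xX] touch by (auto simp: dist_commute)
    moreover have "dist p (g x0) < e"
    proof -
      have "dist p (g x0) = norm (M *v (x - x0) + q)" unfolding p_eq by (simp add: dist_norm)
      also have "\<dots> \<le> B * norm (x - x0) + norm q" using norm_triangle_ineq[of "M *v (x - x0)" q] B(2)[of "x - x0"] by linarith
      also have "\<dots> < B * \<eta> + \<eta>" using x(1) q B(1) by (intro add_le_less_mono mult_left_mono) (auto simp: dist_norm norm_minus_commute)
      also have "\<dots> = (B + 1) * \<eta>" by (simp add: algebra_simps)
      also have "\<dots> \<le> (B + 1) * (e / (B + 1))" using \<eta>(4) B(1) by (intro mult_left_mono) auto
      also have "\<dots> = e" using B(1) by simp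
      finally show ?thesis .
    qed
    moreover have "dist (A + P) (H x0) < e"
    proof -
      have "A + P - H x0 = (5 * \<epsilon>) *\<^sub>R mat 1" unfolding P_def M_def by (simp add: scaleR_left_distrib[symmetric])
      then show ?thesis using small \<epsilon> unfolding c_def by (simp add: dist_norm)
    qed
    ultimately show "\<exists>y r' p' A'. (r', p', A') \<in> fiber F y \<and> dist y x0 < e \<and> dist r' (\<phi> x0) < e \<and> dist p' (g x0) < e \<and> dist A' (H x0) < e"
      by blast
  qed
qed

theorem theorem8p1:
  fixes X :: "(real ^ 'n) set"
    and F :: "((real ^ 'n) \<times> 'n jet) set"
    and u :: "real ^ 'n \<Rightarrow> real"
  assumes "open X"
    and "primitive_subequation X F"
    and "locally_semiconvex X u"
  shows "(AE x in lebesgue_on X.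
            \<exists>p A. has_peano_derivatives u p A x \<and> (u x, p, A) \<in> fiber F x)
         \<longleftrightarrow> (\<lambda>x. ereal (u x)) \<in> subharmonics F X"
proof -
  let ?good = "\<lambda>x. \<exists>p A. has_peano_derivatives u p A x \<and> (u x, p, A) \<in> fiber F x"
  have AE_iff: "(AE x in lebesgue_on X. ?good x) \<longleftrightarrow> negligible {x \<in> X. \<not> ?good x}"
  proof -
    have "X \<in> sets lebesgue" using assms(1) by simp
    then have "(AE x in lebesgue_on X. ?good x) \<longleftrightarrow> (AE x in lebesgue. x \<in> X \<longrightarrow> ?good x)"
      by (simp add: AE_restrict_space_iff)
    also have "\<dots> \<longleftrightarrow> {x. \<not> (x \<in> X \<longrightarrow> ?good x)} \<in> null_sets lebesgue"
      by (simp add: eventually_ae_filter Bex_def flip: negligible_iff_null_sets) (meson negligible_subset order_refl)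
    also have "{x. \<not> (x \<in> X \<longrightarrow> ?good x)} = {x \<in> X. \<not> ?good x}" by blast
    finally show ?thesis unfolding negligible_iff_null_sets .
  qed
  show ?thesis unfolding AE_iff
  proof
    assume N: "negligible {x \<in> X. \<not> ?good x}"
    have "usc_on X (\<lambda>x. ereal (u x))"
      unfolding usc_on_def
    proof
      fix c
      have "continuous_on X (\<lambda>x. ereal (u x))" using locally_semiconvex_continuous_on[OF assms(3)] by (intro continuous_intros)
      then have "openin (top_of_set X) (X \<inter> (\<lambda>x. ereal (u x)) -` {..<c})" by (rule continuous_openin_preimage_gen) simp
      then show "openin (top_of_set X) {x \<in> X. ereal (u x) < c}" by (simp add: vimage_def Int_def)
    qed
    moreover have "(\<phi> x, g x, H x) \<in> fiber F x"
      if x: "x \<in> X" and C2: "C2_near x \<phi> g H" and below: "\<forall>\<^sub>F y in nhds x. y \<in> X \<longrightarrow> ereal (u y) - ereal (\<phi> y) \<le> 0"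
        and touch: "ereal (u x) - ereal (\<phi> x) = 0" for x \<phi> g H
      by (rule test_jet_in_fiber[OF assms N x C2]) (use below touch in \<open>auto simp: zero_ereal_def\<close>)
    ultimately show "(\<lambda>x. ereal (u x)) \<in> subharmonics F X" unfolding subharmonics_def by auto
  next
    assume "(\<lambda>x. ereal (u x)) \<in> subharmonics F X"
    then have "?good x" if "x \<in> X" "has_peano_derivatives u p A x" for x p A
      using subharmonic_peano_jet_in_fiber[OF assms(2)] that by blast
    then show "negligible {x \<in> X. \<not> ?good x}"
      by (intro negligible_subset[OF negligible_no_peano_derivatives[OF assms(3)]]) blast
  qed
qed

end
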